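(* Consider the controlled Markov chain $(\mathbb{X},\mathbb{U},\mathcal{U},\mathcal{T},c)$ and the conditions (A), (A'), (B), (B'), (C), (D), (E) described in the context. (a) If (A), (B), (C), (D) hold, then there exists an optimal measure in $\mathcal{G}$, i.e. a measure $\mu_*\in\mathcal{G}$ with $\langle\mu_*,c\rangle=\inf_{\mu\in\mathcal{G}}\langle\mu,c\rangle$. (b) If (A'), (B'), (D), (E) hold, then there exists a stationary (possibly randomized) policy $\phi\in\Gamma_{\mathsf S}$ that is optimal for every initial condition, i.e. $J(x,\phi)=\inf_{\gamma\in\Gamma_{\mathsf A}}J(x,\gamma)$ for every $x\in\mathbb{X}$.
   Context: **Model.** The state space $\mathbb{X}$ and action space $\mathbb{U}$ are Borel subsets of Polish spaces; $\mathcal{B}(\cdot)$ denotes the Borel $\sigma$-field and $\mathcal{P}(\cdot)$ the set of Borel probability measures. $\mathcal{U}:\mathbb{X}\to\mathcal{B}(\mathbb{U})$ is a strict (nonempty-valued) measurable multifunction, and $\mathbb{K}=\{(x,u): x\in\mathbb{X},\,u\in\mathcal{U}(x)\}$ has the subspace topology from $\mathbb{X}\times\mathbb{U}$. $\mathcal{T}(\cdot\mid x,u)$ is a stochastic kernel on $\mathbb{X}$ given $\mathbb{K}$. The one-stage cost $c:\mathbb{K}\to\mathbb{R}_+$ is measurable. An admissible policy $\gamma=\{\gamma_t\}_{t\ge0}$ is a sequence of stochastic kernels on $\mathbb{U}$ given histories $h_t=(x_0,u_0,\dots,u_{t-1},x_t)$ with $\gamma_t(\mathcal{U}(x_t)\mid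 h_t)=1$; $\Gamma_{\mathsf A}$ is the set of all of them. With an initial law it determines the law of the process $(X_t,U_t)_{t\ge 0}$, where $X_{t+1}\sim\mathcal{T}(\cdot\mid X_t,U_t)$ given the past; $\mathbb{E}^\gamma_x$ is expectation when $X_0=x$. $\Gamma_{\mathsf S}$ is the set of stationary policies: $\gamma_t(\cdot\mid h_t)=\gamma(\cdot\mid x_t)$ for a fixed stochastic kernel $\gamma$ with $\gamma(\mathcal{U}(x)\mid x)=1$. Average cost: $J(x,\gamma)=\limsup_{T\to\infty}\frac1T\mathbb{E}^\gamma_x\big[\sum_{t=0}^{T-1}c(X_t,U_t)\big]$. For $\mu\in\mathcal{P}(\mathbb{K})$ write $\langle\mu,c\rangle=\int_{\mathbb{K}}c\,d\mu$ and $\mu\mathcal{T}(A)=\int_{\mathbb{K}}\mathcal{T}(A\mid x,u)\,\mu(dx,du)$. The set of invariant (ergodic) occupation measures is $$\mathcal{G}=\{\mu\in\mathcal{P}(\mathbb{K}):\ \mu(B\times\mathbb{U})=\mu\mathcal{T}(B)\ \ \forall B\in\mathcal{B}(\mathbb{X})\}.$$ **Conditions.** - (A) $\mathbb{X}$ and $\mathbb{U}$ are Polish, $\mathbb{K}$ is a measurable set, and $\mathcal{U}$ is compact-valued. - (A') $\mathbb{X}$ and $\mathbb{U}$ are compact, $\mathbb{K}$ is a measurable set, and $\mathcal{U}$ is compact-valued. - (B) $c$ is non-negative, $u\mapsto c(x,u)$ is continuous on $\mathcal{U}(x)$ for every $x\in\mathbb{X}$, and $c$ is inf-compact: $\{(x,u)\in\mathbb{K}: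 c(x,u)\le\alpha\}$ is compact for every $\alpha\in\mathbb{R}_+$. - (B') $c$ is bounded, and $u\mapsto c(x,u)$ is continuous on $\mathcal{U}(x)$ for every $x\in\mathbb{X}$. - (C) There exist a policy and an initial state leading to a finite cost $\eta\in\mathbb{R}_+$. - (D) The kernel $\mathcal{T}$ satisfies: (a) for every $x\in\mathbb{X}$ and every bounded measurable $f:\mathbb{X}\to\mathbb{R}$, the map $u\mapsto\int f(z)\,\mathcal{T}(dz\mid x,u)$ is continuous; (b) there is a finite measure $\nu$ on $\mathbb{X}$ with $\mathcal{T}(A\mid x,u)\le\nu(A)$ for all $A\in\mathcal{B}(\mathbb{X})$ and all $x$, $u$. (These are understood for $(x,u)\in\mathbb{K}$, where $\mathcal{T}$ is defined.) - (E) Under every stationary policy, the induced Markov chain on $\mathbb{X}$ is Harris recurrent. *)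

theory Defs
  imports "HOL-Probability.Probability"
begin

text \<open>The Polish spaces containing the state and action spaces are types of class
  \<^class>\<open>polish_space\<close>; the state and action spaces are subsets of these types. The kernel and
  the cost matter only on \<open>\<K>\<close>, the set \<open>graph_set\<close> below; their values elsewhere are never used.\<close>

record ('x, 'u) control_model =
  states :: "'x set"
  actions :: "'u set"
  feasible :: "'x \<Rightarrow> 'u set"
  kernel :: "'x \<times> 'u \<Rightarrow> 'x measure"
  cost :: "'x \<times> 'u \<Rightarrow> real"

definition graph_set :: "('x, 'u) control_model \<Rightarrow> ('x \<times> 'u) set" where
  "graph_set M = {(x, u). x \<in> states M \<and> u \<in> feasible M x}"

definition borel_states :: "('x::topological_space, 'u) control_model \<Rightarrow> 'x measure" where
  "borel_states M = restrict_space borel (states M)"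

definition borel_actions :: "('x, 'u::topological_space) control_model \<Rightarrow> 'u measure" where
  "borel_actions M = restrict_space borel (actions M)"

definition borel_graph ::
    "('x::topological_space, 'u::topological_space) control_model \<Rightarrow> ('x \<times> 'u) measure" where
  "borel_graph M = restrict_space borel (graph_set M)"

text \<open>Measurability of the multifunction is the usual (lower) one, through preimages of open sets;
  for compact values it coincides with the one through preimages of closed sets.\<close>

definition controlled_markov_chain ::
    "('x::polish_space, 'u::polish_space) control_model \<Rightarrow> bool" where
  "controlled_markov_chain M \<longleftrightarrow>
     states M \<in> sets borel \<and> actions M \<in> sets borel \<and>
     (\<forall>x\<in>states M. feasible M x \<noteq> {} \<and> feasible M x \<subseteq> actions M \<and> feasible M x \<in> sets borel) \<and>
     (\<forall>G. open G \<longrightarrow> {x \<in> states M. feasible M x \<inter> G \<noteq> {}} \<in> sets borel) \<and>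
     kernel M \<in> measurable (borel_graph M) (prob_algebra (borel_states M)) \<and>
     cost M \<in> borel_measurable (borel_graph M) \<and>
     (\<forall>k\<in>graph_set M. 0 \<le> cost M k)"

text \<open>The history \<open>(x\<^sub>0, u\<^sub>0, \<dots>, u\<^bsub>t-1\<^esub>, x\<^sub>t)\<close> is the pair of the family
  \<open>(x\<^sub>i, u\<^sub>i)\<^bsub>i<t\<^esub>\<close> of points of \<open>\<K>\<close> and the current state \<open>x\<^sub>t\<close>.\<close>

type_synonym ('x, 'u) policy = "nat \<Rightarrow> (nat \<Rightarrow> 'x \<times> 'u) \<times> 'x \<Rightarrow> 'u measure"

definition histories ::
    "('x::topological_space, 'u::topological_space) control_model \<Rightarrow> nat
      \<Rightarrow> ((nat \<Rightarrow> 'x \<times> 'u) \<times> 'x) measure" where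
  "histories M t = PiM {0..<t} (\<lambda>_. borel_graph M) \<Otimes>\<^sub>M borel_states M"

definition admissible_policies ::
    "('x::topological_space, 'u::topological_space) control_model \<Rightarrow> ('x, 'u) policy set" where
  "admissible_policies M =
     {\<gamma>. \<forall>t. \<gamma> t \<in> measurable (histories M t) (prob_algebra (borel_actions M)) \<and>
          (\<forall>h\<in>space (histories M t). emeasure (\<gamma> t h) (feasible M (snd h)) = 1)}"

definition stationary_policies ::
    "('x::topological_space, 'u::topological_space) control_model \<Rightarrow> ('x, 'u) policy set" where
  "stationary_policies M =
     {\<lambda>t h. \<phi> (snd h) | \<phi>. \<phi> \<in> measurable (borel_states M) (prob_algebra (borel_actions M)) \<and>
          (\<forall>x\<in>states M. emeasure (\<phi> x) (feasible M x) = 1)}"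

text \<open>Conditional law of \<open>(X\<^sub>t, U\<^sub>t)\<close> given the past and \<open>X\<^sub>t = x\<close>. The restriction of \<open>\<gamma>\<^sub>t\<close> to
  \<open>\<U>(x)\<close>, a set of full measure, makes \<open>u \<mapsto> (x, u)\<close> a map into \<open>\<K>\<close>.\<close>

definition pair_law ::
    "('x::topological_space, 'u::topological_space) control_model \<Rightarrow> ('x, 'u) policy \<Rightarrow> nat
      \<Rightarrow> (nat \<Rightarrow> 'x \<times> 'u) \<Rightarrow> 'x \<Rightarrow> ('x \<times> 'u) measure" where
  "pair_law M \<gamma> t w x = distr (restrict_space (\<gamma> t (w, x)) (feasible M x)) (borel_graph M) (Pair x)"

definition step_law ::
    "('x::topological_space, 'u::topological_space) control_model \<Rightarrow> ('x, 'u) policy \<Rightarrow> 'x \<Rightarrow> nat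
      \<Rightarrow> (nat \<Rightarrow> 'x \<times> 'u) \<Rightarrow> ('x \<times> 'u) measure" where
  "step_law M \<gamma> x t w =
     (if t = 0 then pair_law M \<gamma> 0 w x
      else kernel M (w (t - 1)) \<bind> pair_law M \<gamma> t w)"

text \<open>Law of \<open>(X\<^sub>t, U\<^sub>t)\<^bsub>t\<ge>0\<^esub>\<close> under \<open>\<gamma>\<close> with \<open>X\<^sub>0 = x\<close>: the Ionescu-Tulcea measure built from
  \<^const>\<open>step_law\<close>.\<close>

definition process_law ::
    "('x::topological_space, 'u::topological_space) control_model \<Rightarrow> ('x, 'u) policy \<Rightarrow> 'x
      \<Rightarrow> (nat \<Rightarrow> 'x \<times> 'u) measure" where
  "process_law M \<gamma> x =
     projective_family.lim UNIV
       (Ionescu_Tulcea.CI (step_law M \<gamma> x) (\<lambda>_. borel_graph M)) (\<lambda>_. borel_graph M)"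

definition average_cost ::
    "('x::topological_space, 'u::topological_space) control_model \<Rightarrow> 'x \<Rightarrow> ('x, 'u) policy
      \<Rightarrow> ennreal" where
  "average_cost M x \<gamma> =
     limsup (\<lambda>T. (\<integral>\<^sup>+\<omega>. (\<Sum>t<T. ennreal (cost M (\<omega> t))) \<partial>process_law M \<gamma> x) / of_nat T)"

definition mean_cost ::
    "('x, 'u) control_model \<Rightarrow> ('x \<times> 'u) measure \<Rightarrow> ennreal" where
  "mean_cost M \<mu> = (\<integral>\<^sup>+k. ennreal (cost M k) \<partial>\<mu>)"

definition invariant_measures ::
    "('x::topological_space, 'u::topological_space) control_model \<Rightarrow> ('x \<times> 'u) measure set" where
  "invariant_measures M =
     {\<mu> \<in> space (prob_algebra (borel_graph M)).
        \<forall>B\<in>sets (borel_states M).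
          emeasure \<mu> ((B \<times> actions M) \<inter> graph_set M) = (\<integral>\<^sup>+k. emeasure (kernel M k) B \<partial>\<mu>)}"

definition polish_subspace :: "'a::topological_space set \<Rightarrow> bool" where
  "polish_subspace S \<longleftrightarrow>
     completely_metrizable_space (top_of_set S) \<and> second_countable (top_of_set S)"

definition cond_A :: "('x::polish_space, 'u::polish_space) control_model \<Rightarrow> bool" where
  "cond_A M \<longleftrightarrow>
     polish_subspace (states M) \<and> polish_subspace (actions M) \<and>
     graph_set M \<in> sets borel \<and> (\<forall>x\<in>states M. compact (feasible M x))"

definition cond_A' :: "('x::polish_space, 'u::polish_space) control_model \<Rightarrow> bool" where
  "cond_A' M \<longleftrightarrow>
     compact (states M) \<and> compact (actions M) \<and>
     graph_set M \<in> sets borel \<and> (\<forall>x\<in>states M. compact (feasible M x))"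

definition cond_B :: "('x::polish_space, 'u::polish_space) control_model \<Rightarrow> bool" where
  "cond_B M \<longleftrightarrow>
     (\<forall>k\<in>graph_set M. 0 \<le> cost M k) \<and>
     (\<forall>x\<in>states M. continuous_on (feasible M x) (\<lambda>u. cost M (x, u))) \<and>
     (\<forall>\<alpha>\<ge>0. compact {k \<in> graph_set M. cost M k \<le> \<alpha>})"

definition cond_B' :: "('x::polish_space, 'u::polish_space) control_model \<Rightarrow> bool" where
  "cond_B' M \<longleftrightarrow>
     bounded (cost M ` graph_set M) \<and>
     (\<forall>x\<in>states M. continuous_on (feasible M x) (\<lambda>u. cost M (x, u)))"

definition cond_C :: "('x::polish_space, 'u::polish_space) control_model \<Rightarrow> bool" where
  "cond_C M \<longleftrightarrow>
     (\<exists>\<gamma>\<in>admissible_policies M. \<exists>x\<in>states M. \<exists>\<eta>::real. 0 \<le> \<eta> \<and> average_cost M x \<gamma> = ennreal \<eta>)"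

definition cond_D :: "('x::polish_space, 'u::polish_space) control_model \<Rightarrow> bool" where
  "cond_D M \<longleftrightarrow>
     (\<forall>x\<in>states M. \<forall>f::'x \<Rightarrow> real.
        f \<in> borel_measurable (borel_states M) \<longrightarrow> bounded (f ` states M) \<longrightarrow>
        continuous_on (feasible M x) (\<lambda>u. \<integral>z. f z \<partial>kernel M (x, u))) \<and>
     (\<exists>\<nu>. finite_measure \<nu> \<and> sets \<nu> = sets (borel_states M) \<and>
        (\<forall>k\<in>graph_set M. \<forall>A\<in>sets (borel_states M). emeasure (kernel M k) A \<le> emeasure \<nu> A))"

text \<open>Harris recurrence of the state process: for some nontrivial \<open>\<sigma>\<close>-finite \<open>\<psi>\<close>, from every initial
  state every set of positive \<open>\<psi>\<close>-measure is visited infinitely often almost surely.\<close>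

definition harris_recurrent ::
    "('x::topological_space, 'u::topological_space) control_model \<Rightarrow> ('x, 'u) policy \<Rightarrow> bool" where
  "harris_recurrent M \<gamma> \<longleftrightarrow>
     (\<exists>\<psi>. sigma_finite_measure \<psi> \<and> sets \<psi> = sets (borel_states M) \<and> emeasure \<psi> (states M) > 0 \<and>
        (\<forall>A\<in>sets (borel_states M). emeasure \<psi> A > 0 \<longrightarrow>
          (\<forall>x\<in>states M. AE \<omega> in process_law M \<gamma> x. \<exists>\<^sub>\<infinity>t. fst (\<omega> t) \<in> A)))"

definition cond_E :: "('x::polish_space, 'u::polish_space) control_model \<Rightarrow> bool" where
  "cond_E M \<longleftrightarrow> (\<forall>\<gamma>\<in>stationary_policies M. harris_recurrent M \<gamma>)"

end

theory Submission
  imports Defs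
begin

text \<open>
  Everything rests on one limit theorem for laws of state-action pairs. Averaging the laws of the pairs
  at the times \<open>1, \<dots>, T\<close> under any policy gives a law whose state marginal is dominated by \<open>\<nu>\<close>, because
  every transition law is, and which satisfies the equation of invariance up to \<open>1/T\<close>, because the
  defect telescopes. The limit theorem (\<open>almost_invariant_limit\<close>) says: laws with state marginals
  dominated by \<open>\<nu>\<close>, with tight actions and with vanishing defect have, along a subsequence, a limit in
  the set of invariant measures whose mean cost is at most the limit inferior of their mean costs.
  So every finite average cost is bounded below by the mean cost of an invariant measure, and, applied to a
  minimizing sequence of invariant measures, the limit theorem yields a minimizer. For unbounded
  inf-compact costs, bounds on the mean cost supply the tightness; a policy of finite cost then
  guarantees that the infimum is finite. This is the first part.

  In the limit theorem the kernel and the cost are continuous in the action but only measurable in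
  the state, so weak convergence of laws is too weak. Domination by \<open>\<nu>\<close> helps: along a subsequence
  dominated measures converge on every measurable set of states (\<open>dominated_setwise_subsequence\<close>). To
  combine this with weak convergence of the actions, actions are coded by integer sequences, and a law
  of pairs becomes the family of its parts over the cylinders of codes. Each part has a setwise limit,
  and by tightness no mass escapes, so the densities of these limits are the cylinder weights of a
  random law of codes (\<open>cylinderwise_limit\<close>). Decoding gives the limit in the form of a state law \<open>m\<close>
  together with a kernel \<open>\<phi>\<close> from states to actions, that is, with a stationary policy. Functions that
  are Lipschitz in the action depend on finitely many digits up to a uniform error, so their integrals
  converge. A nonnegative integrand continuous in the action is the limit of Lipschitz minorants,
  measurable in the state because the infimum defining them runs over a dense sequence of measurable
  selections of the feasible actions (\<open>measurable_dense_selections\<close>). Hence integrals of such integrands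
  are lower semicontinuous (\<open>dominated_marginals_compactness\<close>), and those of bounded ones converge.

  For the second part, let the joint law of \<open>m\<close> and \<open>\<phi>\<close> be an optimal invariant measure. Under \<open>\<phi>\<close> the
  averaged state laws from any initial state have setwise limit points, all of which are invariant for
  the chain induced by \<open>\<phi>\<close>. Harris recurrence leaves only one invariant law (\<open>harris_unique_invariant\<close>):
  if two of them differ, the set where the density of the first is larger contains, from some initial
  state, the whole trajectory, and so does the set where the density of the second is larger. These
  sets are disjoint, and the complement of each is negligible for the recurrence measure, which would
  therefore vanish. So the averages converge to \<open>m\<close> from every initial state, and the average cost of
  \<open>\<phi>\<close> is the minimal mean cost, the lower bound for all policies.
\<close>

section \<open>Setwise compactness of dominated measures\<close>

text \<open>Intersection-stability is included so that statements about a generator extend to the whole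
  \<open>\<sigma>\<close>-algebra by a Dynkin argument.\<close>

definition countably_generated :: "'a measure \<Rightarrow> bool" where
  "countably_generated N \<longleftrightarrow>
     (\<exists>G. countable G \<and> G \<subseteq> Pow (space N) \<and> Int_stable G \<and> sets N = sigma_sets (space N) G)"

lemma countably_generated_restrict_borel:
  fixes S :: "'a::second_countable_topology set"
  assumes "S \<in> sets borel"
  shows "countably_generated (restrict_space borel S)"
proof -
  obtain B :: "'a set set" where B: "countable B" "topological_basis B"
    using ex_countable_basis by blast
  define C where "C = Inter ` {F. F \<subseteq> B \<and> finite F}"
  have C: "countable C" unfolding C_def
    using countable_Collect_finite_subset[OF B(1)] by (simp add: conj_commute)
  have opn: "open c" if "c \<in> C" for c
    using that topological_basis_open[OF B(2)] by (auto simp: C_def intro!: open_Inter)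
  have BC: "B \<subseteq> C" unfolding C_def by (auto intro!: image_eqI[of _ _ "{_}"])
  have sig: "sets borel = sigma_sets UNIV C"
  proof
    have "sets borel = sigma_sets UNIV B"
      by (subst borel_eq_countable_basis[OF B]) simp
    also have "\<dots> \<subseteq> sigma_sets UNIV C" by (rule sigma_sets_mono') (rule BC)
    finally show "sets borel \<subseteq> sigma_sets UNIV C" .
    show "sigma_sets UNIV C \<subseteq> sets borel"
      using opn sets.sigma_sets_subset[of C borel] by (auto simp: subset_eq)
  qed
  have int: "Int_stable C"
  proof (rule Int_stableI)
    fix a b assume "a \<in> C" "b \<in> C"
    then obtain F1 F2 where "a = Inter F1" "F1 \<subseteq> B" "finite F1" "b = Inter F2" "F2 \<subseteq> B" "finite F2"
      by (auto simp: C_def)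
    then show "a \<inter> b \<in> C" unfolding C_def by (intro image_eqI[of _ _ "F1 \<union> F2"]) auto
  qed
  show ?thesis unfolding countably_generated_def
  proof (intro exI[of _ "(\<inter>) S ` C"] conjI)
    show "countable ((\<inter>) S ` C)" using C by simp
    show "(\<inter>) S ` C \<subseteq> Pow (space (restrict_space borel S))" by (auto simp: space_restrict_space)
    show "Int_stable ((\<inter>) S ` C)"
    proof (rule Int_stableI, safe)
      fix a b assume "a \<in> C" "b \<in> C"
      then have "a \<inter> b \<in> C" using int by (simp add: Int_stable_def)
      then show "S \<inter> a \<inter> (S \<inter> b) \<in> (\<inter>) S ` C"
        by (rule image_eqI[rotated]) auto
    qed
    show "sets (restrict_space borel S) = sigma_sets (space (restrict_space borel S)) ((\<inter>) S ` C)"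
      using sigma_sets_Int[of S UNIV C] assms
      by (simp add: sets_restrict_space space_restrict_space sig) 
  qed
qed

text \<open>The diagonal argument, as sequential compactness of a countable product of intervals.\<close>

lemma bounded_family_convergent_subseq:
  fixes a :: "'i::countable \<Rightarrow> nat \<Rightarrow> real"
  assumes "\<And>i n. \<bar>a i n\<bar> \<le> B i"
  shows "\<exists>r. strict_mono r \<and> (\<forall>i. convergent (\<lambda>n. a i (r n)))"
proof -
  have "compact (PiE UNIV (\<lambda>i. {- B i..B i}))"
    using compactin_PiE[of "\<lambda>i. euclideanreal" UNIV "\<lambda>i. {- B i..B i}"]
    unfolding euclidean_product_topology by (simp only: compactin_euclidean_iff compact_Icc ball_triv simp_thms)
  then have "seq_compact (PiE UNIV (\<lambda>i. {- B i..B i}))" by (rule compact_imp_seq_compact)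
  moreover have "\<forall>n. (\<lambda>i. a i n) \<in> PiE UNIV (\<lambda>i. {- B i..B i})"
    using assms by (auto simp: abs_le_iff minus_le_iff)
  ultimately obtain l r where "strict_mono r" and l: "((\<lambda>n. (\<lambda>i. a i n)) \<circ> r) \<longlonglongrightarrow> l"
    by (metis seq_compactE)
  have "(\<lambda>n. a i (r n)) \<longlonglongrightarrow> l i" for i
    using continuous_on_tendsto_compose[OF continuous_on_product_coordinates[of i] l]
    by (simp add: comp_def)
  then show ?thesis using \<open>strict_mono r\<close> by (auto simp: convergent_def)
qed

text \<open>Domination makes the errors of all approximations from a generator uniform along the sequence,
  so convergence on the generator spreads to the whole \<open>\<sigma>\<close>-algebra and the limit is continuous at the
  empty set.\<close>

lemma dominated_setwise_limit:
  fixes m :: "nat \<Rightarrow> 'x measure"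
  assumes \<nu>: "finite_measure \<nu>" and gen: "G \<subseteq> Pow (space \<nu>)" "Int_stable G"
    "sets \<nu> = sigma_sets (space \<nu>) G"
    and m: "\<And>n. sets (m n) = sets \<nu>" "\<And>n A. A \<in> sets \<nu> \<Longrightarrow> emeasure (m n) A \<le> emeasure \<nu> A"
    and conv: "\<And>A. A \<in> G \<Longrightarrow> convergent (\<lambda>n. measure (m n) A)"
    "convergent (\<lambda>n. measure (m n) (space \<nu>))"
  shows "\<exists>m'. sets m' = sets \<nu> \<and> (\<forall>A\<in>sets \<nu>. emeasure m' A \<le> emeasure \<nu> A \<and>
           (\<lambda>n. measure (m n) A) \<longlonglongrightarrow> measure m' A)"
proof -
  interpret \<nu>: finite_measure \<nu> by fact
  have sp[simp]: "space (m n) = space \<nu>" for n by (rule sets_eq_imp_space_eq) (rule m)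
  have fin: "finite_measure (m n)" for n
  proof
    have "emeasure (m n) (space \<nu>) \<le> emeasure \<nu> (space \<nu>)" by (rule m(2)) simp
    then show "emeasure (m n) (space (m n)) \<noteq> \<infinity>"
      using \<nu>.emeasure_finite[of "space \<nu>"] by (auto simp: top_unique)
  qed
  have le: "measure (m n) A \<le> measure \<nu> A" if "A \<in> sets \<nu>" for n A
    using m(2)[OF that, of n] that
    by (simp add: \<nu>.emeasure_eq_measure finite_measure.emeasure_eq_measure[OF fin])
  have C: "convergent (\<lambda>n. measure (m n) A)" if "A \<in> sets \<nu>" for A
    using gen(2) gen(1) that[unfolded gen(3)]
  proof (induction rule: sigma_sets_induct_disjoint)
    case (basic A) then show ?case by (rule conv)
  next
    case empty then show ?case by (simp add: convergent_const)
  next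
    case (compl A)
    have "measure (m n) (space \<nu> - A) = measure (m n) (space \<nu>) - measure (m n) A" for n
      using finite_measure.finite_measure_compl[OF fin, of A n] compl m(1)[of n] gen(3) by simp
    then show ?case using convergent_diff[OF conv(2) compl(2)] by simp
  next
    case (union A)
    have A: "range A \<subseteq> sets \<nu>" using union(2) gen(3) by auto
    have s\<nu>: "(\<lambda>i. measure \<nu> (A i)) sums measure \<nu> (\<Union>i. A i)"
      using \<nu>.finite_measure_UNION A union(1) by blast
    have sm: "(\<lambda>i. measure (m n) (A i)) sums measure (m n) (\<Union>i. A i)" for n
      using finite_measure.finite_measure_UNION[OF fin, of A n] A union(1) m(1) by auto
    have "Cauchy (\<lambda>n. measure (m n) (\<Union>i. A i))"
    proof (rule metric_CauchyI)
      fix e :: real assume e: "0 < e"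
      from s\<nu> have "(\<lambda>k. \<Sum>i<k. measure \<nu> (A i)) \<longlonglongrightarrow> measure \<nu> (\<Union>i. A i)" by (simp add: sums_def)
      from tendstoD[OF this, of "e/3"] e obtain k
        where k: "dist (\<Sum>i<k. measure \<nu> (A i)) (measure \<nu> (\<Union>i. A i)) < e/3"
        by (auto simp: eventually_sequentially)
      have tail: "\<bar>measure (m n) (\<Union>i. A i) - (\<Sum>i<k. measure (m n) (A i))\<bar> < e/3" for n
      proof -
        have "measure (m n) (\<Union>i. A i) - (\<Sum>i<k. measure (m n) (A i)) = (\<Sum>i. measure (m n) (A (i+k)))"
          using suminf_minus_initial_segment[of "\<lambda>i. measure (m n) (A i)" k] sm[of n]
          by (auto simp: sums_iff)
        also have "\<dots> \<le> (\<Sum>i. measure \<nu> (A (i+k)))"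
          using sm[of n] s\<nu> A by (intro suminf_le le summable_ignore_initial_segment) (auto simp: sums_iff)
        also have "\<dots> = measure \<nu> (\<Union>i. A i) - (\<Sum>i<k. measure \<nu> (A i))"
          using suminf_minus_initial_segment[of "\<lambda>i. measure \<nu> (A i)" k] s\<nu> by (auto simp: sums_iff)
        also have "\<dots> < e/3" using k unfolding dist_real_def by linarith
        finally have "measure (m n) (\<Union>i. A i) - (\<Sum>i<k. measure (m n) (A i)) < e/3" .
        moreover have "(\<Sum>i<k. measure (m n) (A i)) \<le> measure (m n) (\<Union>i. A i)"
          using sm[of n] sum_le_suminf[of "\<lambda>i. measure (m n) (A i)" "{..<k}"] by (auto simp: sums_iff)
        ultimately show ?thesis by simp
      qed
      have "convergent (\<lambda>n. \<Sum>i<k. measure (m n) (A i))"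
        using union(3) by (intro convergent_sum) auto
      then have "Cauchy (\<lambda>n. \<Sum>i<k. measure (m n) (A i))" by (rule convergent_Cauchy)
      from metric_CauchyD[OF this, of "e/3"] e
      obtain N where N: "\<And>n n'. n \<ge> N \<Longrightarrow> n' \<ge> N \<Longrightarrow>
          dist (\<Sum>i<k. measure (m n) (A i)) (\<Sum>i<k. measure (m n') (A i)) < e/3"
        by auto
      show "\<exists>N. \<forall>n\<ge>N. \<forall>n'\<ge>N. dist (measure (m n) (\<Union>i. A i)) (measure (m n') (\<Union>i. A i)) < e"
      proof (intro exI allI impI)
        fix n n' assume "N \<le> n" "N \<le> n'"
        from N[OF this] tail[of n] tail[of n']
        show "dist (measure (m n) (\<Union>i. A i)) (measure (m n') (\<Union>i. A i)) < e"
          unfolding dist_real_def by linarith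
      qed
    qed
    then show ?case by (simp add: Cauchy_convergent_iff)
  qed
  define L where "L A = lim (\<lambda>n. measure (m n) A)" for A
  have L: "(\<lambda>n. measure (m n) A) \<longlonglongrightarrow> L A" if "A \<in> sets \<nu>" for A
    using C[OF that] by (simp add: L_def convergent_LIMSEQ_iff)
  have L0: "0 \<le> L A" if "A \<in> sets \<nu>" for A
    using L[OF that] by (rule LIMSEQ_le_const) auto
  have Lle: "L A \<le> measure \<nu> A" if "A \<in> sets \<nu>" for A
    using L[OF that] by (rule LIMSEQ_le_const2) (auto intro: le that)
  have Lempty: "L {} = 0" by (simp add: L_def)
  have Ladd: "L (A \<union> B) = L A + L B" if "A \<in> sets \<nu>" "B \<in> sets \<nu>" "A \<inter> B = {}" for A B
  proof -
    have "measure (m n) (A \<union> B) = measure (m n) A + measure (m n) B" for n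
      using that m(1) by (intro finite_measure.finite_measure_Union[OF fin]) auto
    then have "(\<lambda>n. measure (m n) (A \<union> B)) \<longlonglongrightarrow> L A + L B"
      using tendsto_add[OF L[OF that(1)] L[OF that(2)]] by simp
    with L[of "A \<union> B"] that show ?thesis by (auto intro: LIMSEQ_unique)
  qed
  define m' where "m' = measure_of (space \<nu>) (sets \<nu>) (\<lambda>A. ennreal (L A))"
  have pos: "positive (sets \<nu>) (\<lambda>A. ennreal (L A))" by (simp add: positive_def Lempty)
  have ca: "countably_additive (sets \<nu>) (\<lambda>A. ennreal (L A))"
  proof (rule sets.empty_continuous_imp_countably_additive[OF pos])
    show "additive (sets \<nu>) (\<lambda>A. ennreal (L A))"
      by (auto simp: additive_def Ladd L0 ennreal_plus[symmetric] simp del: ennreal_plus)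
    fix A :: "nat \<Rightarrow> 'x set" assume A: "range A \<subseteq> sets \<nu>" "decseq A" "(\<Inter>i. A i) = {}"
    have "(\<lambda>i. measure \<nu> (A i)) \<longlonglongrightarrow> 0"
      using \<nu>.finite_Lim_measure_decseq[OF A(1,2)] A(3) by simp
    then have "(\<lambda>i. L (A i)) \<longlonglongrightarrow> 0"
    proof (rule tendsto_sandwich[OF _ _ tendsto_const, rotated 2])
      have "A i \<in> sets \<nu>" for i using A by auto
      then show "\<forall>\<^sub>F i in sequentially. 0 \<le> L (A i)"
        "\<forall>\<^sub>F i in sequentially. L (A i) \<le> measure \<nu> (A i)"
        using L0 Lle by simp_all
    qed
    then show "(\<lambda>i. ennreal (L (A i))) \<longlonglongrightarrow> 0" using tendsto_ennrealI by fastforce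
  qed auto
  have em: "emeasure m' A = ennreal (L A)" if "A \<in> sets \<nu>" for A
    unfolding m'_def using that pos ca
    by (intro emeasure_measure_of_sigma) (auto simp: sets.sigma_algebra_axioms)
  show ?thesis
  proof (intro exI[of _ m'] conjI ballI)
    show "sets m' = sets \<nu>" by (simp add: m'_def)
    fix A assume A: "A \<in> sets \<nu>"
    show "emeasure m' A \<le> emeasure \<nu> A"
      by (simp add: em A \<nu>.emeasure_eq_measure Lle)
    show "(\<lambda>n. measure (m n) A) \<longlonglongrightarrow> measure m' A"
      using L[OF A] L0[OF A] em[OF A] by (simp add: measure_def)
  qed
qed

lemma dominated_setwise_subsequence:
  fixes m :: "'i::countable \<Rightarrow> nat \<Rightarrow> 'x measure"
  assumes \<nu>: "finite_measure \<nu>" "countably_generated \<nu>"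
    and m: "\<And>i n. sets (m i n) = sets \<nu>"
      "\<And>i n A. A \<in> sets \<nu> \<Longrightarrow> emeasure (m i n) A \<le> emeasure \<nu> A"
  shows "\<exists>r m'. strict_mono r \<and> (\<forall>i. sets (m' i) = sets \<nu> \<and>
           (\<forall>A\<in>sets \<nu>. emeasure (m' i) A \<le> emeasure \<nu> A \<and>
              (\<lambda>n. measure (m i (r n)) A) \<longlonglongrightarrow> measure (m' i) A))"
proof -
  interpret \<nu>: finite_measure \<nu> by fact
  from \<nu>(2) obtain G where G: "countable G" "G \<subseteq> Pow (space \<nu>)" "Int_stable G"
    "sets \<nu> = sigma_sets (space \<nu>) G" by (auto simp: countably_generated_def)
  \<comment> \<open>The total masses have to converge too: masses of complements are computed from them.\<close>
  define H where "H = insert (space \<nu>) G"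
  have H: "countable H" "H \<noteq> {}" using G by (auto simp: H_def)
  have Hs: "from_nat_into H k \<in> sets \<nu>" for k
    using from_nat_into[OF H(2), of k] G(4) by (auto simp: H_def intro: sigma_sets.Basic)
  have "\<bar>measure (m i n) A\<bar> \<le> measure \<nu> A" if "A \<in> sets \<nu>" for i n A
    using enn2real_mono[OF m(2)[OF that, of i n]] \<nu>.emeasure_finite[of A]
    by (simp add: measure_def less_top[symmetric])
  then have "\<exists>r. strict_mono r \<and> (\<forall>p::'i \<times> nat. convergent (\<lambda>n. measure (m (fst p) (r n)) (from_nat_into H (snd p))))"
    by (intro bounded_family_convergent_subseq[of "\<lambda>p n. measure (m (fst p) n) (from_nat_into H (snd p))"
          "\<lambda>p. measure \<nu> (from_nat_into H (snd p))"]) (auto intro: Hs)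
  then obtain r where r: "strict_mono r"
    and c: "\<And>i k. convergent (\<lambda>n. measure (m i (r n)) (from_nat_into H k))" by auto
  have c': "convergent (\<lambda>n. measure (m i (r n)) A)" if "A \<in> H" for i A
    using c[of i] from_nat_into_surj[OF H(1) that] by auto
  have "\<exists>m'. sets m' = sets \<nu> \<and> (\<forall>A\<in>sets \<nu>. emeasure m' A \<le> emeasure \<nu> A \<and>
           (\<lambda>n. measure (m i (r n)) A) \<longlonglongrightarrow> measure m' A)" for i
    by (rule dominated_setwise_limit[OF \<nu>(1) G(2-4)]) (use m c' in \<open>auto simp: H_def\<close>)
  then show ?thesis using r by metis
qed

text \<open>A bounded function is a uniform limit of functions with finitely many values, and
  convergent total masses are bounded, so the error is uniform along the sequence.\<close>

lemma setwise_imp_integral_tendsto: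
  fixes f :: "'x \<Rightarrow> real"
  assumes fin: "\<And>n. finite_measure (m n)" "finite_measure m'"
    and sets: "\<And>n. sets (m n) = sets N" "sets m' = sets N"
    and conv: "\<And>A. A \<in> sets N \<Longrightarrow> (\<lambda>n. measure (m n) A) \<longlonglongrightarrow> measure m' A"
    and f: "f \<in> borel_measurable N" "\<And>x. x \<in> space N \<Longrightarrow> \<bar>f x\<bar> \<le> B"
  shows "(\<lambda>n. \<integral>x. f x \<partial>m n) \<longlonglongrightarrow> (\<integral>x. f x \<partial>m')"
proof -
  have sp: "space (m n) = space N" "space m' = space N" for n
    using sets by (auto dest: sets_eq_imp_space_eq)
  obtain C where C: "\<And>n. measure (m n) (space N) \<le> C" "measure m' (space N) \<le> C" "C > 0"
  proof -
    from conv[of "space N"] have "Bseq (\<lambda>n. measure (m n) (space N))"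
      by (intro convergent_imp_Bseq) (auto simp: convergent_def)
    then obtain K where "\<And>n. \<bar>measure (m n) (space N)\<bar> \<le> K" by (auto simp: Bseq_def)
    then show ?thesis by (intro that[of "max (max K 1) (measure m' (space N))"]) (auto simp: max_def intro: order_trans)
  qed
  show ?thesis
  proof (rule LIMSEQ_I)
    fix e :: real assume e: "0 < e"
    define d where "d = e / (4 * C)"
    have d: "d > 0" using e C by (simp add: d_def)
    \<comment> \<open>\<open>f\<close> rounded down to a multiple of \<open>d\<close>; only the multiples with index in \<open>I\<close> occur.\<close>
    define g where "g x = d * real_of_int \<lfloor>f x / d\<rfloor>" for x
    define I where "I = {\<lfloor>-B/d\<rfloor>..\<lfloor>B/d\<rfloor>}"
    define E where "E j = {x \<in> space N. \<lfloor>f x / d\<rfloor> = j}" for j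
    have [measurable]: "f \<in> borel_measurable N" by fact
    have E[measurable]: "E j \<in> sets N" for j unfolding E_def by measurable
    have gI: "\<lfloor>f x / d\<rfloor> \<in> I" if "x \<in> space N" for x
    proof -
      have "- B / d \<le> f x / d" "f x / d \<le> B / d"
        using f(2)[OF that] d by (intro divide_right_mono; simp)+
      then show ?thesis unfolding I_def by (auto intro!: floor_mono)
    qed
    have g_eq: "g x = (\<Sum>j\<in>I. d * j * indicator (E j) x)" if "x \<in> space N" for x
    proof -
      have "(\<Sum>j\<in>I. d * j * indicator (E j) x) = (\<Sum>j\<in>I. if j = \<lfloor>f x / d\<rfloor> then d * j else 0)"
        using that by (intro sum.cong) (auto simp: E_def)
      also have "\<dots> = g x" using gI[OF that] by (subst sum.delta) (auto simp: I_def g_def)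
      finally show ?thesis ..
    qed
    have gm[measurable]: "g \<in> borel_measurable N" unfolding g_def by measurable
    have fg: "\<bar>f x - g x\<bar> \<le> d" for x
    proof -
      have "real_of_int \<lfloor>f x / d\<rfloor> \<le> f x / d" "f x / d < real_of_int \<lfloor>f x / d\<rfloor> + 1" by linarith+
      then have "real_of_int \<lfloor>f x / d\<rfloor> * d \<le> f x" "f x < (real_of_int \<lfloor>f x / d\<rfloor> + 1) * d"
        unfolding pos_le_divide_eq[OF d] pos_divide_less_eq[OF d] .
      then have "d * real_of_int \<lfloor>f x / d\<rfloor> \<le> f x" "f x < d * real_of_int \<lfloor>f x / d\<rfloor> + d"
        by (auto simp: algebra_simps)
      then show ?thesis by (simp add: g_def)
    qed
    have key: "integral\<^sup>L M g = (\<Sum>j\<in>I. d * j * measure M (E j))" "\<bar>integral\<^sup>L M f - integral\<^sup>L M g\<bar> \<le> e / 4"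
      if M: "finite_measure M" "sets M = sets N" "measure M (space N) \<le> C" for M
    proof -
      interpret M: finite_measure M by fact
      have spM: "space M = space N" using M by (auto dest: sets_eq_imp_space_eq)
      note M(2)[measurable_cong]
      have "integral\<^sup>L M g = (\<integral>x. (\<Sum>j\<in>I. d * j * indicator (E j) x) \<partial>M)"
        by (rule Bochner_Integration.integral_cong) (auto simp: g_eq spM)
      also have "\<dots> = (\<Sum>j\<in>I. \<integral>x. d * j * indicator (E j) x \<partial>M)"
        by (rule Bochner_Integration.integral_sum) (simp add: M.emeasure_finite M(2) integrable_real_indicator less_top[symmetric])
      also have "\<dots> = (\<Sum>j\<in>I. d * j * measure M (E j))"
        using sets.sets_into_space[OF E] by (simp add: Int_absorb1 spM Int_absorb2)
      finally show "integral\<^sup>L M g = (\<Sum>j\<in>I. d * j * measure M (E j))" .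
      have intf: "integrable M f"
        using f by (intro M.integrable_const_bound[of _ B]) (auto simp: spM)
      have intg: "integrable M g"
      proof (intro M.integrable_const_bound[of _ "B + d"] AE_I2)
        fix x assume "x \<in> space M"
        then show "norm (g x) \<le> B + d" using f(2)[of x] fg[of x] by (auto simp: spM)
      qed simp
      have "\<bar>integral\<^sup>L M f - integral\<^sup>L M g\<bar> = \<bar>\<integral>x. f x - g x \<partial>M\<bar>" using intf intg by simp
      also have "\<dots> \<le> (\<integral>x. \<bar>f x - g x\<bar> \<partial>M)" by (rule integral_abs_bound)
      also have "\<dots> \<le> (\<integral>x. d \<partial>M)" using intf intg fg by (intro integral_mono) auto
      also have "\<dots> \<le> C * d" using M(3) d by (simp add: spM)
      also have "\<dots> = e / 4" using C by (simp add: d_def)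
      finally show "\<bar>integral\<^sup>L M f - integral\<^sup>L M g\<bar> \<le> e / 4" .
    qed
    have "(\<lambda>n. integral\<^sup>L (m n) g) \<longlonglongrightarrow> integral\<^sup>L m' g"
      unfolding key(1)[OF fin(1) sets(1) C(1)] key(1)[OF fin(2) sets(2) C(2)]
      by (intro tendsto_sum tendsto_mult_left conv E)
    from LIMSEQ_D[OF this, of "e/4"] e
    obtain n0 where n0: "\<And>n. n \<ge> n0 \<Longrightarrow> \<bar>integral\<^sup>L (m n) g - integral\<^sup>L m' g\<bar> < e / 4"
      by auto
    show "\<exists>no. \<forall>n\<ge>no. norm (integral\<^sup>L (m n) f - integral\<^sup>L m' f) < e"
    proof (intro exI allI impI)
      fix n assume "n0 \<le> n"
      from n0[OF this] key(2)[OF fin(1) sets(1) C(1), of n] key(2)[OF fin(2) sets(2) C(2)] e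
      show "norm (integral\<^sup>L (m n) f - integral\<^sup>L m' f) < e" by (simp add: abs_if split: if_splits)
    qed
  qed
qed

section \<open>Measures on integer sequences with prescribed cylinder weights\<close>

abbreviation baire :: "(nat \<Rightarrow> nat) measure" where
  "baire \<equiv> PiM UNIV (\<lambda>_. count_space UNIV)"

definition prefix_of :: "nat \<Rightarrow> (nat \<Rightarrow> nat) \<Rightarrow> nat list" where
  "prefix_of n \<omega> = map \<omega> [0..<n]"

definition cyl :: "nat list \<Rightarrow> (nat \<Rightarrow> nat) set" where
  "cyl w = {\<omega>. prefix_of (length w) \<omega> = w}"

lemma length_prefix_of[simp]: "length (prefix_of n \<omega>) = n"
  by (simp add: prefix_of_def)

lemma prefix_of_Suc: "prefix_of (Suc n) \<omega> = prefix_of n \<omega> @ [\<omega> n]"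
  by (simp add: prefix_of_def)

lemma map_upt_eq_iff: "map \<omega> [0..<n] = w \<longleftrightarrow> length w = n \<and> (\<forall>j\<in>{0..<n}. \<omega> j = w ! j)"
proof
  assume "length w = n \<and> (\<forall>j\<in>{0..<n}. \<omega> j = w ! j)"
  then show "map \<omega> [0..<n] = w" by (intro nth_equalityI) auto
qed auto

lemma prefix_of_eq_iff: "prefix_of n \<omega> = w \<longleftrightarrow> length w = n \<and> (\<forall>j<n. \<omega> j = w ! j)"
  unfolding prefix_of_def map_upt_eq_iff by auto

lemma space_baire[simp]: "space baire = UNIV"
  by (simp add: space_PiM)

lemma measurable_map_upt[measurable]:
  "(\<lambda>\<omega>. map \<omega> [0..<n]) \<in> PiM {0..<n} (\<lambda>_. count_space UNIV) \<rightarrow>\<^sub>M count_space (UNIV :: nat list set)"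
proof (subst measurable_count_space_eq2_countable)
  let ?S = "PiM {0..<n} (\<lambda>_. count_space (UNIV :: nat set))"
  have "{\<omega> \<in> space ?S. length w = n \<and> (\<forall>j\<in>{0..<n}. \<omega> j = w ! j)} \<in> sets ?S" for w
    by measurable
  then have "(\<lambda>\<omega>. map \<omega> [0..<n]) -` {w} \<inter> space ?S \<in> sets ?S" for w
    by (simp add: vimage_def map_upt_eq_iff Int_def conj_commute)
  then show "(\<lambda>\<omega>. map \<omega> [0..<n]) \<in> space ?S \<rightarrow> UNIV \<and>
    (\<forall>a\<in>UNIV. (\<lambda>\<omega>. map \<omega> [0..<n]) -` {a} \<inter> space ?S \<in> sets ?S)"
    by blast
qed

lemma measurable_prefix_of[measurable]: "prefix_of n \<in> baire \<rightarrow>\<^sub>M count_space UNIV"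
proof (subst measurable_count_space_eq2_countable)
  have "{\<omega> \<in> space baire. length w = n \<and> (\<forall>j\<in>{0..<n}. \<omega> j = w ! j)} \<in> sets baire" for w
    by measurable
  then have "{\<omega>. length w = n \<and> (\<forall>j<n. \<omega> j = w ! j)} \<in> sets baire" for w
    by (simp add: atLeast0LessThan lessThan_def)
  then show "prefix_of n \<in> space baire \<rightarrow> UNIV \<and>
     (\<forall>a\<in>UNIV. prefix_of n -` {a} \<inter> space baire \<in> sets baire)"
    by (simp add: vimage_def prefix_of_eq_iff)
qed

lemma sets_cyl[measurable]: "cyl w \<in> sets baire"
proof -
  have "{\<omega> \<in> space baire. prefix_of (length w) \<omega> = w} \<in> sets baire" by measurable
  then show ?thesis by (simp add: cyl_def)
qed

lemma cyl_Int: "cyl v \<inter> cyl w = {} \<or> cyl v \<inter> cyl w = cyl v \<or> cyl v \<inter> cyl w = cyl w"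
proof -
  have *: "cyl v \<inter> cyl w = {} \<or> cyl v \<inter> cyl w = cyl w" if le: "length v \<le> length w" for v w
  proof (cases "\<forall>j<length v. v ! j = w ! j")
    case True
    then have "cyl w \<subseteq> cyl v" using le by (auto simp: cyl_def prefix_of_eq_iff)
    then show ?thesis by auto
  next
    case False
    then show ?thesis using le by (fastforce simp: cyl_def prefix_of_eq_iff)
  qed
  show ?thesis using *[of v w] *[of w v] by (cases "length v \<le> length w") auto
qed

lemma sets_baire_eq: "sets baire = sigma_sets UNIV (insert {} (range cyl))"
proof
  show "sigma_sets UNIV (insert {} (range cyl)) \<subseteq> sets baire"
    using sets.sigma_sets_subset[of "insert {} (range cyl)" baire] sets_cyl
    by (simp only: space_baire image_subset_iff insert_subset sets.empty_sets simp_thms) blast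
  show "sets baire \<subseteq> sigma_sets UNIV (insert {} (range cyl))"
  proof -
    have UU: "(\<Pi>\<^sub>E i\<in>UNIV. space (count_space UNIV)) = (UNIV :: (nat \<Rightarrow> nat) set)"
      by (simp add: PiE_UNIV_domain)
    show ?thesis
      unfolding sets_PiM_single UU
    proof (rule sigma_sets_mono, rule subsetI)
      fix E :: "(nat \<Rightarrow> nat) set"
      assume "E \<in> {{f \<in> UNIV. f i \<in> A} |i A. i \<in> UNIV \<and> A \<in> sets (count_space UNIV)}"
      then obtain i A where E: "E = {f. f i \<in> A}" by auto
      have "f \<in> E \<longleftrightarrow> f \<in> (\<Union>w\<in>{w. length w = Suc i \<and> w ! i \<in> A}. cyl w)" for f
      proof
        assume "f \<in> E"
        then have "length (prefix_of (Suc i) f) = Suc i \<and> prefix_of (Suc i) f ! i \<in> A"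
          by (simp add: E prefix_of_Suc nth_append)
        moreover have "f \<in> cyl (prefix_of (Suc i) f)" by (simp add: cyl_def)
        ultimately show "f \<in> (\<Union>w\<in>{w. length w = Suc i \<and> w ! i \<in> A}. cyl w)" by blast
      qed (auto simp: E cyl_def prefix_of_eq_iff)
      then have "E = (\<Union>w\<in>{w. length w = Suc i \<and> w ! i \<in> A}. cyl w)" by blast
      also have "\<dots> \<in> sigma_sets UNIV (insert {} (range cyl))"
        by (rule sigma_sets_UNION) (auto intro: sigma_sets.Basic)
      finally show "E \<in> sigma_sets UNIV (insert {} (range cyl))" .
    qed
  qed
qed

lemma Int_stable_cyl: "Int_stable (insert {} (range cyl))"
  using cyl_Int by (fastforce simp: Int_stable_def)

text \<open>The process that continues a word \<open>w\<close> by the digit \<open>i\<close> with probability \<open>q (w @ [i]) / q w\<close>. A word of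
  weight \<open>0\<close> is never reached, and any continuation of it will do.\<close>

theorem cylinder_measure_exists:
  fixes q :: "nat list \<Rightarrow> real"
  assumes q0: "q [] = 1" and nn: "\<And>w. 0 \<le> q w" and sums: "\<And>w. (\<lambda>i. q (w @ [i])) sums q w"
  shows "\<exists>Q. prob_space Q \<and> sets Q = sets baire \<and> (\<forall>w. emeasure Q (cyl w) = ennreal (q w))"
proof -
  define K where "K w = (if q w > 0 then density (count_space UNIV) (\<lambda>i. ennreal (q (w @ [i]) / q w))
      else return (count_space UNIV) (0::nat))" for w
  have Kp: "prob_space (K w)" for w
  proof (cases "q w > 0")
    case True
    have "emeasure (density (count_space UNIV) (\<lambda>i. ennreal (q (w @ [i]) / q w))) UNIV
        = (\<Sum>i. ennreal (q (w @ [i]) / q w))"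
      by (simp add: emeasure_density nn_integral_count_space_nat)
    also have "\<dots> = ennreal (\<Sum>i. q (w @ [i]) / q w)"
      using sums[of w] nn True by (intro suminf_ennreal2) (auto simp: sums_iff)
    also have "(\<Sum>i. q (w @ [i]) / q w) = 1"
      using sums[of w] True by (simp add: sums_iff suminf_divide)
    finally show ?thesis using True by (auto simp: K_def intro!: prob_spaceI)
  next
    case False
    then show ?thesis by (simp add: K_def prob_space_return)
  qed
  have Ks: "sets (K w) = UNIV" for w by (simp add: K_def)
  have Ksub: "K w \<in> space (subprob_algebra (count_space UNIV))" for w
    using Kp by (simp add: space_subprob_algebra Ks prob_space_imp_subprob_space)
  define P where "P n \<omega> = K (map \<omega> [0..<n])" for n \<omega>
  have KM[measurable]: "K \<in> count_space UNIV \<rightarrow>\<^sub>M subprob_algebra (count_space UNIV)"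
    using Ksub by (simp add: measurable_def)
  interpret IT: Ionescu_Tulcea P "\<lambda>_. count_space UNIV"
  proof (rule Ionescu_Tulcea.intro)
    show "P i \<in> PiM {0..<i} (\<lambda>_. count_space UNIV) \<rightarrow>\<^sub>M subprob_algebra (count_space UNIV)" for i
      unfolding P_def[abs_def] by (rule measurable_compose[OF measurable_map_upt KM])
    show "prob_space (P i x)" if "x \<in> space (PiM {0..<i} (\<lambda>_. count_space UNIV))" for i x
      by (simp add: P_def Kp)
  qed
  let ?S = "\<lambda>n::nat. PiM {0..<n} (\<lambda>_. count_space (UNIV :: nat set))"
  have CC: "emeasure (IT.C 0 n (\<lambda>_. undefined)) {\<omega> \<in> space (?S n). map \<omega> [0..<n] = w} = ennreal (q w)"
    if "length w = n" for n w
    using that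
  proof (induction n arbitrary: w)
    case 0
    have "{\<omega> \<in> space (?S 0). map \<omega> [0..<0] = w} = space (?S 0)" using 0 by auto
    moreover have "emeasure (return (?S 0) (\<lambda>_. undefined)) (space (?S 0)) = 1"
      by (subst emeasure_return[OF sets.top]) (simp add: space_PiM)
    ultimately show ?case using 0 q0 by (metis IT.C.simps(1) ennreal_1 length_0_conv)
  next
    case (Suc n)
    then obtain v i where w: "w = v @ [i]" and v: "length v = n"
      by (metis length_Suc_conv_rev)
    let ?C = "IT.C 0 n (\<lambda>_. undefined)"
    let ?X = "{\<omega> \<in> space (?S (Suc n)). map \<omega> [0..<Suc n] = w}"
    let ?Y = "{\<omega> \<in> space (?S n). map \<omega> [0..<n] = v}"
    have Cs: "sets ?C = sets (?S n)" "space ?C = space (?S n)"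
      using IT.sets_C[of "\<lambda>_. undefined" 0 n] IT.space_C[of "\<lambda>_. undefined" 0 n] by (auto simp: space_PiM)
    have Xm: "?X \<in> sets (?S (Suc n))" by measurable
    have "emeasure (IT.C 0 (Suc n) (\<lambda>_. undefined)) ?X = (\<integral>\<^sup>+\<omega>. emeasure (IT.eP n \<omega>) ?X \<partial>?C)"
      unfolding IT.C.simps add_0
    proof (rule emeasure_bind)
      show "space ?C \<noteq> {}" by (simp add: Cs)
      show "IT.eP n \<in> ?C \<rightarrow>\<^sub>M subprob_algebra (?S (Suc n))"
        using IT.measurable_eP[of n] by (simp cong: measurable_cong_sets add: Cs)
    qed measurable
    also have "\<dots> = (\<integral>\<^sup>+\<omega>. emeasure (K v) {i} * indicator ?Y \<omega> \<partial>?C)"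
    proof (rule nn_integral_cong)
      fix \<omega> assume \<omega>: "\<omega> \<in> space ?C"
      have "emeasure (IT.eP n \<omega>) ?X = emeasure (P n \<omega>) ((\<lambda>x. fun_upd \<omega> n x) -` ?X \<inter> space (count_space UNIV))"
        using \<omega> by (intro IT.emeasure_eP[OF _ Xm]) (simp add: Cs)
      also have "(\<lambda>x. fun_upd \<omega> n x) -` ?X \<inter> space (count_space UNIV) = (if \<omega> \<in> ?Y then {i} else {})"
        using \<omega> v by (auto simp: w Cs space_PiM PiE_iff extensional_def)
      also have "emeasure (P n \<omega>) (if \<omega> \<in> ?Y then {i} else {}) = emeasure (K v) {i} * indicator ?Y \<omega>"
        by (auto simp: P_def)
      finally show "emeasure (IT.eP n \<omega>) ?X = emeasure (K v) {i} * indicator ?Y \<omega>" .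
    qed
    also have "\<dots> = emeasure (K v) {i} * emeasure ?C ?Y"
      by (subst nn_integral_cmult_indicator) (auto simp: Cs)
    also have "\<dots> = emeasure (K v) {i} * ennreal (q v)"
      using Suc.IH[OF v] by simp
    also have "\<dots> = ennreal (q w)"
    proof (cases "q v > 0")
      case True
      then have "emeasure (K v) {i} = ennreal (q w / q v)"
        by (simp add: K_def emeasure_density w nn_integral_indicator_singleton)
      then show ?thesis using nn True by (simp add: ennreal_mult[symmetric])
    next
      case False
      then have "q v = 0" using nn[of v] by simp
      then have "q (v @ [i]) = 0"
        using sums[of v] nn suminf_eq_zero_iff[of "\<lambda>j. q (v @ [j])"] by (simp add: sums_iff)
      then show ?thesis using \<open>q v = 0\<close> by (simp add: w)
    qed
    finally show ?case .
  qed
  have lim: "emeasure IT.PF.lim (cyl w) = ennreal (q w)" for w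
  proof -
    let ?n = "length w"
    let ?X = "{\<omega> \<in> space (?S ?n). map \<omega> [0..<?n] = w}"
    have X: "?X \<in> sets (?S ?n)" by measurable
    have "map (restrict \<omega> {0..<?n}) [0..<?n] = prefix_of ?n \<omega>" for \<omega>
      by (simp add: prefix_of_def)
    then have "cyl w = IT.PF.emb UNIV {0..<?n} ?X"
      by (simp add: cyl_def prod_emb_def space_PiM PiE_UNIV_domain vimage_def)
    then have "emeasure IT.PF.lim (cyl w) = emeasure (IT.CI {0..<?n}) ?X"
      using IT.lim[OF _ X] by simp
    also have "\<dots> = emeasure (IT.C 0 ?n (\<lambda>_. undefined)) (IT.PF.emb {0..<?n} {0..<?n} ?X)"
      by (rule IT.emeasure_CI[OF _ X]) simp
    also have "IT.PF.emb {0..<?n} {0..<?n} ?X = ?X"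
      by (rule prod_emb_id) (auto simp: space_PiM)
    finally show ?thesis using CC by simp
  qed
  show ?thesis
  proof (intro exI[of _ IT.PF.lim] conjI allI)
    have "cyl [] = UNIV" by (simp add: cyl_def prefix_of_def)
    then show "prob_space IT.PF.lim" using lim[of "[]"] q0 by (intro prob_spaceI) simp
  qed (simp_all add: lim)
qed

section \<open>Coding of a Polish space by integer sequences\<close>

definition dense_seq :: "nat \<Rightarrow> 'u::polish_space" where
  "dense_seq = (SOME d. \<forall>u. \<forall>e>0. \<exists>i. dist u (d i) < e)"

lemma dense_seq: "e > 0 \<Longrightarrow> \<exists>i. dist (u::'u::polish_space) (dense_seq i) < e"
proof -
  obtain D :: "'u set" where D: "countable D" "\<And>X. open X \<Longrightarrow> X \<noteq> {} \<Longrightarrow> \<exists>d\<in>D. d \<in> X"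
    using countable_dense_exists by blast
  have "\<exists>d :: nat \<Rightarrow> 'u. \<forall>u. \<forall>e>0. \<exists>i. dist u (d i) < e"
  proof (intro exI[of _ "from_nat_into D"] allI impI)
    fix u :: 'u and e :: real assume "e > 0"
    then obtain x where "x \<in> D" "x \<in> ball u e" using D(2)[of "ball u e"] by auto
    then show "\<exists>i. dist u (from_nat_into D i) < e"
      using from_nat_into_surj[OF D(1)] by (metis mem_ball)
  qed
  then have "\<forall>u. \<forall>e>0. \<exists>i. dist (u::'u) (dense_seq i) < e"
    unfolding dense_seq_def by (rule someI_ex)
  then show "e > 0 \<Longrightarrow> ?thesis" by blast
qed

text \<open>Digit \<open>m\<close> names the first centre within distance \<open>2\<^sup>-\<^sup>m\<close>. A point can be recovered from its code, and
  the points whose codes begin with a given word form a Borel set.\<close>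

definition code :: "'u::polish_space \<Rightarrow> nat \<Rightarrow> nat" where
  "code u m = (LEAST i. dist u (dense_seq i) < (1/2)^m)"

text \<open>The closed condition that all codes satisfy by the triangle inequality and that makes the named
  centres converge at a known rate.\<close>

definition decodable :: "'u::polish_space itself \<Rightarrow> (nat \<Rightarrow> nat) set" where
  "decodable _ = {\<omega>. \<forall>m n. dist (dense_seq (\<omega> m) :: 'u) (dense_seq (\<omega> n)) \<le> (1/2)^m + (1/2)^n}"

definition decode :: "(nat \<Rightarrow> nat) \<Rightarrow> 'u::polish_space" where
  "decode \<omega> = (if \<omega> \<in> decodable TYPE('u) then lim (\<lambda>m. dense_seq (\<omega> m)) else dense_seq 0)"

lemma code_close: "dist u (dense_seq (code u m)) < (1/2)^m"
  unfolding code_def by (rule LeastI_ex) (rule dense_seq, simp)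

lemma code_decodable: "code (u::'u::polish_space) \<in> decodable TYPE('u)"
  unfolding decodable_def
proof (intro CollectI allI)
  fix m n
  show "dist (dense_seq (code u m) :: 'u) (dense_seq (code u n)) \<le> (1/2)^m + (1/2)^n"
    using dist_triangle3[of "dense_seq (code u m)" "dense_seq (code u n)" u] code_close[of u m] code_close[of u n]
    by linarith
qed

lemma decode_tendsto:
  assumes "\<omega> \<in> decodable TYPE('u)"
  shows "(\<lambda>m. dense_seq (\<omega> m)) \<longlonglongrightarrow> (decode \<omega> :: 'u::polish_space)"
proof -
  have "Cauchy (\<lambda>m. dense_seq (\<omega> m) :: 'u)"
  proof (rule metric_CauchyI)
    fix e :: real assume "e > 0"
    then obtain N where N: "(1/2)^N < e/2"
      using real_arch_pow_inv[of "e/2" "1/2"] by auto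
    show "\<exists>N. \<forall>m\<ge>N. \<forall>n\<ge>N. dist (dense_seq (\<omega> m) :: 'u) (dense_seq (\<omega> n)) < e"
    proof (intro exI[of _ N] allI impI)
      fix m n assume "N \<le> m" "N \<le> n"
      then have "(1/2::real)^m \<le> (1/2)^N" "(1/2::real)^n \<le> (1/2)^N"
        by (auto intro!: power_decreasing)
      moreover have "dist (dense_seq (\<omega> m) :: 'u) (dense_seq (\<omega> n)) \<le> (1/2)^m + (1/2)^n"
        using assms by (auto simp: decodable_def)
      ultimately show "dist (dense_seq (\<omega> m) :: 'u) (dense_seq (\<omega> n)) < e" using N by linarith
    qed
  qed
  then show ?thesis
    using assms by (simp add: decode_def Cauchy_convergent_iff convergent_LIMSEQ_iff)
qed

lemma decode_close:
  assumes "\<omega> \<in> decodable TYPE('u)"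
  shows "dist (dense_seq (\<omega> m)) (decode \<omega> :: 'u::polish_space) \<le> (1/2)^m"
proof (rule LIMSEQ_le)
  show "(\<lambda>n. dist (dense_seq (\<omega> m)) (dense_seq (\<omega> n) :: 'u)) \<longlonglongrightarrow> dist (dense_seq (\<omega> m)) (decode \<omega> :: 'u)"
    by (intro tendsto_intros decode_tendsto assms)
  show "(\<lambda>n. (1/2)^m + (1/2)^n) \<longlonglongrightarrow> (1/2::real)^m"
    using tendsto_add[OF tendsto_const[of "(1/2::real)^m"] LIMSEQ_realpow_zero[of "1/2::real"]] by simp
qed (use assms in \<open>auto simp: decodable_def\<close>)

lemma tendsto_of_dist_le_pow:
  fixes a :: "nat \<Rightarrow> 'a::metric_space"
  assumes "\<And>n. dist (a n) l \<le> (1/2)^n"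
  shows "a \<longlonglongrightarrow> l"
  by (rule metric_tendsto_imp_tendsto[OF LIMSEQ_realpow_zero[of "1/2::real"]])
    (use assms in \<open>auto simp: dist_real_def intro!: always_eventually\<close>)

lemma decode_code[simp]: "decode (code u) = (u :: 'u::polish_space)"
proof (rule LIMSEQ_unique[OF decode_tendsto[OF code_decodable]])
  show "(\<lambda>m. dense_seq (code u m)) \<longlonglongrightarrow> u"
    using code_close[of u] by (intro tendsto_of_dist_le_pow) (auto simp: dist_commute less_imp_le)
qed

lemma measurable_code_nth[measurable]: "(\<lambda>u. code u m) \<in> borel \<rightarrow>\<^sub>M count_space UNIV"
  unfolding code_def by measurable

lemma measurable_code[measurable]: "code \<in> borel \<rightarrow>\<^sub>M baire"
  by (rule measurable_PiM_single') (auto simp: measurable_code_nth)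

lemma decodable_sets[measurable]: "decodable TYPE('u::polish_space) \<in> sets baire"
proof -
  have [measurable]: "(\<lambda>\<omega>. dense_seq (\<omega> m) :: 'u) \<in> baire \<rightarrow>\<^sub>M borel" for m by measurable
  have "{\<omega> \<in> space baire. \<forall>m n. dist (dense_seq (\<omega> m) :: 'u) (dense_seq (\<omega> n)) \<le> (1/2)^m + (1/2)^n} \<in> sets baire"
    by measurable
  then show ?thesis by (simp add: decodable_def)
qed

lemma measurable_decode[measurable]: "(decode :: _ \<Rightarrow> 'u::polish_space) \<in> baire \<rightarrow>\<^sub>M borel"
proof (rule borel_measurable_LIMSEQ_metric)
  fix m
  have [measurable]: "(\<lambda>\<omega>. dense_seq (\<omega> m) :: 'u) \<in> baire \<rightarrow>\<^sub>M borel" by measurable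
  show "(\<lambda>\<omega>. if \<omega> \<in> decodable TYPE('u) then dense_seq (\<omega> m) else dense_seq 0 :: 'u) \<in> baire \<rightarrow>\<^sub>M borel"
    by measurable
next
  fix \<omega>
  show "(\<lambda>m. if \<omega> \<in> decodable TYPE('u) then dense_seq (\<omega> m) else dense_seq 0 :: 'u) \<longlonglongrightarrow> decode \<omega>"
    using decode_tendsto[of \<omega>, where 'u='u] by (auto simp: decode_def)
qed

text \<open>Decodability is violated by two digits, so a finite prefix rules out every code.\<close>

lemma not_decodable_prefix:
  assumes "\<omega> \<notin> decodable TYPE('u)"
  shows "\<exists>n. \<forall>u::'u::polish_space. code u \<notin> cyl (prefix_of n \<omega>)"
proof -
  from assms obtain m n where mn: "\<not> dist (dense_seq (\<omega> m) :: 'u) (dense_seq (\<omega> n)) \<le> (1/2)^m + (1/2)^n"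
    by (auto simp: decodable_def)
  show ?thesis
  proof (intro exI[of _ "Suc (max m n)"] allI notI)
    fix u :: 'u assume "code u \<in> cyl (prefix_of (Suc (max m n)) \<omega>)"
    then have "code u m = \<omega> m" "code u n = \<omega> n"
      by (auto simp: cyl_def prefix_of_def less_Suc_eq_le)
    moreover have "dist (dense_seq (code u m) :: 'u) (dense_seq (code u n)) \<le> (1/2)^m + (1/2)^n"
      using code_decodable[of u] unfolding decodable_def by blast
    ultimately show False using mn by simp
  qed
qed

text \<open>Finitely many balls of radius \<open>2\<^sup>-\<^sup>m\<close> around centres cover a compact set. Tightness of a family of laws
  thus becomes tightness of each digit of the code.\<close>

lemma finite_code_compact:
  assumes "compact (L :: 'u::polish_space set)"
  shows "finite ((\<lambda>u. code u m) ` L)"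
proof -
  let ?b = "\<lambda>i. ball (dense_seq i :: 'u) ((1/2)^m)"
  have "L \<subseteq> (\<Union>i. ?b i)" using dense_seq[of "(1/2)^m"] by (auto simp: dist_commute)
  then obtain I where I: "finite I" "L \<subseteq> (\<Union>i\<in>I. ?b i)"
    using compactE_image[OF assms, of UNIV ?b] by auto
  have "(\<lambda>u. code u m) ` L \<subseteq> {..Max I}"
  proof (rule image_subsetI)
    fix u assume "u \<in> L"
    then obtain i where i: "i \<in> I" "dist u (dense_seq i) < (1/2)^m" using I by (auto simp: dist_commute)
    then have "code u m \<le> i" unfolding code_def by (intro Least_le)
    also have "i \<le> Max I" using I i by simp
    finally show "code u m \<in> {..Max I}" by simp
  qed
  then show ?thesis by (rule finite_subset) simp
qed

section \<open>Measurable selections\<close>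

text \<open>A greedy search for a point of \<open>\<Gamma> x\<close>: the \<open>n\<close>-th ball is the first one of radius \<open>2\<^sup>-\<^sup>n\<close> that
  meets what is left of \<open>\<Gamma> x\<close>. The chosen centres decode to a point of the closed set \<open>\<Gamma> x\<close>.\<close>

lemma measurable_selection_in:
  fixes \<Gamma> :: "'x \<Rightarrow> 'u::polish_space set"
  assumes ne: "\<And>x. x \<in> space N \<Longrightarrow> \<Gamma> x \<noteq> {}" and cl: "\<And>x. x \<in> space N \<Longrightarrow> closed (\<Gamma> x)"
    and meas: "\<And>G. open G \<Longrightarrow> {x \<in> space N. \<Gamma> x \<inter> G \<noteq> {}} \<in> sets N"
    and G: "open G"
  shows "\<exists>v. v \<in> N \<rightarrow>\<^sub>M borel \<and> (\<forall>x\<in>space N. v x \<in> \<Gamma> x \<and> (\<Gamma> x \<inter> G \<noteq> {} \<longrightarrow> v x \<in> closure G))"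
proof -
  let ?b = "\<lambda>n i. ball (dense_seq i :: 'u) ((1/2)^n)"
  \<comment> \<open>The search starts inside \<open>G\<close> whenever \<open>\<Gamma> x\<close> meets \<open>G\<close>.\<close>
  define W0 where "W0 x = (if \<Gamma> x \<inter> G \<noteq> {} then G else UNIV)" for x
  define W where "W = rec_nat W0
     (\<lambda>n w x. w x \<inter> ?b n (LEAST i. \<Gamma> x \<inter> (w x \<inter> ?b n i) \<noteq> {}))"
  define c where "c x n = (LEAST i. \<Gamma> x \<inter> (W n x \<inter> ?b n i) \<noteq> {})" for x n
  have W_0: "W 0 x = W0 x" for x by (simp add: W_def)
  have W_Suc: "W (Suc n) x = W n x \<inter> ?b n (c x n)" for n x by (simp add: W_def c_def)
  have m1: "Measurable.pred N (\<lambda>x. \<Gamma> x \<inter> H \<noteq> {})" if "open H" for H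
    using meas[OF that] by (simp add: pred_def)
  have m: "Measurable.pred N (\<lambda>x. \<Gamma> x \<inter> (W n x \<inter> H) \<noteq> {})" if "open H" for n H
    using that
  proof (induction n arbitrary: H)
    case 0
    have "(\<Gamma> x \<inter> (W 0 x \<inter> H) \<noteq> {}) = (if \<Gamma> x \<inter> G \<noteq> {} then \<Gamma> x \<inter> (G \<inter> H) \<noteq> {} else \<Gamma> x \<inter> H \<noteq> {})" for x
      by (simp add: W_0 W0_def)
    then show ?case using m1[OF G] m1[of "G \<inter> H"] m1[of H] 0 G by (simp add: open_Int)
  next
    case (Suc n)
    have [measurable]: "(\<lambda>x. c x n) \<in> N \<rightarrow>\<^sub>M count_space UNIV"
      unfolding c_def by (intro measurable_Least Suc.IH) simp
    have "Measurable.pred N (\<lambda>x. \<Gamma> x \<inter> (W n x \<inter> (?b n (c x n) \<inter> H)) \<noteq> {})"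
      by (rule measurable_compose_countable[where f="\<lambda>i x. \<Gamma> x \<inter> (W n x \<inter> (?b n i \<inter> H)) \<noteq> {}"])
        (auto intro!: Suc.IH open_Int Suc.prems)
    then show ?case by (simp add: W_Suc Int_assoc)
  qed
  have cm: "(\<lambda>x. c x n) \<in> N \<rightarrow>\<^sub>M count_space UNIV" for n
    unfolding c_def by (intro measurable_Least m) simp
  have cM[measurable]: "c \<in> N \<rightarrow>\<^sub>M baire"
    by (rule measurable_PiM_single') (auto simp: cm)
  have Wne: "\<Gamma> x \<inter> W n x \<noteq> {}" if "x \<in> space N" for x n
  proof (induction n)
    case 0 then show ?case using ne[OF that] by (simp add: W_0 W0_def)
  next
    case (Suc n)
    then obtain u where u: "u \<in> \<Gamma> x" "u \<in> W n x" by auto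
    obtain i where "dist u (dense_seq i) < (1/2)^n" using dense_seq[of "(1/2)^n" u] by auto
    with u have "\<Gamma> x \<inter> (W n x \<inter> ?b n i) \<noteq> {}" by (auto simp: dist_commute)
    then have "\<Gamma> x \<inter> (W n x \<inter> ?b n (c x n)) \<noteq> {}" unfolding c_def by (rule LeastI)
    then show ?case by (simp add: W_Suc)
  qed
  have Wdec: "W n x \<subseteq> W k x" if "k \<le> n" for n k x
    using that by (induction rule: dec_induct) (auto simp: W_Suc)
  have cD: "c x \<in> decodable TYPE('u)" if x: "x \<in> space N" for x
    unfolding decodable_def
  proof (intro CollectI allI)
    fix k n
    obtain u where "u \<in> W (Suc (max k n)) x" using Wne[OF x] by blast
    then have "u \<in> W (Suc k) x" "u \<in> W (Suc n) x"
      using Wdec[of "Suc k" "Suc (max k n)" x] Wdec[of "Suc n" "Suc (max k n)" x] by auto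
    then have "dist (dense_seq (c x k)) u < (1/2)^k" "dist (dense_seq (c x n)) u < (1/2)^n"
      by (auto simp: W_Suc)
    then show "dist (dense_seq (c x k) :: 'u) (dense_seq (c x n)) \<le> (1/2)^k + (1/2)^n"
      using dist_triangle2[of "dense_seq (c x k)" "dense_seq (c x n)" u] by linarith
  qed
  show ?thesis
  proof (intro exI[of _ "\<lambda>x. decode (c x)"] conjI ballI)
    show "(\<lambda>x. decode (c x)) \<in> N \<rightarrow>\<^sub>M (borel :: 'u measure)" by measurable
    fix x assume x: "x \<in> space N"
    have "\<forall>n. \<exists>q. q \<in> \<Gamma> x \<and> q \<in> W n x" using Wne[OF x] by blast
    then obtain p where p: "\<And>n. p n \<in> \<Gamma> x" "\<And>n. p n \<in> W n x" by metis
    have "(\<lambda>n. p (Suc n)) \<longlonglongrightarrow> decode (c x)"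
    proof (rule metric_tendsto_imp_tendsto)
      show "(\<lambda>n. 2 * (1/2)^n) \<longlonglongrightarrow> (0::real)"
        using tendsto_mult_right[OF LIMSEQ_realpow_zero[of "1/2::real"], of 2] by simp
      have "dist (p (Suc n)) (decode (c x)) \<le> 2 * (1/2)^n" for n
      proof -
        have "dist (dense_seq (c x n)) (p (Suc n)) < (1/2)^n" using p(2)[of "Suc n"] by (simp add: W_Suc)
        then show ?thesis using decode_close[OF cD[OF x], of n]
            dist_triangle3[of "p (Suc n)" "decode (c x)" "dense_seq (c x n)"] by linarith
      qed
      then show "\<forall>\<^sub>F n in sequentially. dist (p (Suc n)) (decode (c x)) \<le> dist (2 * (1/2)^n) (0::real)"
        by (auto simp: dist_real_def intro!: always_eventually)
    qed
    note lim = this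
    show "decode (c x) \<in> \<Gamma> x"
      using closed_sequentially[OF cl[OF x] _ lim] p(1) by blast
    show "\<Gamma> x \<inter> G \<noteq> {} \<longrightarrow> decode (c x) \<in> closure G"
    proof
      assume *: "\<Gamma> x \<inter> G \<noteq> {}"
      have "p (Suc n) \<in> G" for n
        using p(2)[of "Suc n"] Wdec[of 0 "Suc n" x] * by (auto simp: W_0 W0_def)
      then have "p (Suc n) \<in> closure G" for n using closure_subset by blast
      then show "decode (c x) \<in> closure G"
        using closed_sequentially[OF closed_closure _ lim] by blast
    qed
  qed
qed

text \<open>One selection for each ball of dyadic radius around a centre: points of \<open>\<Gamma> x\<close> are approximated by
  the selections for the small balls around them.\<close>

theorem measurable_dense_selections:
  fixes \<Gamma> :: "'x \<Rightarrow> 'u::polish_space set"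
  assumes ne: "\<And>x. x \<in> space N \<Longrightarrow> \<Gamma> x \<noteq> {}" and cl: "\<And>x. x \<in> space N \<Longrightarrow> closed (\<Gamma> x)"
    and meas: "\<And>G. open G \<Longrightarrow> {x \<in> space N. \<Gamma> x \<inter> G \<noteq> {}} \<in> sets N"
  shows "\<exists>v :: nat \<Rightarrow> 'x \<Rightarrow> 'u. (\<forall>j. v j \<in> N \<rightarrow>\<^sub>M borel) \<and>
    (\<forall>x\<in>space N. (\<forall>j. v j x \<in> \<Gamma> x) \<and> (\<forall>u\<in>\<Gamma> x. \<forall>e>0. \<exists>j. dist u (v j x) < e))"
proof -
  define G where "G j = (case prod_decode j of (i, k) \<Rightarrow> ball (dense_seq i :: 'u) ((1/2)^k))" for j
  have "\<forall>j. \<exists>v. v \<in> N \<rightarrow>\<^sub>M borel \<and> (\<forall>x\<in>space N. v x \<in> \<Gamma> x \<and> (\<Gamma> x \<inter> G j \<noteq> {} \<longrightarrow> v x \<in> closure (G j)))"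
    by (intro allI measurable_selection_in[OF ne cl meas]) (auto simp: G_def split: prod.split)
  then obtain v where v: "\<And>j. v j \<in> N \<rightarrow>\<^sub>M borel" "\<And>j x. x \<in> space N \<Longrightarrow> v j x \<in> \<Gamma> x"
    "\<And>j x. x \<in> space N \<Longrightarrow> \<Gamma> x \<inter> G j \<noteq> {} \<Longrightarrow> v j x \<in> closure (G j)" by metis
  have "\<exists>j. dist u (v j x) < e" if x: "x \<in> space N" and u: "u \<in> \<Gamma> x" and e: "e > 0" for x u e
  proof -
    obtain k where k: "(1/2)^k < e/2" using real_arch_pow_inv[of "e/2" "1/2"] e by auto
    obtain i where i: "dist u (dense_seq i) < (1/2)^k" using dense_seq[of "(1/2)^k" u] by auto
    define j where "j = prod_encode (i, k)"
    have Gj: "G j = ball (dense_seq i) ((1/2)^k)" by (simp add: G_def j_def)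
    have "\<Gamma> x \<inter> G j \<noteq> {}" using u i by (auto simp: Gj dist_commute)
    then have "v j x \<in> closure (G j)" using v(3)[OF x] by simp
    then have "v j x \<in> cball (dense_seq i) ((1/2)^k)"
      unfolding Gj using closure_minimal[OF ball_subset_cball closed_cball] by blast
    then have "dist (dense_seq i) (v j x) \<le> (1/2)^k" by simp
    then have "dist u (v j x) < e"
      using i k dist_triangle[of u "v j x" "dense_seq i"] by linarith
    then show ?thesis ..
  qed
  then show ?thesis using v by blast
qed

section \<open>Products of a measure with a kernel\<close>

text \<open>The joint law of \<open>x\<close> drawn from \<open>m\<close> and \<open>y\<close> drawn from \<open>\<kappa> x\<close>. The \<open>\<sigma>\<close>-algebras \<open>N\<close> and \<open>L\<close> are explicit
  because those carried by \<open>m\<close> and \<open>\<kappa> x\<close> agree with them only up to the equality of their sets.\<close>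

definition kernel_prod ::
    "'x measure \<Rightarrow> 'y measure \<Rightarrow> 'x measure \<Rightarrow> ('x \<Rightarrow> 'y measure) \<Rightarrow> ('x \<times> 'y) measure" where
  "kernel_prod N L m \<kappa> = m \<bind> (\<lambda>x. distr (\<kappa> x) (N \<Otimes>\<^sub>M L) (Pair x))"

lemma in_prob_algebraD:
  assumes "m \<in> space (prob_algebra N)"
  shows "prob_space m" "sets m = sets N" "space m = space N"
  using assms by (auto simp: space_prob_algebra dest: sets_eq_imp_space_eq)

lemma kernelD:
  assumes "\<kappa> \<in> N \<rightarrow>\<^sub>M prob_algebra L" "x \<in> space N"
  shows "prob_space (\<kappa> x)" "sets (\<kappa> x) = sets L" "space (\<kappa> x) = space L"
  using in_prob_algebraD[OF measurable_space[OF assms]] by auto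

lemma kernel_prod_kernel:
  assumes "\<kappa> \<in> N \<rightarrow>\<^sub>M prob_algebra L"
  shows "(\<lambda>x. distr (\<kappa> x) (N \<Otimes>\<^sub>M L) (Pair x)) \<in> N \<rightarrow>\<^sub>M prob_algebra (N \<Otimes>\<^sub>M L)"
  by (rule measurable_distr_prob_space2[OF assms]) simp

lemma kernel_prod_in_prob_algebra:
  assumes "m \<in> space (prob_algebra N)" "\<kappa> \<in> N \<rightarrow>\<^sub>M prob_algebra L"
  shows "kernel_prod N L m \<kappa> \<in> space (prob_algebra (N \<Otimes>\<^sub>M L))"
  unfolding kernel_prod_def space_prob_algebra
  using prob_space_bind'[OF assms(1) kernel_prod_kernel[OF assms(2)]]
    sets_bind'[OF assms(1) kernel_prod_kernel[OF assms(2)]] by simp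

lemma nn_integral_bind_prob_algebra:
  assumes m: "m \<in> space (prob_algebra N)" and K: "K \<in> N \<rightarrow>\<^sub>M prob_algebra L"
    and f: "f \<in> borel_measurable L"
  shows "(\<integral>\<^sup>+y. f y \<partial>(m \<bind> K)) = (\<integral>\<^sup>+x. \<integral>\<^sup>+y. f y \<partial>K x \<partial>m)"
proof (rule nn_integral_bind[OF f])
  show "K \<in> m \<rightarrow>\<^sub>M subprob_algebra L"
    using measurable_prob_algebraD[OF K] in_prob_algebraD(2)[OF m] by (simp cong: measurable_cong_sets)
qed

lemma nn_integral_kernel_prod:
  assumes m: "m \<in> space (prob_algebra N)" and \<kappa>: "\<kappa> \<in> N \<rightarrow>\<^sub>M prob_algebra L"
    and f: "f \<in> borel_measurable (N \<Otimes>\<^sub>M L)"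
  shows "(\<integral>\<^sup>+z. f z \<partial>kernel_prod N L m \<kappa>) = (\<integral>\<^sup>+x. \<integral>\<^sup>+y. f (x, y) \<partial>\<kappa> x \<partial>m)"
  unfolding kernel_prod_def nn_integral_bind_prob_algebra[OF m kernel_prod_kernel[OF \<kappa>] f]
proof (rule nn_integral_cong)
  fix x assume "x \<in> space m"
  then have x: "x \<in> space N" using in_prob_algebraD[OF m] by simp
  have "Pair x \<in> \<kappa> x \<rightarrow>\<^sub>M N \<Otimes>\<^sub>M L"
    using x kernelD(2)[OF \<kappa> x] by (simp cong: measurable_cong_sets)
  then show "(\<integral>\<^sup>+z. f z \<partial>distr (\<kappa> x) (N \<Otimes>\<^sub>M L) (Pair x)) = (\<integral>\<^sup>+y. f (x, y) \<partial>\<kappa> x)"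
    by (simp add: nn_integral_distr f)
qed

lemma emeasure_kernel_prod_times:
  assumes m: "m \<in> space (prob_algebra N)" and \<kappa>: "\<kappa> \<in> N \<rightarrow>\<^sub>M prob_algebra L"
    and A: "A \<in> sets N" and B: "B \<in> sets L"
  shows "emeasure (kernel_prod N L m \<kappa>) (A \<times> B) = (\<integral>\<^sup>+x. emeasure (\<kappa> x) B * indicator A x \<partial>m)"
proof -
  have AB: "A \<times> B \<in> sets (N \<Otimes>\<^sub>M L)" using A B by simp
  have "emeasure (kernel_prod N L m \<kappa>) (A \<times> B) = (\<integral>\<^sup>+z. indicator (A \<times> B) z \<partial>kernel_prod N L m \<kappa>)"
    using AB in_prob_algebraD(2)[OF kernel_prod_in_prob_algebra[OF m \<kappa>]] by simp
  also have "\<dots> = (\<integral>\<^sup>+x. \<integral>\<^sup>+y. indicator (A \<times> B) (x, y) \<partial>\<kappa> x \<partial>m)"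
    using AB by (intro nn_integral_kernel_prod[OF m \<kappa>]) simp
  also have "\<dots> = (\<integral>\<^sup>+x. emeasure (\<kappa> x) B * indicator A x \<partial>m)"
  proof (rule nn_integral_cong)
    fix x assume "x \<in> space m"
    then have "x \<in> space N" using in_prob_algebraD[OF m] by simp
    then have "B \<in> sets (\<kappa> x)" using B kernelD(2)[OF \<kappa>] by simp
    then show "(\<integral>\<^sup>+y. indicator (A \<times> B) (x, y) \<partial>\<kappa> x) = emeasure (\<kappa> x) B * indicator A x"
      by (cases "x \<in> A") (simp_all add: indicator_times)
  qed
  finally show ?thesis .
qed

section \<open>Limits of probability measures on a product with the integer sequences\<close>

lemma sets_times_cyl[measurable]: "A \<in> sets N \<Longrightarrow> A \<times> cyl w \<in> sets (N \<Otimes>\<^sub>M baire)"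
  by simp

lemma UNIV_sets_baire[simp]: "UNIV \<in> sets baire"
  using sets.top[of baire] by simp

lemma cyl_Nil[simp]: "cyl [] = UNIV"
  by (simp add: cyl_def prefix_of_def)

lemma cyl_snoc: "cyl (w @ [i]) = cyl w \<inter> {\<omega>. \<omega> (length w) = i}"
  by (auto simp: cyl_def prefix_of_Suc)

lemma cyl_snoc_disjoint: "disjoint_family (\<lambda>i. cyl (w @ [i]))"
  by (auto simp: disjoint_family_on_def cyl_snoc)

text \<open>Setwise limits of the parts over cylinders are consistent along the tree of words, because
  tightness keeps mass from escaping to infinitely many children of a word. Their densities are then
  the cylinder weights of a random measure.\<close>

theorem cylinderwise_limit:
  fixes P :: "nat \<Rightarrow> ('x \<times> (nat \<Rightarrow> nat)) measure"
  assumes \<nu>: "finite_measure \<nu>" "countably_generated \<nu>"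
    and P: "\<And>n. P n \<in> space (prob_algebra (\<nu> \<Otimes>\<^sub>M baire))"
    and dom: "\<And>n A. A \<in> sets \<nu> \<Longrightarrow> emeasure (P n) (A \<times> UNIV) \<le> emeasure \<nu> A"
    and tight: "\<And>k e. e > 0 \<Longrightarrow> \<exists>F. finite F \<and> (\<forall>n. measure (P n) {z \<in> space (\<nu> \<Otimes>\<^sub>M baire). snd z k \<notin> F} \<le> e)"
  shows "\<exists>r m \<kappa>. strict_mono r \<and> m \<in> space (prob_algebra \<nu>) \<and> (\<forall>A\<in>sets \<nu>. emeasure m A \<le> emeasure \<nu> A) \<and>
     \<kappa> \<in> \<nu> \<rightarrow>\<^sub>M prob_algebra baire \<and>
     (\<forall>A\<in>sets \<nu>. \<forall>w. (\<lambda>n. measure (P (r n)) (A \<times> cyl w)) \<longlonglongrightarrow> measure (kernel_prod \<nu> baire m \<kappa>) (A \<times> cyl w))"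
proof -
  note Ps = in_prob_algebraD[OF P]
  interpret P: prob_space "P n" for n by (rule Ps)
  \<comment> \<open>The part of \<open>P n\<close> over the cylinder of \<open>w\<close>, projected to the first coordinate.\<close>
  define S where "S w n = distr (density (P n) (indicator (space \<nu> \<times> cyl w))) \<nu> fst" for w n
  have S: "emeasure (S w n) A = emeasure (P n) (A \<times> cyl w)" if A: "A \<in> sets \<nu>" for w n A
  proof -
    have 1: "fst \<in> density (P n) (indicator (space \<nu> \<times> cyl w)) \<rightarrow>\<^sub>M \<nu>"
      by (simp add: Ps cong: measurable_cong_sets)
    have 2: "space \<nu> \<times> cyl w \<in> sets (P n)" by (simp add: Ps)
    have sp: "fst -` A \<inter> space (density (P n) (indicator (space \<nu> \<times> cyl w))) = A \<times> UNIV"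
      using sets.sets_into_space[OF A] by (auto simp: Ps space_pair_measure)
    have "emeasure (S w n) A = emeasure (density (P n) (indicator (space \<nu> \<times> cyl w))) (A \<times> UNIV)"
      unfolding S_def by (subst emeasure_distr[OF 1 A]) (simp only: sp)
    also have "\<dots> = (\<integral>\<^sup>+z. indicator (A \<times> cyl w) z \<partial>P n)"
    proof (subst emeasure_density)
      show "indicator (space \<nu> \<times> cyl w) \<in> borel_measurable (P n)" using 2 by simp
      show "A \<times> UNIV \<in> sets (P n)" using A by (simp add: Ps)
      show "(\<integral>\<^sup>+z. indicator (space \<nu> \<times> cyl w) z * indicator (A \<times> UNIV) z \<partial>P n) =
          (\<integral>\<^sup>+z. indicator (A \<times> cyl w) z \<partial>P n)"
        using sets.sets_into_space[OF A] by (intro nn_integral_cong) (auto split: split_indicator)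
    qed
    also have "\<dots> = emeasure (P n) (A \<times> cyl w)" using A by (simp add: Ps)
    finally show ?thesis .
  qed
  have Sm: "measure (S w n) A = measure (P n) (A \<times> cyl w)" if "A \<in> sets \<nu>" for w n A
    using S[OF that] by (simp add: measure_def)
  have "\<exists>r G. strict_mono r \<and> (\<forall>w. sets (G w) = sets \<nu> \<and>
           (\<forall>A\<in>sets \<nu>. emeasure (G w) A \<le> emeasure \<nu> A \<and>
              (\<lambda>n. measure (S w (r n)) A) \<longlonglongrightarrow> measure (G w) A))"
  proof (rule dominated_setwise_subsequence[OF \<nu>])
    show "sets (S w n) = sets \<nu>" for w n by (simp add: S_def)
    fix w n A assume A: "A \<in> sets \<nu>"
    have "emeasure (P n) (A \<times> cyl w) \<le> emeasure (P n) (A \<times> UNIV)"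
      using A by (intro emeasure_mono) (auto simp: Ps)
    with dom[OF A, of n] show "emeasure (S w n) A \<le> emeasure \<nu> A" by (simp add: S[OF A])
  qed
  then obtain r G where r: "strict_mono r" and Gs: "\<And>w. sets (G w) = sets \<nu>"
    and Gle: "\<And>w A. A \<in> sets \<nu> \<Longrightarrow> emeasure (G w) A \<le> emeasure \<nu> A"
    and "\<And>w A. A \<in> sets \<nu> \<Longrightarrow> (\<lambda>n. measure (S w (r n)) A) \<longlonglongrightarrow> measure (G w) A"
    by blast
  then have Glim: "\<And>w A. A \<in> sets \<nu> \<Longrightarrow> (\<lambda>n. measure (P (r n)) (A \<times> cyl w)) \<longlonglongrightarrow> measure (G w) A"
    by (simp add: Sm)
  have Gsp: "space (G w) = space \<nu>" for w using Gs by (rule sets_eq_imp_space_eq)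
  have Gfin: "finite_measure (G w)" for w
  proof
    show "emeasure (G w) (space (G w)) \<noteq> \<infinity>"
      using Gle[of "space \<nu>" w] finite_measure.emeasure_finite[OF \<nu>(1), of "space \<nu>"]
      by (auto simp: Gsp top_unique)
  qed
  interpret G: finite_measure "G w" for w by (rule Gfin)
  define m where "m = G []"
  have ms: "sets m = sets \<nu>" "space m = space \<nu>" by (simp_all add: m_def Gs Gsp)
  have m1: "prob_space m"
  proof
    have "(\<lambda>n. measure (P (r n)) (space \<nu> \<times> cyl [])) \<longlonglongrightarrow> measure m (space \<nu>)"
      unfolding m_def by (rule Glim) simp
    moreover have "measure (P (r n)) (space \<nu> \<times> cyl []) = 1" for n
      using P.prob_space[of "r n"] by (simp add: Ps space_pair_measure)
    ultimately have "measure m (space \<nu>) = 1" by (simp add: LIMSEQ_const_iff)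
    then show "emeasure m (space m) = 1" by (simp add: ms m_def Gsp G.emeasure_eq_measure)
  qed
  interpret m: prob_space m by fact
  have Gm: "emeasure (G w) A \<le> emeasure m A" if A: "A \<in> sets \<nu>" for w A
  proof -
    have "measure (G w) A \<le> measure (G []) A"
    proof (rule LIMSEQ_le[OF Glim[OF A] Glim[OF A]])
      show "\<exists>N. \<forall>n\<ge>N. measure (P (r n)) (A \<times> cyl w) \<le> measure (P (r n)) (A \<times> cyl [])"
        using A by (intro exI allI impI P.finite_measure_mono) (auto simp: Ps)
    qed
    then show ?thesis by (simp add: m_def G.emeasure_eq_measure)
  qed
  have "\<exists>p\<in>borel_measurable m. density m p = G w" for w
  proof (rule m.Radon_Nikodym_finite_measure[OF Gfin])
    show "sets (G w) = sets m" by (simp add: Gs ms)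
    show "absolutely_continuous m (G w)"
      unfolding absolutely_continuous_def
    proof
      fix A assume "A \<in> null_sets m"
      then have A: "A \<in> sets \<nu>" "emeasure m A = 0" by (auto simp: null_sets_def ms)
      then show "A \<in> null_sets (G w)" using Gm[OF A(1), of w] by (simp add: null_sets_def Gs)
    qed
  qed
  then obtain p where pm: "\<And>w. p w \<in> borel_measurable m" and p: "\<And>w. density m (p w) = G w"
    by metis
  have [measurable]: "p w \<in> borel_measurable \<nu>" for w
    using pm[of w] by (simp add: ms cong: measurable_cong_sets)
  have pA: "(\<integral>\<^sup>+x. p w x * indicator A x \<partial>m) = emeasure (G w) A" if "A \<in> sets \<nu>" for w A
    using emeasure_density[OF pm[of w], of A] that by (simp add: p ms)
  have Gadd: "(\<Sum>i. emeasure (G (w @ [i])) A) = emeasure (G w) A" if A: "A \<in> sets \<nu>" for w A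
  proof -
    have disj: "disjoint_family_on (\<lambda>i. A \<times> cyl (w @ [i])) F" for F
      using cyl_snoc_disjoint[of w] by (auto simp: disjoint_family_on_def)
    have Uset: "(\<Sum>i\<in>F. measure (P n) (A \<times> cyl (w @ [i]))) = measure (P n) (\<Union>i\<in>F. A \<times> cyl (w @ [i]))"
      if "finite F" for F n
      using that A disj by (intro P.finite_measure_finite_Union[symmetric]) (auto simp: Ps)
    have up: "(\<Sum>i\<in>F. measure (G (w @ [i])) A) \<le> measure (G w) A" if F: "finite F" for F
    proof (rule LIMSEQ_le[OF tendsto_sum Glim[OF A]])
      show "\<exists>N. \<forall>n\<ge>N. (\<Sum>i\<in>F. measure (P (r n)) (A \<times> cyl (w @ [i]))) \<le> measure (P (r n)) (A \<times> cyl w)"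
        unfolding Uset[OF F] using A
        by (intro exI allI impI P.finite_measure_mono) (auto simp: Ps cyl_snoc)
    qed (rule Glim[OF A])
    \<comment> \<open>Up to mass \<open>e\<close>, uniformly in \<open>n\<close>, only finitely many next digits occur.\<close>
    have low: "emeasure (G w) A \<le> (\<Sum>i. emeasure (G (w @ [i])) A)"
    proof (rule ennreal_le_epsilon)
      fix e :: real assume e: "0 < e"
      obtain F where F: "finite F"
        "\<And>n. measure (P n) {z \<in> space (\<nu> \<Otimes>\<^sub>M baire). snd z (length w) \<notin> F} \<le> e"
        using tight[OF e, of "length w"] by blast
      have "measure (G w) A \<le> (\<Sum>i\<in>F. measure (G (w @ [i])) A) + e"
      proof (rule LIMSEQ_le[OF Glim[OF A] tendsto_add[OF tendsto_sum tendsto_const]])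
        show "\<exists>N. \<forall>n\<ge>N. measure (P (r n)) (A \<times> cyl w) \<le> (\<Sum>i\<in>F. measure (P (r n)) (A \<times> cyl (w @ [i]))) + e"
        proof (intro exI allI impI)
          fix n
          let ?T = "{z \<in> space (\<nu> \<Otimes>\<^sub>M baire). snd z (length w) \<notin> F}"
          let ?U = "\<Union>i\<in>F. A \<times> cyl (w @ [i])"
          have T: "?T \<in> sets (P (r n))" unfolding Ps by measurable
          have U: "?U \<in> sets (P (r n))" using F(1) A by (auto simp: Ps intro!: sets.finite_UN)
          have "A \<times> cyl w \<subseteq> ?U \<union> ?T"
            using sets.sets_into_space[OF A] by (auto simp: cyl_snoc space_pair_measure)
          then have "measure (P (r n)) (A \<times> cyl w) \<le> measure (P (r n)) (?U \<union> ?T)"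
            using T U by (intro P.finite_measure_mono) auto
          also have "\<dots> \<le> measure (P (r n)) ?U + measure (P (r n)) ?T"
            using T U by (intro measure_Un_le)
          also have "\<dots> \<le> (\<Sum>i\<in>F. measure (P (r n)) (A \<times> cyl (w @ [i]))) + e"
            unfolding Uset[OF F(1)] using F(2) by simp
          finally show "measure (P (r n)) (A \<times> cyl w) \<le> (\<Sum>i\<in>F. measure (P (r n)) (A \<times> cyl (w @ [i]))) + e" .
        qed
      qed (rule Glim[OF A])
      then have "ennreal (measure (G w) A) \<le> ennreal (\<Sum>i\<in>F. measure (G (w @ [i])) A) + ennreal e"
        using e by (subst ennreal_plus[symmetric]) (auto intro: sum_nonneg ennreal_leI)
      also have "\<dots> \<le> (\<Sum>i. emeasure (G (w @ [i])) A) + ennreal e"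
      proof (rule add_right_mono)
        have "ennreal (\<Sum>i\<in>F. measure (G (w @ [i])) A) = (\<Sum>i\<in>F. emeasure (G (w @ [i])) A)"
          by (simp add: G.emeasure_eq_measure)
        also have "\<dots> \<le> (\<Sum>i. emeasure (G (w @ [i])) A)"
          using F(1) by (intro sum_le_suminf) auto
        finally show "ennreal (\<Sum>i\<in>F. measure (G (w @ [i])) A) \<le> (\<Sum>i. emeasure (G (w @ [i])) A)" .
      qed
      finally show "emeasure (G w) A \<le> (\<Sum>i. emeasure (G (w @ [i])) A) + ennreal e"
        unfolding G.emeasure_eq_measure[of w A] .
    qed
    have high: "(\<Sum>i. emeasure (G (w @ [i])) A) \<le> emeasure (G w) A"
    proof (rule suminf_le_const)
      fix n
      have "(\<Sum>i<n. emeasure (G (w @ [i])) A) = ennreal (\<Sum>i<n. measure (G (w @ [i])) A)"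
        by (simp add: G.emeasure_eq_measure)
      also have "\<dots> \<le> emeasure (G w) A"
        using up[of "{..<n}"] by (simp add: G.emeasure_eq_measure)
      finally show "(\<Sum>i<n. emeasure (G (w @ [i])) A) \<le> emeasure (G w) A" .
    qed simp
    show ?thesis using low high by simp
  qed
  have padd: "AE x in m. (\<Sum>i. p (w @ [i]) x) = p w x" for w
  proof (rule m.density_unique_finite_measure)
    fix A assume "A \<in> sets m"
    then have A: "A \<in> sets \<nu>" by (simp add: ms)
    have "(\<integral>\<^sup>+x. (\<Sum>i. p (w @ [i]) x) * indicator A x \<partial>m) = (\<integral>\<^sup>+x. (\<Sum>i. p (w @ [i]) x * indicator A x) \<partial>m)"
      by simp
    also have "\<dots> = (\<Sum>i. \<integral>\<^sup>+x. p (w @ [i]) x * indicator A x \<partial>m)"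
      using A by (intro nn_integral_suminf borel_measurable_times_ennreal pm borel_measurable_indicator) (simp add: ms)
    also have "\<dots> = (\<integral>\<^sup>+x. p w x * indicator A x \<partial>m)"
      by (simp add: pA[OF A] Gadd[OF A])
    finally show "(\<integral>\<^sup>+x. (\<Sum>i. p (w @ [i]) x) * indicator A x \<partial>m) = (\<integral>\<^sup>+x. p w x * indicator A x \<partial>m)" .
  qed (use pm in auto)
  have p1: "AE x in m. p [] x = 1"
  proof (rule m.density_unique_finite_measure)
    fix A assume "A \<in> sets m"
    then have A: "A \<in> sets \<nu>" "A \<in> sets m" by (simp_all add: ms)
    show "(\<integral>\<^sup>+x. p [] x * indicator A x \<partial>m) = (\<integral>\<^sup>+x. 1 * indicator A x \<partial>m)"
      unfolding pA[OF A(1)] using A(2) by (simp add: m_def[symmetric])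
  qed (use pm in auto)
  have pfin: "AE x in m. p w x \<noteq> \<infinity>" for w
  proof (rule nn_integral_PInf_AE[OF pm])
    have "(\<integral>\<^sup>+x. p w x \<partial>m) = (\<integral>\<^sup>+x. p w x * indicator (space \<nu>) x \<partial>m)"
      by (intro nn_integral_cong) (simp add: ms)
    also have "\<dots> = emeasure (G w) (space \<nu>)" by (rule pA) simp
    finally show "(\<integral>\<^sup>+x. p w x \<partial>m) \<noteq> \<infinity>" by simp
  qed
  \<comment> \<open>Almost every \<open>x\<close> has densities that form consistent cylinder weights; at the others \<open>d\<close> is used.\<close>
  define good where "good x \<longleftrightarrow> p [] x = 1 \<and> (\<forall>w. p w x \<noteq> \<infinity> \<and> (\<Sum>i. p (w @ [i]) x) = p w x)" for x
  have good_AE: "AE x in m. good x"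
    unfolding good_def using p1 padd pfin by (auto simp: AE_all_countable)
  have [measurable]: "Measurable.pred \<nu> good"
    unfolding good_def by measurable
  define d where "d = return baire (\<lambda>_. 0)"
  have "\<exists>Q. prob_space Q \<and> sets Q = sets baire \<and> (\<forall>w. emeasure Q (cyl w) = p w x)" if "good x" for x
  proof -
    have pr: "ennreal (enn2real (p w x)) = p w x" for w
      using that by (intro ennreal_enn2real) (auto simp: good_def less_top)
    have "(\<lambda>i. enn2real (p (w @ [i]) x)) sums enn2real (p w x)" for w
    proof -
      have "(\<Sum>i. ennreal (enn2real (p (w @ [i]) x))) = ennreal (enn2real (p w x))"
        unfolding pr using that by (auto simp: good_def)
      moreover have "(\<lambda>i. ennreal (enn2real (p (w @ [i]) x))) sums (\<Sum>i. ennreal (enn2real (p (w @ [i]) x)))"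
        by (rule summable_sums) simp
      ultimately show ?thesis by (simp add: sums_ennreal)
    qed
    from cylinder_measure_exists[of "\<lambda>w. enn2real (p w x)", OF _ _ this]
    show ?thesis using that by (auto simp: pr good_def)
  qed
  then obtain Q where Q: "\<And>x. good x \<Longrightarrow> prob_space (Q x)" "\<And>x. good x \<Longrightarrow> sets (Q x) = sets baire"
    "\<And>x w. good x \<Longrightarrow> emeasure (Q x) (cyl w) = p w x" by metis
  define \<kappa> where "\<kappa> x = (if good x then Q x else d)" for x
  have \<kappa>: "\<kappa> \<in> \<nu> \<rightarrow>\<^sub>M prob_algebra baire"
  proof (rule measurable_prob_algebra_generated[OF sets_baire_eq Int_stable_cyl])
    show "prob_space (\<kappa> x)" for x by (simp add: \<kappa>_def Q d_def prob_space_return)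
    show "sets (\<kappa> x) = sets baire" for x by (simp add: \<kappa>_def Q d_def)
    fix A assume "A \<in> insert {} (range cyl)"
    then consider "A = {}" | w where "A = cyl w" by auto
    then show "(\<lambda>x. emeasure (\<kappa> x) A) \<in> borel_measurable \<nu>"
    proof cases
      case 2
      have "(\<lambda>x. emeasure (\<kappa> x) A) = (\<lambda>x. if good x then p w x else emeasure d (cyl w))"
        by (auto simp: \<kappa>_def Q 2)
      then show ?thesis by simp
    qed simp
  qed simp
  have mN: "m \<in> space (prob_algebra \<nu>)" by (simp add: space_prob_algebra ms m1)
  have "measure (kernel_prod \<nu> baire m \<kappa>) (A \<times> cyl w) = measure (G w) A" if A: "A \<in> sets \<nu>" for A w
  proof -
    have "emeasure (kernel_prod \<nu> baire m \<kappa>) (A \<times> cyl w) = (\<integral>\<^sup>+x. emeasure (\<kappa> x) (cyl w) * indicator A x \<partial>m)"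
      by (rule emeasure_kernel_prod_times[OF mN \<kappa> A]) simp
    also have "\<dots> = (\<integral>\<^sup>+x. p w x * indicator A x \<partial>m)"
      using good_AE by (intro nn_integral_cong_AE) (auto simp: \<kappa>_def Q elim!: eventually_mono)
    also have "\<dots> = emeasure (G w) A" by (rule pA[OF A])
    finally show ?thesis by (simp add: measure_def)
  qed
  then show ?thesis
    using r mN \<kappa> Glim Gle by (intro exI[of _ r] exI[of _ m] exI[of _ \<kappa>]) (auto simp: m_def)
qed

text \<open>No mass is lost in the limit, so convergence on cylinders is already uniform over the countably
  many cylinders of a fixed length.\<close>

lemma cylinderwise_imp_integral_tendsto:
  fixes g :: "'x \<Rightarrow> nat list \<Rightarrow> real"
  assumes P: "\<And>n. P n \<in> space (prob_algebra (N \<Otimes>\<^sub>M baire))" and P': "P' \<in> space (prob_algebra (N \<Otimes>\<^sub>M baire))"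
    and conv: "\<And>A w. A \<in> sets N \<Longrightarrow> (\<lambda>n. measure (P n) (A \<times> cyl w)) \<longlonglongrightarrow> measure P' (A \<times> cyl w)"
    and g: "\<And>w. (\<lambda>x. g x w) \<in> borel_measurable N" "\<And>x w. x \<in> space N \<Longrightarrow> \<bar>g x w\<bar> \<le> B"
  shows "(\<lambda>n. \<integral>z. g (fst z) (prefix_of k (snd z)) \<partial>P n) \<longlonglongrightarrow> (\<integral>z. g (fst z) (prefix_of k (snd z)) \<partial>P')"
proof -
  let ?W = "count_space (UNIV :: nat list set)"
  let ?\<pi> = "\<lambda>z::'x \<times> (nat \<Rightarrow> nat). (fst z, prefix_of k (snd z))"
  have \<pi>M[measurable]: "?\<pi> \<in> N \<Otimes>\<^sub>M baire \<rightarrow>\<^sub>M N \<Otimes>\<^sub>M ?W" by measurable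
  have \<pi>Q: "?\<pi> \<in> Q \<rightarrow>\<^sub>M N \<Otimes>\<^sub>M ?W" if "Q \<in> space (prob_algebra (N \<Otimes>\<^sub>M baire))" for Q
    using \<pi>M in_prob_algebraD(2)[OF that] by (simp cong: measurable_cong_sets)
  have gM[measurable]: "(\<lambda>y. g (fst y) (snd y)) \<in> borel_measurable (N \<Otimes>\<^sub>M ?W)"
  proof -
    show ?thesis
    proof (rule measurable_compose_countable[where f="\<lambda>w y. g (fst y) w" and g=snd])
      show "(\<lambda>y. g (fst y) w) \<in> borel_measurable (N \<Otimes>\<^sub>M ?W)" for w
        using g(1)[of w] by measurable
    qed simp
  qed
  have slice: "{x. (x, w) \<in> E} \<in> sets N" if "E \<in> sets (N \<Otimes>\<^sub>M ?W)" for E w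
    using sets_Pair2[OF that, of w] by (simp add: vimage_def)
  have pre: "?\<pi> -` E \<inter> space (N \<Otimes>\<^sub>M baire) \<in> sets (N \<Otimes>\<^sub>M baire)" if "E \<in> sets (N \<Otimes>\<^sub>M ?W)" for E
    using measurable_sets[OF \<pi>M that] .
  have part: "measure Q (?\<pi> -` (E \<inter> UNIV \<times> F) \<inter> space (N \<Otimes>\<^sub>M baire)) =
      (\<Sum>w\<in>F. if length w = k then measure Q ({x. (x, w) \<in> E} \<times> cyl w) else 0)"
    if Q: "Q \<in> space (prob_algebra (N \<Otimes>\<^sub>M baire))" and E: "E \<in> sets (N \<Otimes>\<^sub>M ?W)" and F: "finite F" for Q E F
  proof -
    interpret Q: prob_space Q by (rule in_prob_algebraD[OF Q])
    let ?D = "\<lambda>w. if length w = k then {x. (x, w) \<in> E} \<times> cyl w else {}"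
    have Esub: "E \<subseteq> space N \<times> UNIV" using sets.sets_into_space[OF E] by (simp add: space_pair_measure)
    have "?\<pi> -` (E \<inter> UNIV \<times> F) \<inter> space (N \<Otimes>\<^sub>M baire) = (\<Union>w\<in>F. ?D w)"
      using Esub by (auto simp: space_pair_measure cyl_def split: if_splits)
    also have "measure Q \<dots> = (\<Sum>w\<in>F. measure Q (?D w))"
    proof (rule Q.finite_measure_finite_Union[OF F])
      show "?D ` F \<subseteq> sets Q" using slice[OF E] in_prob_algebraD(2)[OF Q] by auto
      show "disjoint_family_on ?D F" by (auto simp: disjoint_family_on_def cyl_def)
    qed
    also have "\<dots> = (\<Sum>w\<in>F. if length w = k then measure Q ({x. (x, w) \<in> E} \<times> cyl w) else 0)"
      by (intro sum.cong) auto
    finally show ?thesis .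
  qed
  have convF: "(\<lambda>n. measure (P n) (?\<pi> -` (E \<inter> UNIV \<times> F) \<inter> space (N \<Otimes>\<^sub>M baire))) \<longlonglongrightarrow>
      measure P' (?\<pi> -` (E \<inter> UNIV \<times> F) \<inter> space (N \<Otimes>\<^sub>M baire))"
    if E: "E \<in> sets (N \<Otimes>\<^sub>M ?W)" and F: "finite F" for E F
    unfolding part[OF P E F] part[OF P' E F]
    by (rule tendsto_sum) (simp add: conv slice[OF E])
  have convE: "(\<lambda>n. measure (P n) (?\<pi> -` E \<inter> space (N \<Otimes>\<^sub>M baire))) \<longlonglongrightarrow>
      measure P' (?\<pi> -` E \<inter> space (N \<Otimes>\<^sub>M baire))" if E: "E \<in> sets (N \<Otimes>\<^sub>M ?W)" for E
  proof (rule LIMSEQ_I)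
    fix e :: real assume e: "0 < e"
    let ?\<Omega> = "space (N \<Otimes>\<^sub>M ?W)"
    let ?V = "\<lambda>E. ?\<pi> -` E \<inter> space (N \<Otimes>\<^sub>M baire)"
    interpret P': prob_space P' by (rule in_prob_algebraD[OF P'])
    \<comment> \<open>Finite sets of words that exhaust all words: one of them carries almost all of \<open>P'\<close>.\<close>
    define F where "F j = {w :: nat list. to_nat w < j}" for j
    have Ffin: "finite (F j)" for j
      unfolding F_def by (rule finite_imageD[of to_nat]) (auto intro: finite_subset[of _ "{..<j}"] inj_on_subset[OF inj_to_nat])
    have UF: "UNIV \<times> F j \<inter> ?\<Omega> \<in> sets (N \<Otimes>\<^sub>M ?W)" for j
    proof -
      have "UNIV \<times> F j \<inter> ?\<Omega> = space N \<times> F j" by (auto simp: space_pair_measure)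
      then show ?thesis by simp
    qed
    have Int\<Omega>: "?V (?\<Omega> \<inter> UNIV \<times> F j) = ?V (UNIV \<times> F j)" for j
      by (auto simp: space_pair_measure)
    have Vs: "?V (UNIV \<times> F j) \<in> sets (N \<Otimes>\<^sub>M baire)" for j
      using pre[OF UF[of j]] Int\<Omega>[of j] by (simp add: Int_commute)
    have "(\<lambda>j. measure P' (?V (UNIV \<times> F j))) \<longlonglongrightarrow> measure P' (\<Union>j. ?V (UNIV \<times> F j))"
    proof (rule P'.finite_Lim_measure_incseq)
      show "range (\<lambda>j. ?V (UNIV \<times> F j)) \<subseteq> sets P'" using Vs in_prob_algebraD(2)[OF P'] by auto
      show "incseq (\<lambda>j. ?V (UNIV \<times> F j))" by (auto simp: incseq_def F_def)
    qed
    also have "(\<Union>j. ?V (UNIV \<times> F j)) = space P'"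
      using in_prob_algebraD(3)[OF P'] by (auto simp: F_def)
    finally have "(\<lambda>j. measure P' (?V (UNIV \<times> F j))) \<longlonglongrightarrow> 1" by (simp add: P'.prob_space)
    from LIMSEQ_D[OF this, of "e/4"] e obtain j where j: "\<bar>measure P' (?V (UNIV \<times> F j)) - 1\<bar> < e/4" by auto
    have "(\<lambda>n. measure (P n) (?V (UNIV \<times> F j))) \<longlonglongrightarrow> measure P' (?V (UNIV \<times> F j))"
      using convF[OF sets.top Ffin[of j]] unfolding Int\<Omega> .
    from LIMSEQ_D[OF this, of "e/4"] e obtain n1 where n1:
      "\<And>n. n \<ge> n1 \<Longrightarrow> \<bar>measure (P n) (?V (UNIV \<times> F j)) - measure P' (?V (UNIV \<times> F j))\<bar> < e/4" by auto
    from LIMSEQ_D[OF convF[OF E Ffin[of j]], of "e/4"] e obtain n2 where n2: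
      "\<And>n. n \<ge> n2 \<Longrightarrow> \<bar>measure (P n) (?V (E \<inter> UNIV \<times> F j)) - measure P' (?V (E \<inter> UNIV \<times> F j))\<bar> < e/4" by auto
    have cut: "measure Q (?V (E \<inter> UNIV \<times> F j)) \<le> measure Q (?V E)"
      "measure Q (?V E) \<le> measure Q (?V (E \<inter> UNIV \<times> F j)) + (1 - measure Q (?V (UNIV \<times> F j)))"
      if Q: "Q \<in> space (prob_algebra (N \<Otimes>\<^sub>M baire))" for Q
    proof -
      interpret Q: prob_space Q by (rule in_prob_algebraD[OF Q])
      note Qs = in_prob_algebraD[OF Q]
      have E1: "?V E \<in> sets Q" using pre[OF E] Qs by simp
      have F1: "?V (UNIV \<times> F j) \<in> sets Q" using Vs Qs by simp
      have eq: "?V (E \<inter> UNIV \<times> F j) = ?V E \<inter> ?V (UNIV \<times> F j)" by auto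
      show "measure Q (?V (E \<inter> UNIV \<times> F j)) \<le> measure Q (?V E)"
        unfolding eq using E1 by (intro Q.finite_measure_mono) auto
      have "measure Q (?V E) \<le> measure Q (?V E \<inter> ?V (UNIV \<times> F j) \<union> (space Q - ?V (UNIV \<times> F j)))"
        using E1 F1 sets.sets_into_space[OF E1] by (intro Q.finite_measure_mono) auto
      also have "\<dots> \<le> measure Q (?V E \<inter> ?V (UNIV \<times> F j)) + measure Q (space Q - ?V (UNIV \<times> F j))"
        using E1 F1 by (intro measure_Un_le) auto
      also have "measure Q (space Q - ?V (UNIV \<times> F j)) = 1 - measure Q (?V (UNIV \<times> F j))"
        using F1 by (rule Q.prob_compl)
      finally show "measure Q (?V E) \<le> measure Q (?V (E \<inter> UNIV \<times> F j)) + (1 - measure Q (?V (UNIV \<times> F j)))"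
        unfolding eq .
    qed
    show "\<exists>no. \<forall>n\<ge>no. norm (measure (P n) (?V E) - measure P' (?V E)) < e"
    proof (intro exI allI impI)
      fix n assume "max n1 n2 \<le> n"
      then have "n1 \<le> n" "n2 \<le> n" by auto
      with n1[OF this(1)] n2[OF this(2)] cut[OF P[of n]] cut[OF P'] j
      show "norm (measure (P n) (?V E) - measure P' (?V E)) < e"
        unfolding real_norm_def by linarith
    qed
  qed
  have "(\<lambda>n. \<integral>y. g (fst y) (snd y) \<partial>distr (P n) (N \<Otimes>\<^sub>M ?W) ?\<pi>) \<longlonglongrightarrow> (\<integral>y. g (fst y) (snd y) \<partial>distr P' (N \<Otimes>\<^sub>M ?W) ?\<pi>)"
  proof (rule setwise_imp_integral_tendsto[where N="N \<Otimes>\<^sub>M ?W" and B=B])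
    show "finite_measure (distr (P n) (N \<Otimes>\<^sub>M ?W) ?\<pi>)" for n
      using prob_space.prob_space_distr[OF in_prob_algebraD(1)[OF P] \<pi>Q[OF P]] by (simp add: prob_space_def)
    show "finite_measure (distr P' (N \<Otimes>\<^sub>M ?W) ?\<pi>)"
      using prob_space.prob_space_distr[OF in_prob_algebraD(1)[OF P'] \<pi>Q[OF P']] by (simp add: prob_space_def)
    show "\<bar>g (fst x) (snd x)\<bar> \<le> B" if "x \<in> space (N \<Otimes>\<^sub>M ?W)" for x
      using g(2) that by (auto simp: space_pair_measure)
    fix A assume A: "A \<in> sets (N \<Otimes>\<^sub>M ?W)"
    show "(\<lambda>n. measure (distr (P n) (N \<Otimes>\<^sub>M ?W) ?\<pi>) A) \<longlonglongrightarrow> measure (distr P' (N \<Otimes>\<^sub>M ?W) ?\<pi>) A"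
      using convE[OF A] by (simp add: measure_distr[OF \<pi>Q[OF P] A] measure_distr[OF \<pi>Q[OF P'] A] in_prob_algebraD(3)[OF P] in_prob_algebraD(3)[OF P'])
  qed simp_all
  then show ?thesis
    by (simp add: integral_distr[OF \<pi>Q[OF P]] integral_distr[OF \<pi>Q[OF P']])
qed

section \<open>Compactness of laws of state-action pairs with dominated state marginals\<close>

text \<open>Replacing \<open>u\<close> by the centre named by a digit of its code leaves countably many functions of \<open>x\<close>.\<close>

lemma lipschitz_caratheodory_measurable:
  fixes h :: "'x \<times> 'u::polish_space \<Rightarrow> real"
  assumes m: "\<And>u. (\<lambda>x. h (x, u)) \<in> borel_measurable N"
    and lip: "\<And>x u u'. x \<in> space N \<Longrightarrow> \<bar>h (x, u) - h (x, u')\<bar> \<le> K * dist u u'"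
  shows "h \<in> borel_measurable (N \<Otimes>\<^sub>M borel)"
proof (rule borel_measurable_LIMSEQ_metric)
  fix k
  show "(\<lambda>z. h (fst z, dense_seq (code (snd z) k))) \<in> borel_measurable (N \<Otimes>\<^sub>M borel)"
  proof (rule measurable_compose_countable[where f="\<lambda>i z. h (fst z, dense_seq i)" and g="\<lambda>z. code (snd z) k"])
    show "(\<lambda>z. h (fst z, dense_seq i)) \<in> borel_measurable (N \<Otimes>\<^sub>M borel)" for i
      using m[of "dense_seq i"] by measurable
  qed measurable
next
  fix z :: "'x \<times> 'u" assume "z \<in> space (N \<Otimes>\<^sub>M borel)"
  then obtain x u where z: "z = (x, u)" "x \<in> space N" by (auto simp: space_pair_measure)
  have "(\<lambda>k. h (x, dense_seq (code u k)) - h (x, u)) \<longlonglongrightarrow> 0"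
  proof (rule Lim_null_comparison)
    show "(\<lambda>k. \<bar>K\<bar> * (1/2)^k) \<longlonglongrightarrow> (0::real)"
      using tendsto_mult_left[OF LIMSEQ_realpow_zero[of "1/2::real"], of "\<bar>K\<bar>"] by simp
    have "\<bar>h (x, dense_seq (code u k)) - h (x, u)\<bar> \<le> \<bar>K\<bar> * (1/2)^k" for k
    proof -
      have "\<bar>h (x, dense_seq (code u k)) - h (x, u)\<bar> \<le> K * dist (dense_seq (code u k)) u"
        by (rule lip[OF z(2)])
      also have "\<dots> \<le> \<bar>K\<bar> * dist (dense_seq (code u k)) u" by (intro mult_right_mono) auto
      also have "\<dots> \<le> \<bar>K\<bar> * (1/2)^k"
        using code_close[of u k] by (intro mult_left_mono) (auto simp: dist_commute)
      finally show ?thesis .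
    qed
    then show "\<forall>\<^sub>F k in sequentially. norm (h (x, dense_seq (code u k)) - h (x, u)) \<le> \<bar>K\<bar> * (1/2)^k"
      by simp
  qed
  then show "(\<lambda>k. h (fst z, dense_seq (code (snd z) k))) \<longlonglongrightarrow> h z"
    using z by (simp add: LIM_zero_iff)
qed

text \<open>A Lipschitz function of the decoded action is, up to \<open>K\<close> times \<open>2\<^sup>-\<^sup>k\<close>, a function of digit \<open>k\<close> alone.\<close>

lemma lipschitz_integral_tendsto:
  fixes h :: "'x \<times> 'u::polish_space \<Rightarrow> real"
  assumes P: "\<And>n. P n \<in> space (prob_algebra (N \<Otimes>\<^sub>M baire))" and P': "P' \<in> space (prob_algebra (N \<Otimes>\<^sub>M baire))"
    and conv: "\<And>A w. A \<in> sets N \<Longrightarrow> (\<lambda>n. measure (P n) (A \<times> cyl w)) \<longlonglongrightarrow> measure P' (A \<times> cyl w)"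
    and dec: "\<And>n. AE z in P n. snd z \<in> decodable TYPE('u)" "AE z in P'. snd z \<in> decodable TYPE('u)"
    and m: "\<And>u. (\<lambda>x. h (x, u)) \<in> borel_measurable N"
    and lip: "\<And>x u u'. x \<in> space N \<Longrightarrow> \<bar>h (x, u) - h (x, u')\<bar> \<le> K * dist u u'" and K: "0 \<le> K"
    and bd: "\<And>x u. x \<in> space N \<Longrightarrow> \<bar>h (x, u)\<bar> \<le> B"
  shows "(\<lambda>n. \<integral>z. h (fst z, decode (snd z)) \<partial>P n) \<longlonglongrightarrow> (\<integral>z. h (fst z, decode (snd z)) \<partial>P')"
proof (rule LIMSEQ_I)
  fix e :: real assume e: "0 < e"
  have hM[measurable]: "h \<in> borel_measurable (N \<Otimes>\<^sub>M borel)"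
    by (rule lipschitz_caratheodory_measurable[OF m lip])
  \<comment> \<open>\<open>K + 1\<close> instead of \<open>K\<close> keeps the denominator positive.\<close>
  obtain k where k: "(1/2)^k < e / (4 * (K + 1))"
    using real_arch_pow_inv[of "e / (4 * (K + 1))" "1/2"] e K by auto
  have Kk: "K * (1/2)^k \<le> e / 4"
  proof -
    have "K * (1/2)^k \<le> (K + 1) * (1/2)^k" by (intro mult_right_mono) auto
    also have "\<dots> \<le> (K + 1) * (e / (4 * (K + 1)))" using k K by (intro mult_left_mono) auto
    also have "\<dots> = e / 4" using K by (simp add: field_simps)
    finally show ?thesis .
  qed
  define g where "g x w = h (x, dense_seq (last w))" for x and w :: "nat list"
  have g_eq: "g x (prefix_of (Suc k) \<omega>) = h (x, dense_seq (\<omega> k))" for x \<omega>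
    by (simp add: g_def prefix_of_Suc)
  have gM: "(\<lambda>z. g (fst z) (prefix_of (Suc k) (snd z))) \<in> borel_measurable (N \<Otimes>\<^sub>M baire)"
  proof (rule measurable_compose_countable[where f="\<lambda>w z. g (fst z) w" and g="\<lambda>z. prefix_of (Suc k) (snd z)"])
    show "(\<lambda>z. g (fst z) w) \<in> borel_measurable (N \<Otimes>\<^sub>M baire)" for w
      unfolding g_def using m[of "dense_seq (last w)"] by measurable
  qed measurable
  have close: "\<bar>(\<integral>z. h (fst z, decode (snd z)) \<partial>Q) - (\<integral>z. g (fst z) (prefix_of (Suc k) (snd z)) \<partial>Q)\<bar> \<le> e / 4"
    if Q: "Q \<in> space (prob_algebra (N \<Otimes>\<^sub>M baire))" and dQ: "AE z in Q. snd z \<in> decodable TYPE('u)" for Q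
  proof -
    interpret Q: prob_space Q by (rule in_prob_algebraD[OF Q])
    note Qs = in_prob_algebraD(2,3)[OF Q]
    have sp: "fst z \<in> space N" if "z \<in> space Q" for z
      using that by (auto simp: Qs space_pair_measure)
    have "(\<lambda>z. h (fst z, decode (snd z))) \<in> borel_measurable (N \<Otimes>\<^sub>M baire)" by measurable
    then have m1: "(\<lambda>z. h (fst z, decode (snd z))) \<in> borel_measurable Q"
      using measurable_cong_sets[OF Qs(1) refl] by blast
    have m2: "(\<lambda>z. g (fst z) (prefix_of (Suc k) (snd z))) \<in> borel_measurable Q"
      using gM measurable_cong_sets[OF Qs(1) refl] by blast
    have i1: "integrable Q (\<lambda>z. h (fst z, decode (snd z)))"
      using bd sp m1 by (intro Q.integrable_const_bound[of _ B]) auto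
    have i2: "integrable Q (\<lambda>z. g (fst z) (prefix_of (Suc k) (snd z)))"
      using bd sp m2 by (intro Q.integrable_const_bound[of _ B]) (auto simp: g_def)
    have "AE z in Q. \<bar>h (fst z, decode (snd z)) - g (fst z) (prefix_of (Suc k) (snd z))\<bar> \<le> e / 4"
      using dQ AE_space
    proof eventually_elim
      case (elim z)
      have "\<bar>h (fst z, decode (snd z)) - h (fst z, dense_seq (snd z k))\<bar> \<le> K * dist (decode (snd z)) (dense_seq (snd z k) :: 'u)"
        by (rule lip) (rule sp[OF elim(2)])
      also have "\<dots> \<le> K * (1/2)^k"
        using decode_close[OF elim(1), of k] K by (intro mult_left_mono) (auto simp: dist_commute)
      also have "\<dots> \<le> e / 4" by (rule Kk)
      finally show ?case by (simp add: g_eq)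
    qed
    then have "(\<integral>z. \<bar>h (fst z, decode (snd z)) - g (fst z) (prefix_of (Suc k) (snd z))\<bar> \<partial>Q) \<le> (\<integral>z. e / 4 \<partial>Q)"
      using i1 i2 by (intro integral_mono_AE) auto
    also have "\<dots> = e / 4" by (simp add: Q.prob_space)
    finally have "(\<integral>z. \<bar>h (fst z, decode (snd z)) - g (fst z) (prefix_of (Suc k) (snd z))\<bar> \<partial>Q) \<le> e / 4" .
    moreover have "\<bar>\<integral>z. h (fst z, decode (snd z)) - g (fst z) (prefix_of (Suc k) (snd z)) \<partial>Q\<bar>
        \<le> (\<integral>z. \<bar>h (fst z, decode (snd z)) - g (fst z) (prefix_of (Suc k) (snd z))\<bar> \<partial>Q)"
      by (rule integral_abs_bound)
    ultimately show ?thesis using i1 i2 by simp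
  qed
  have "(\<lambda>n. \<integral>z. g (fst z) (prefix_of (Suc k) (snd z)) \<partial>P n) \<longlonglongrightarrow> (\<integral>z. g (fst z) (prefix_of (Suc k) (snd z)) \<partial>P')"
    by (rule cylinderwise_imp_integral_tendsto[OF P P' conv, where B=B]) (auto simp: g_def m bd)
  from LIMSEQ_D[OF this, of "e/4"] e obtain n0 where n0: "\<And>n. n \<ge> n0 \<Longrightarrow>
     \<bar>(\<integral>z. g (fst z) (prefix_of (Suc k) (snd z)) \<partial>P n) - (\<integral>z. g (fst z) (prefix_of (Suc k) (snd z)) \<partial>P')\<bar> < e/4" by auto
  show "\<exists>no. \<forall>n\<ge>no. norm ((\<integral>z. h (fst z, decode (snd z)) \<partial>P n) - (\<integral>z. h (fst z, decode (snd z)) \<partial>P')) < e"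
  proof (intro exI allI impI)
    fix n assume "n0 \<le> n"
    from n0[OF this] close[OF P dec(1), of n] close[OF P' dec(2)] e
    show "norm ((\<integral>z. h (fst z, decode (snd z)) \<partial>P n) - (\<integral>z. h (fst z, decode (snd z)) \<partial>P')) < e"
      unfolding real_norm_def by linarith
  qed
qed

subsection \<open>Lipschitz minorants\<close>

text \<open>The infimal convolution of \<open>f(x, \<cdot>)\<close> on \<open>\<Gamma> x\<close> with \<open>k\<close> times the distance, cut at \<open>k\<close> to make it
  bounded. Because the infimum runs over countably many measurable selections \<open>v j\<close>, it is measurable
  in \<open>x\<close>, and because they are dense in \<open>\<Gamma> x\<close>, nothing is lost when \<open>f(x, \<cdot>)\<close> is continuous.\<close>

definition lip_minorant ::
    "(nat \<Rightarrow> 'x \<Rightarrow> 'u::metric_space) \<Rightarrow> ('x \<times> 'u \<Rightarrow> real) \<Rightarrow> real \<Rightarrow> 'x \<times> 'u \<Rightarrow> real" where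
  "lip_minorant v f k z = min k (INF j. f (fst z, v j (fst z)) + k * dist (snd z) (v j (fst z)))"

lemma lip_minorant_bounds:
  assumes "\<And>j. 0 \<le> f (x, v j x)" "0 \<le> k"
  shows "0 \<le> lip_minorant v f k (x, u)" "lip_minorant v f k (x, u) \<le> k"
  using assms by (auto simp: lip_minorant_def intro!: cINF_greatest)

lemma lip_minorant_lipschitz:
  assumes nn: "\<And>j. 0 \<le> f (x, v j x)" and k: "0 \<le> k"
  shows "\<bar>lip_minorant v f k (x, u) - lip_minorant v f k (x, u')\<bar> \<le> k * dist u u'"
proof -
  let ?I = "\<lambda>u. INF j. f (x, v j x) + k * dist u (v j x)"
  have *: "?I u \<le> ?I u' + k * dist u u'" for u u'
  proof -
    have "?I u - k * dist u u' \<le> ?I u'"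
    proof (rule cINF_greatest)
      fix j
      have "bdd_below (range (\<lambda>j. f (x, v j x) + k * dist u (v j x)))"
        using nn k by (intro bdd_belowI[of _ 0]) auto
      then have "?I u \<le> f (x, v j x) + k * dist u (v j x)" by (rule cINF_lower) simp
      also have "k * dist u (v j x) \<le> k * (dist u u' + dist u' (v j x))"
        using k dist_triangle by (intro mult_left_mono)
      finally show "?I u - k * dist u u' \<le> f (x, v j x) + k * dist u' (v j x)" by (simp add: algebra_simps)
    qed simp
    then show ?thesis by simp
  qed
  show ?thesis using *[of u u'] *[of u' u] by (auto simp: lip_minorant_def dist_commute min_def abs_le_iff)
qed

lemma lip_minorant_measurable:
  assumes "\<And>j. v j \<in> N \<rightarrow>\<^sub>M (borel :: 'u::polish_space measure)" "\<And>j. (\<lambda>x. f (x, v j x)) \<in> borel_measurable N"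
  shows "(\<lambda>x. lip_minorant v f k (x, u)) \<in> borel_measurable N"
proof -
  have "(\<lambda>x. INF j. f (x, v j x) + k * dist u (v j x)) \<in> borel_measurable N"
  proof (rule borel_measurable_cINF_real)
    show "(\<lambda>x. f (x, v j x) + k * dist u (v j x)) \<in> borel_measurable N" for j
      using assms(1)[of j] assms(2)[of j] by measurable
  qed simp
  then show ?thesis unfolding lip_minorant_def fst_conv snd_conv
    by (intro borel_measurable_min borel_measurable_const)
qed

lemma lip_minorant_le:
  assumes nn: "\<And>j. 0 \<le> f (x, v j x)" and k: "0 \<le> k" and v: "\<And>j. v j x \<in> \<Gamma> x"
    and dense: "\<And>e. e > 0 \<Longrightarrow> \<exists>j. dist u (v j x) < e"
    and u: "u \<in> \<Gamma> x" and cont: "continuous_on (\<Gamma> x) (\<lambda>u. f (x, u))"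
  shows "lip_minorant v f k (x, u) \<le> f (x, u)"
proof (rule field_le_epsilon)
  fix e :: real assume e: "0 < e"
  have "\<exists>d>0. \<forall>u'\<in>\<Gamma> x. dist u' u < d \<longrightarrow> dist (f (x, u')) (f (x, u)) < e / 2"
    using cont[unfolded continuous_on_iff, rule_format, OF u, of "e / 2"] e by simp
  then obtain d where d: "d > 0" "\<And>u'. u' \<in> \<Gamma> x \<Longrightarrow> dist u' u < d \<Longrightarrow> dist (f (x, u')) (f (x, u)) < e / 2"
    by blast
  have "0 < min d (e / (2 * (k + 1)))" using d e k by simp
  from dense[OF this] obtain j where j: "dist u (v j x) < d" "dist u (v j x) < e / (2 * (k + 1))" by auto
  have "f (x, v j x) < f (x, u) + e / 2"
  proof -
    have "dist (v j x) u < d" using j(1) by (simp add: dist_commute)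
    from d(2)[OF v this] show ?thesis unfolding dist_real_def by linarith
  qed
  moreover have "k * dist u (v j x) \<le> e / 2"
  proof -
    have "k * dist u (v j x) \<le> (k + 1) * (e / (2 * (k + 1)))"
      using j(2) k by (intro mult_mono) auto
    also have "\<dots> = e / 2" using k by (simp add: field_simps)
    finally show ?thesis .
  qed
  moreover have "(INF j. f (x, v j x) + k * dist u (v j x)) \<le> f (x, v j x) + k * dist u (v j x)"
    using nn k by (intro cINF_lower bdd_belowI[of _ 0]) auto
  ultimately show "lip_minorant v f k (x, u) \<le> f (x, u) + e"
    by (simp add: lip_minorant_def)
qed

text \<open>A selection near \<open>u\<close> has a value near \<open>f (x, u)\<close> by continuity; for a selection farther than \<open>d\<close> the
  penalty \<open>k * d\<close> exceeds \<open>f (x, u)\<close> once \<open>k\<close> is large.\<close>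

lemma lip_minorant_tendsto:
  assumes nn: "\<And>j. 0 \<le> f (x, v j x)" "0 \<le> f (x, u)" and v: "\<And>j. v j x \<in> \<Gamma> x"
    and dense: "\<And>e. e > 0 \<Longrightarrow> \<exists>j. dist u (v j x) < e"
    and u: "u \<in> \<Gamma> x" and cont: "continuous_on (\<Gamma> x) (\<lambda>u. f (x, u))"
  shows "(\<lambda>k. lip_minorant v f (real k) (x, u)) \<longlonglongrightarrow> f (x, u)"
proof (rule LIMSEQ_I)
  fix e :: real assume e: "0 < e"
  have "\<exists>d>0. \<forall>u'\<in>\<Gamma> x. dist u' u < d \<longrightarrow> dist (f (x, u')) (f (x, u)) < e / 2"
    using cont[unfolded continuous_on_iff, rule_format, OF u, of "e / 2"] e by simp
  then obtain d where d: "d > 0" "\<And>u'. u' \<in> \<Gamma> x \<Longrightarrow> dist u' u < d \<Longrightarrow> dist (f (x, u')) (f (x, u)) < e / 2"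
    by blast
  obtain k0 :: nat where k0: "f (x, u) / d \<le> real k0" "f (x, u) \<le> real k0"
    using real_arch_simple[of "max (f (x, u) / d) (f (x, u))"] by auto
  show "\<exists>no. \<forall>k\<ge>no. norm (lip_minorant v f (real k) (x, u) - f (x, u)) < e"
  proof (intro exI allI impI)
    fix k assume "k0 \<le> k"
    then have k: "f (x, u) / d \<le> real k" "f (x, u) \<le> real k" using k0 by auto
    have "f (x, u) - e / 2 \<le> (INF j. f (x, v j x) + real k * dist u (v j x))"
    proof (rule cINF_greatest)
      fix j
      show "f (x, u) - e / 2 \<le> f (x, v j x) + real k * dist u (v j x)"
      proof (cases "dist u (v j x) < d")
        case True
        then have "dist (v j x) u < d" by (simp add: dist_commute)
        from d(2)[OF v this] have "f (x, u) - e / 2 \<le> f (x, v j x)"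
          unfolding dist_real_def by linarith
        moreover have "0 \<le> real k * dist u (v j x)" by simp
        ultimately show ?thesis by linarith
      next
        case False
        have "f (x, u) \<le> real k * d" using k(1) d(1) by (simp add: pos_divide_le_eq)
        also have "\<dots> \<le> real k * dist u (v j x)" using False by (intro mult_left_mono) auto
        finally show ?thesis using nn(1)[of j] e by linarith
      qed
    qed simp
    then have "f (x, u) - e / 2 \<le> lip_minorant v f (real k) (x, u)"
      using k(2) e by (simp add: lip_minorant_def)
    moreover have "lip_minorant v f (real k) (x, u) \<le> f (x, u)"
      by (rule lip_minorant_le[where \<Gamma>=\<Gamma>]) (use assms in auto)
    ultimately show "norm (lip_minorant v f (real k) (x, u) - f (x, u)) < e"
      using e unfolding real_norm_def by linarith
  qed
qed

lemma lip_minorant_zero_imp_mem: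
  assumes v: "\<And>j. v j x \<in> \<Gamma> x" and cl: "closed (\<Gamma> x)" and z: "lip_minorant v (\<lambda>_. 0) 1 (x, u) = 0"
  shows "u \<in> \<Gamma> x"
proof -
  have "(INF j. dist u (v j x)) = 0" using z by (simp add: lip_minorant_def min_def split: if_splits)
  then have "\<exists>j. dist u (v j x) < e" if "e > 0" for e
    using cInf_lessD[of "range (\<lambda>j. dist u (v j x))" e] that by auto
  then have "u \<in> closure (\<Gamma> x)" 
    unfolding closure_approachable using v by (metis dist_commute)
  then show ?thesis using cl by simp
qed

subsection \<open>The compactness theorem\<close>

text \<open>The hypotheses under which dense measurable selections exist. \<open>distance\<close> below is the distance to
  \<open>\<Gamma> x\<close> cut at \<open>1\<close>, whose zero set over \<open>space N\<close> is the graph of \<open>\<Gamma>\<close>.\<close>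

locale selectable =
  fixes N :: "'x measure" and \<Gamma> :: "'x \<Rightarrow> 'u::polish_space set"
  assumes ne: "\<And>x. x \<in> space N \<Longrightarrow> \<Gamma> x \<noteq> {}" and cl: "\<And>x. x \<in> space N \<Longrightarrow> closed (\<Gamma> x)"
    and lower_meas: "\<And>G. open G \<Longrightarrow> {x \<in> space N. \<Gamma> x \<inter> G \<noteq> {}} \<in> sets N"
begin

abbreviation "graph \<equiv> Sigma (space N) \<Gamma>"

definition sel :: "nat \<Rightarrow> 'x \<Rightarrow> 'u" where
  "sel = (SOME v. (\<forall>j. v j \<in> N \<rightarrow>\<^sub>M borel) \<and>
    (\<forall>x\<in>space N. (\<forall>j. v j x \<in> \<Gamma> x) \<and> (\<forall>u\<in>\<Gamma> x. \<forall>e>0. \<exists>j. dist u (v j x) < e)))"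

lemma sel:
  shows measurable_sel[measurable]: "sel j \<in> N \<rightarrow>\<^sub>M borel"
    and sel_in: "x \<in> space N \<Longrightarrow> sel j x \<in> \<Gamma> x"
    and sel_dense: "x \<in> space N \<Longrightarrow> u \<in> \<Gamma> x \<Longrightarrow> e > 0 \<Longrightarrow> \<exists>j. dist u (sel j x) < e"
  using someI_ex[OF measurable_dense_selections[OF ne cl lower_meas], folded sel_def] by blast+

abbreviation "distance \<equiv> lip_minorant sel (\<lambda>_. 0) 1"

lemma distance_measurable[measurable]: "distance \<in> borel_measurable (N \<Otimes>\<^sub>M borel)"
  by (rule lipschitz_caratheodory_measurable[OF lip_minorant_measurable lip_minorant_lipschitz])
    (auto intro: measurable_sel)

lemma distance_zero_iff: "x \<in> space N \<Longrightarrow> distance (x, u) = 0 \<longleftrightarrow> u \<in> \<Gamma> x"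
proof
  assume x: "x \<in> space N" and "u \<in> \<Gamma> x"
  then have "distance (x, u) \<le> 0"
    by (intro lip_minorant_le[where \<Gamma>=\<Gamma> and f="\<lambda>_. 0"]) (auto intro: sel_in sel_dense)
  moreover have "0 \<le> distance (x, u)" by (rule lip_minorant_bounds) auto
  ultimately show "distance (x, u) = 0" by simp
next
  assume x: "x \<in> space N" and d: "distance (x, u) = 0"
  show "u \<in> \<Gamma> x"
    by (rule lip_minorant_zero_imp_mem[where v=sel and \<Gamma>=\<Gamma> and x=x, OF sel_in[OF x] cl[OF x] d])
qed

lemma graph_sets[measurable]: "graph \<in> sets (N \<Otimes>\<^sub>M borel)"
proof -
  have "{z \<in> space (N \<Otimes>\<^sub>M borel). distance z = 0} \<in> sets (N \<Otimes>\<^sub>M borel)" by measurable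
  also have "{z \<in> space (N \<Otimes>\<^sub>M borel). distance z = 0} = graph"
    using distance_zero_iff by (auto simp: space_pair_measure)
  finally show ?thesis .
qed

text \<open>Weak convergence in the action variable, tested against functions Lipschitz in the action, gives
  lower semicontinuity for all nonnegative integrands measurable in the state and continuous in the
  action, because on the graph their Lipschitz minorants converge to them. The limit stays on the graph
  because the truncated distance to \<open>\<Gamma> x\<close> is itself such a test function.\<close>

theorem dominated_marginals_compactness:
  fixes \<mu> :: "nat \<Rightarrow> ('x \<times> 'u) measure"
  assumes N: "finite_measure N" "countably_generated N"
    and \<mu>: "\<And>n. \<mu> n \<in> space (prob_algebra (N \<Otimes>\<^sub>M borel))"
    and graph: "\<And>n. AE z in \<mu> n. snd z \<in> \<Gamma> (fst z)"
    and dom: "\<And>n A. A \<in> sets N \<Longrightarrow> emeasure (\<mu> n) (A \<times> UNIV) \<le> emeasure N A"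
    and tight: "\<And>e. e > 0 \<Longrightarrow> \<exists>L. compact L \<and> (\<forall>n. measure (\<mu> n) {z \<in> space (N \<Otimes>\<^sub>M borel). snd z \<notin> L} \<le> e)"
  shows "\<exists>r m \<phi>. strict_mono r \<and> m \<in> space (prob_algebra N) \<and> (\<forall>A\<in>sets N. emeasure m A \<le> emeasure N A) \<and>
     \<phi> \<in> N \<rightarrow>\<^sub>M prob_algebra borel \<and> (\<forall>x\<in>space N. emeasure (\<phi> x) (\<Gamma> x) = 1) \<and>
     (\<forall>f. f \<in> borel_measurable (restrict_space (N \<Otimes>\<^sub>M borel) graph) \<longrightarrow> (\<forall>z\<in>graph. (0::real) \<le> f z) \<longrightarrow>
        (\<forall>x\<in>space N. continuous_on (\<Gamma> x) (\<lambda>u. f (x, u))) \<longrightarrow>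
        (\<integral>\<^sup>+z. ennreal (f z) * indicator graph z \<partial>kernel_prod N borel m \<phi>)
          \<le> liminf (\<lambda>n. \<integral>\<^sup>+z. ennreal (f z) * indicator graph z \<partial>\<mu> (r n)))"
proof -
  note \<mu>s = in_prob_algebraD[OF \<mu>]
  let ?c = "\<lambda>z::'x \<times> 'u. (fst z, code (snd z))"
  let ?d = "\<lambda>z. (fst z, decode (snd z) :: 'u)"
  have cM[measurable]: "?c \<in> N \<Otimes>\<^sub>M borel \<rightarrow>\<^sub>M N \<Otimes>\<^sub>M baire" by measurable
  have dM[measurable]: "?d \<in> N \<Otimes>\<^sub>M baire \<rightarrow>\<^sub>M N \<Otimes>\<^sub>M borel" by measurable
  have c\<mu>: "?c \<in> \<mu> n \<rightarrow>\<^sub>M N \<Otimes>\<^sub>M baire" for n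
    using cM measurable_cong_sets[OF \<mu>s(2) refl] by blast
  define P where "P n = distr (\<mu> n) (N \<Otimes>\<^sub>M baire) ?c" for n
  have P: "P n \<in> space (prob_algebra (N \<Otimes>\<^sub>M baire))" for n
    unfolding P_def space_prob_algebra using prob_space.prob_space_distr[OF \<mu>s(1) c\<mu>] by simp
  have Pe: "emeasure (P n) E = emeasure (\<mu> n) (?c -` E \<inter> space (N \<Otimes>\<^sub>M borel))"
    if "E \<in> sets (N \<Otimes>\<^sub>M baire)" for n E
    unfolding P_def using emeasure_distr[OF c\<mu> that] by (simp add: \<mu>s)
  have "\<exists>r m \<kappa>. strict_mono r \<and> m \<in> space (prob_algebra N) \<and> (\<forall>A\<in>sets N. emeasure m A \<le> emeasure N A) \<and>
     \<kappa> \<in> N \<rightarrow>\<^sub>M prob_algebra baire \<and>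
     (\<forall>A\<in>sets N. \<forall>w. (\<lambda>n. measure (P (r n)) (A \<times> cyl w)) \<longlonglongrightarrow> measure (kernel_prod N baire m \<kappa>) (A \<times> cyl w))"
  proof (rule cylinderwise_limit[OF N P])
    fix n A assume A: "A \<in> sets N"
    have "?c -` (A \<times> UNIV) \<inter> space (N \<Otimes>\<^sub>M borel) = A \<times> UNIV"
      using sets.sets_into_space[OF A] by (auto simp: space_pair_measure)
    then show "emeasure (P n) (A \<times> UNIV) \<le> emeasure N A"
      using dom[OF A, of n] A by (simp add: Pe)
  next
    fix k and e :: real assume "0 < e"
    from tight[OF this] obtain L where L: "compact L"
      "\<And>n. measure (\<mu> n) {z \<in> space (N \<Otimes>\<^sub>M borel). snd z \<notin> L} \<le> e" by blast
    define F where "F = (\<lambda>u. code u k) ` L"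
    have "measure (P n) {z \<in> space (N \<Otimes>\<^sub>M baire). snd z k \<notin> F} \<le> e" for n
    proof -
      interpret prob_space "\<mu> n" by (rule \<mu>s)
      have [measurable]: "L \<in> sets borel" using L(1) by (intro borel_closed compact_imp_closed)
      have FM: "{z \<in> space (N \<Otimes>\<^sub>M baire). snd z k \<notin> F} \<in> sets (N \<Otimes>\<^sub>M baire)" by measurable
      have LM: "{z \<in> space (N \<Otimes>\<^sub>M borel). snd z \<notin> L} \<in> sets (\<mu> n)" unfolding \<mu>s by measurable
      have "measure (P n) {z \<in> space (N \<Otimes>\<^sub>M baire). snd z k \<notin> F}
          = measure (\<mu> n) (?c -` {z \<in> space (N \<Otimes>\<^sub>M baire). snd z k \<notin> F} \<inter> space (N \<Otimes>\<^sub>M borel))"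
        using Pe[OF FM] by (simp add: measure_def)
      also have "\<dots> \<le> measure (\<mu> n) {z \<in> space (N \<Otimes>\<^sub>M borel). snd z \<notin> L}"
        by (rule finite_measure_mono[OF _ LM]) (auto simp: F_def)
      finally show ?thesis using L(2)[of n] by simp
    qed
    then show "\<exists>F. finite F \<and> (\<forall>n. measure (P n) {z \<in> space (N \<Otimes>\<^sub>M baire). snd z k \<notin> F} \<le> e)"
      using finite_code_compact[OF L(1), of k] by (auto simp: F_def intro!: exI[of _ F])
  qed
  then obtain r m \<kappa> where r: "strict_mono r" and m: "m \<in> space (prob_algebra N)"
    and mle: "\<And>A. A \<in> sets N \<Longrightarrow> emeasure m A \<le> emeasure N A"
    and \<kappa>: "\<kappa> \<in> N \<rightarrow>\<^sub>M prob_algebra baire"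
    and conv: "\<And>A w. A \<in> sets N \<Longrightarrow>
      (\<lambda>n. measure (P (r n)) (A \<times> cyl w)) \<longlonglongrightarrow> measure (kernel_prod N baire m \<kappa>) (A \<times> cyl w)"
    by blast
  define P' where "P' = kernel_prod N baire m \<kappa>"
  have P': "P' \<in> space (prob_algebra (N \<Otimes>\<^sub>M baire))"
    unfolding P'_def by (rule kernel_prod_in_prob_algebra[OF m \<kappa>])
  note P's = in_prob_algebraD[OF P']
  interpret P': prob_space P' by (rule P's)
  have dP: "AE z in P n. snd z \<in> decodable TYPE('u)" for n
  proof -
    have "AE z in distr (\<mu> n) (N \<Otimes>\<^sub>M baire) ?c. snd z \<in> decodable TYPE('u)"
      by (subst AE_distr_iff[OF c\<mu>]) (auto simp: code_decodable)
    then show ?thesis unfolding P_def .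
  qed
  \<comment> \<open>A word that is no prefix of a code has no mass along the sequence, hence none in the limit.\<close>
  have null: "space N \<times> cyl w \<in> null_sets P'" if w: "\<And>u::'u. code u \<notin> cyl w" for w
  proof (rule null_setsI)
    have "?c -` (space N \<times> cyl w) \<inter> space (N \<Otimes>\<^sub>M borel) = {}" using w by auto
    then have "measure (P (r n)) (space N \<times> cyl w) = 0" for n
      using Pe[of "space N \<times> cyl w" "r n"] by (simp add: measure_def)
    then have "measure P' (space N \<times> cyl w) = 0"
      using conv[of "space N" w] by (simp add: P'_def LIMSEQ_const_iff)
    then show "emeasure P' (space N \<times> cyl w) = 0" by (simp add: P'.emeasure_eq_measure)
  qed (simp add: P's)
  have dP': "AE z in P'. snd z \<in> decodable TYPE('u)"
  proof (rule AE_I')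
    let ?B = "{w. \<forall>u::'u. code u \<notin> cyl w}"
    show "(\<Union>w\<in>?B. space N \<times> cyl w) \<in> null_sets P'"
      by (rule null_sets_UN') (auto intro: null)
    show "{z \<in> space P'. snd z \<notin> decodable TYPE('u)} \<subseteq> (\<Union>w\<in>?B. space N \<times> cyl w)"
    proof
      fix z assume z: "z \<in> {z \<in> space P'. snd z \<notin> decodable TYPE('u)}"
      then obtain n where "\<forall>u::'u. code u \<notin> cyl (prefix_of n (snd z))"
        using not_decodable_prefix[of "snd z", where 'u='u] by auto
      moreover have "z \<in> space N \<times> cyl (prefix_of n (snd z))"
        using z by (auto simp: P's space_pair_measure cyl_def)
      ultimately show "z \<in> (\<Union>w\<in>?B. space N \<times> cyl w)" by blast
    qed
  qed
  define \<phi>0 where "\<phi>0 x = distr (\<kappa> x) (borel :: 'u measure) decode" for x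
  have \<phi>0: "\<phi>0 \<in> N \<rightarrow>\<^sub>M prob_algebra borel"
    unfolding \<phi>0_def by (rule measurable_compose[OF \<kappa> measurable_distr_prob_space[OF measurable_decode]])
  define \<mu>' where "\<mu>' = kernel_prod N borel m \<phi>0"
  have \<mu>': "\<mu>' \<in> space (prob_algebra (N \<Otimes>\<^sub>M borel))"
    unfolding \<mu>'_def by (rule kernel_prod_in_prob_algebra[OF m \<phi>0])
  note \<mu>'s = in_prob_algebraD[OF \<mu>']
  interpret \<mu>': prob_space \<mu>' by (rule \<mu>'s)
  have dP'M: "?d \<in> P' \<rightarrow>\<^sub>M N \<Otimes>\<^sub>M borel"
    using dM measurable_cong_sets[OF P's(2) refl] by blast
  have \<mu>'_distr: "\<mu>' = distr P' (N \<Otimes>\<^sub>M borel) ?d"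
  proof (rule measure_eqI)
    show "sets \<mu>' = sets (distr P' (N \<Otimes>\<^sub>M borel) ?d)" by (simp add: \<mu>'s)
    fix E assume "E \<in> sets \<mu>'"
    then have E[measurable]: "E \<in> sets (N \<Otimes>\<^sub>M borel)" by (simp add: \<mu>'s)
    have "emeasure \<mu>' E = (\<integral>\<^sup>+z. indicator E z \<partial>\<mu>')" using E by (simp add: \<mu>'s)
    also have "\<dots> = (\<integral>\<^sup>+x. \<integral>\<^sup>+u. indicator E (x, u) \<partial>\<phi>0 x \<partial>m)"
      unfolding \<mu>'_def by (rule nn_integral_kernel_prod[OF m \<phi>0]) simp
    also have "\<dots> = (\<integral>\<^sup>+x. \<integral>\<^sup>+\<omega>. indicator E (x, decode \<omega>) \<partial>\<kappa> x \<partial>m)"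
    proof (rule nn_integral_cong)
      fix x assume "x \<in> space m"
      then have x[measurable]: "x \<in> space N" using in_prob_algebraD(3)[OF m] by simp
      have 1: "decode \<in> \<kappa> x \<rightarrow>\<^sub>M (borel :: 'u measure)"
        using measurable_decode measurable_cong_sets[OF kernelD(2)[OF \<kappa> x] refl] by blast
      have 2: "(\<lambda>u. indicator E (x, u) :: ennreal) \<in> borel_measurable borel" by measurable
      show "(\<integral>\<^sup>+u. indicator E (x, u) \<partial>\<phi>0 x) = (\<integral>\<^sup>+\<omega>. indicator E (x, decode \<omega>) \<partial>\<kappa> x)"
        unfolding \<phi>0_def using nn_integral_distr[OF 1, of "\<lambda>u. indicator E (x, u)"] 2 by simp
    qed
    also have "\<dots> = (\<integral>\<^sup>+z. indicator E (?d z) \<partial>P')"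
      unfolding P'_def by (subst nn_integral_kernel_prod[OF m \<kappa>]) auto
    also have "\<dots> = (\<integral>\<^sup>+z. indicator E z \<partial>distr P' (N \<Otimes>\<^sub>M borel) ?d)"
      using E by (subst nn_integral_distr[OF dP'M]) auto
    also have "\<dots> = emeasure (distr P' (N \<Otimes>\<^sub>M borel) ?d) E" using E by simp
    finally show "emeasure \<mu>' E = emeasure (distr P' (N \<Otimes>\<^sub>M borel) ?d) E" .
  qed
  have lipconv: "(\<lambda>n. \<integral>z. h z \<partial>\<mu> (r n)) \<longlonglongrightarrow> (\<integral>z. h z \<partial>\<mu>')"
    if h1: "\<And>u. (\<lambda>x. h (x, u)) \<in> borel_measurable N"
      and h2: "\<And>x u u'. x \<in> space N \<Longrightarrow> \<bar>h (x, u) - h (x, u')\<bar> \<le> K * dist u u'" and K: "0 \<le> K"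
      and h3: "\<And>x u. x \<in> space N \<Longrightarrow> \<bar>h (x, u)\<bar> \<le> B" for h :: "'x \<times> 'u \<Rightarrow> real" and K B
  proof -
    have hM: "h \<in> borel_measurable (N \<Otimes>\<^sub>M borel)"
      by (rule lipschitz_caratheodory_measurable[OF h1 h2])
    then have hd: "(\<lambda>z. h (fst z, decode (snd z))) \<in> borel_measurable (N \<Otimes>\<^sub>M baire)"
      by measurable
    have "(\<lambda>n. \<integral>z. h (fst z, decode (snd z)) \<partial>P (r n)) \<longlonglongrightarrow> (\<integral>z. h (fst z, decode (snd z)) \<partial>P')"
      by (rule lipschitz_integral_tendsto[OF P P' _ dP dP' h1 h2 K h3]) (auto intro: conv simp: P'_def)
    moreover have "(\<integral>z. h (fst z, decode (snd z)) \<partial>P n) = (\<integral>z. h z \<partial>\<mu> n)" for n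
      unfolding P_def by (subst integral_distr[OF c\<mu> hd]) simp
    moreover have "(\<integral>z. h (fst z, decode (snd z)) \<partial>P') = (\<integral>z. h z \<partial>\<mu>')"
      unfolding \<mu>'_distr by (subst integral_distr[OF dP'M hM]) simp
    ultimately show ?thesis by simp
  qed
  have distM: "distance \<in> borel_measurable \<mu>'" "distance \<in> borel_measurable (\<mu> n)" for n
    using distance_measurable measurable_cong_sets[OF \<mu>'s(2) refl] measurable_cong_sets[OF \<mu>s(2) refl] by blast+
  have dist0: "0 \<le> distance z" "distance z \<le> 1" for z
    using lip_minorant_bounds[of "\<lambda>_. 0" _ sel 1] by (cases z; simp)+
  have "(\<lambda>n. \<integral>z. distance z \<partial>\<mu> (r n)) \<longlonglongrightarrow> (\<integral>z. distance z \<partial>\<mu>')"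
  proof (rule lipconv)
    show "(\<lambda>x. distance (x, u)) \<in> borel_measurable N" for u
      by (rule lip_minorant_measurable) auto
    show "\<bar>distance (x, u) - distance (x, u')\<bar> \<le> 1 * dist u u'" for x u u'
      by (rule lip_minorant_lipschitz) auto
    show "\<bar>distance (x, u)\<bar> \<le> 1" for x u using dist0[of "(x, u)"] by simp
  qed simp
  moreover have "(\<integral>z. distance z \<partial>\<mu> n) = 0" for n
  proof -
    have "AE z in \<mu> n. distance z = 0"
      using graph[of n] AE_space by eventually_elim (auto simp: \<mu>s space_pair_measure distance_zero_iff)
    then show ?thesis using integral_cong_AE[OF distM(2), of "\<lambda>_. 0"] by simp
  qed
  ultimately have "(\<integral>z. distance z \<partial>\<mu>') = 0" by (simp add: LIMSEQ_const_iff)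
  moreover have "integrable \<mu>' distance"
    using distM(1) dist0 by (intro \<mu>'.integrable_const_bound[of _ 1]) auto
  ultimately have "AE z in \<mu>'. distance z = 0"
    using integral_nonneg_eq_0_iff_AE[of \<mu>' distance] dist0(1) by simp
  then have graph': "AE z in \<mu>'. z \<in> graph"
    using AE_space by eventually_elim (auto simp: \<mu>'s space_pair_measure distance_zero_iff)
  have "(\<integral>\<^sup>+x. \<integral>\<^sup>+u. indicator (space (N \<Otimes>\<^sub>M borel) - graph) (x, u) \<partial>\<phi>0 x \<partial>m)
      = (\<integral>\<^sup>+z. indicator (space (N \<Otimes>\<^sub>M borel) - graph) z \<partial>\<mu>')"
    unfolding \<mu>'_def by (rule nn_integral_kernel_prod[OF m \<phi>0, symmetric]) measurable
  also have "\<dots> = (\<integral>\<^sup>+z. 0 \<partial>\<mu>')"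
    using graph' by (intro nn_integral_cong_AE) (auto elim: eventually_mono)
  finally have I0: "(\<integral>\<^sup>+x. \<integral>\<^sup>+u. indicator (space (N \<Otimes>\<^sub>M borel) - graph) (x, u) \<partial>\<phi>0 x \<partial>m) = 0" by simp
  have \<Gamma>b: "\<Gamma> x \<in> sets borel" if "x \<in> space N" for x using cl[OF that] by simp
  have slice: "(\<integral>\<^sup>+u. indicator (space (N \<Otimes>\<^sub>M borel) - graph) (x, u) \<partial>\<phi>0 x) = emeasure (\<phi>0 x) (UNIV - \<Gamma> x)"
    if x: "x \<in> space N" for x
  proof -
    have "(\<integral>\<^sup>+u. indicator (space (N \<Otimes>\<^sub>M borel) - graph) (x, u) \<partial>\<phi>0 x) = (\<integral>\<^sup>+u. indicator (UNIV - \<Gamma> x) u \<partial>\<phi>0 x)"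
      using x by (intro nn_integral_cong) (auto simp: space_pair_measure split: split_indicator)
    also have "\<dots> = emeasure (\<phi>0 x) (UNIV - \<Gamma> x)"
      using \<Gamma>b[OF x] kernelD(2)[OF \<phi>0 x] by (intro nn_integral_indicator) auto
    finally show ?thesis .
  qed
  have compM: "(\<lambda>x. emeasure (\<phi>0 x) (\<Gamma> x)) \<in> borel_measurable N"
    by (rule emeasure_measurable_subprob_algebra2[OF graph_sets measurable_prob_algebraD[OF \<phi>0]])
  have "AE x in m. (\<integral>\<^sup>+u. indicator (space (N \<Otimes>\<^sub>M borel) - graph) (x, u) \<partial>\<phi>0 x) = 0"
  proof (subst nn_integral_0_iff_AE[symmetric])
    have "(\<lambda>x. \<integral>\<^sup>+u. indicator (space (N \<Otimes>\<^sub>M borel) - graph) (x, u) \<partial>\<phi>0 x) \<in> borel_measurable N"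
      by (rule nn_integral_measurable_subprob_algebra2[OF _ measurable_prob_algebraD[OF \<phi>0]]) measurable
    then show "(\<lambda>x. \<integral>\<^sup>+u. indicator (space (N \<Otimes>\<^sub>M borel) - graph) (x, u) \<partial>\<phi>0 x) \<in> borel_measurable m"
      using measurable_cong_sets[OF in_prob_algebraD(2)[OF m] refl] by blast
  qed (rule I0)
  then have \<phi>0_AE: "AE x in m. emeasure (\<phi>0 x) (\<Gamma> x) = 1"
    using AE_space
  proof eventually_elim
    case (elim x)
    then have x: "x \<in> space N" using in_prob_algebraD(3)[OF m] by simp
    interpret prob_space "\<phi>0 x" by (rule kernelD[OF \<phi>0 x])
    have "\<Gamma> x \<in> sets (\<phi>0 x)" using \<Gamma>b[OF x] kernelD(2)[OF \<phi>0 x] by simp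
    then have "prob (space (\<phi>0 x) - \<Gamma> x) = 1 - prob (\<Gamma> x)" by (rule prob_compl)
    moreover have "space (\<phi>0 x) = UNIV" using kernelD(3)[OF \<phi>0 x] by simp
    ultimately show ?case using elim(1) slice[OF x] by (simp add: emeasure_eq_measure)
  qed
  \<comment> \<open>Corrected on a null set, so that \<open>\<phi> x\<close> lives on \<open>\<Gamma> x\<close> for every \<open>x\<close>.\<close>
  define \<phi> where "\<phi> x = (if emeasure (\<phi>0 x) (\<Gamma> x) = 1 then \<phi>0 x else return borel (sel 0 x))" for x
  have \<phi>: "\<phi> \<in> N \<rightarrow>\<^sub>M prob_algebra borel"
    unfolding \<phi>_def
  proof (rule measurable_If[OF \<phi>0])
    show "(\<lambda>x. return borel (sel 0 x)) \<in> N \<rightarrow>\<^sub>M prob_algebra borel"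
      by (rule measurable_compose[OF measurable_sel measurable_return_prob_space])
    show "{x \<in> space N. emeasure (\<phi>0 x) (\<Gamma> x) = 1} \<in> sets N"
      using compM by measurable
  qed
  have \<phi>1: "emeasure (\<phi> x) (\<Gamma> x) = 1" if x: "x \<in> space N" for x
    using \<Gamma>b[OF x] sel_in[OF x, of 0] by (simp add: \<phi>_def)
  have \<mu>'_\<phi>: "kernel_prod N borel m \<phi> = \<mu>'"
    unfolding \<mu>'_def kernel_prod_def
  proof (rule bind_cong_AE'[OF m kernel_prod_kernel[OF \<phi>] kernel_prod_kernel[OF \<phi>0]])
    show "AE x in m. distr (\<phi> x) (N \<Otimes>\<^sub>M borel) (Pair x) = distr (\<phi>0 x) (N \<Otimes>\<^sub>M borel) (Pair x)"
      using \<phi>0_AE by eventually_elim (simp add: \<phi>_def)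
  qed
  have lsc: "(\<integral>\<^sup>+z. ennreal (f z) * indicator graph z \<partial>\<mu>')
      \<le> liminf (\<lambda>n. \<integral>\<^sup>+z. ennreal (f z) * indicator graph z \<partial>\<mu> (r n))"
    if fM: "f \<in> borel_measurable (restrict_space (N \<Otimes>\<^sub>M borel) graph)" and f0: "\<And>z. z \<in> graph \<Longrightarrow> 0 \<le> f z"
      and fc: "\<And>x. x \<in> space N \<Longrightarrow> continuous_on (\<Gamma> x) (\<lambda>u. f (x, u))" for f :: "'x \<times> 'u \<Rightarrow> real"
  proof -
    define F where "F k = lip_minorant sel f (real k)" for k
    have fsel: "(\<lambda>x. f (x, sel j x)) \<in> borel_measurable N" for j
    proof (rule measurable_compose[OF _ fM])
      show "(\<lambda>x. (x, sel j x)) \<in> N \<rightarrow>\<^sub>M restrict_space (N \<Otimes>\<^sub>M borel) graph"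
        by (rule measurable_restrict_space2) (auto simp: sel_in)
    qed
    have f0s: "0 \<le> f (x, sel j x)" if "x \<in> space N" for x j
      using f0[of "(x, sel j x)"] sel_in[OF that] that by simp
    have F1: "(\<lambda>x. F k (x, u)) \<in> borel_measurable N" for k u
      unfolding F_def by (rule lip_minorant_measurable[OF measurable_sel fsel])
    have F2: "\<bar>F k (x, u) - F k (x, u')\<bar> \<le> real k * dist u u'" if "x \<in> space N" for k x u u'
      unfolding F_def by (rule lip_minorant_lipschitz) (auto intro: f0s that)
    have F3: "0 \<le> F k (x, u)" "F k (x, u) \<le> real k" if "x \<in> space N" for k x u
      unfolding F_def by (rule lip_minorant_bounds; auto intro: f0s that)+
    have FM: "F k \<in> borel_measurable (N \<Otimes>\<^sub>M borel)" for k
      by (rule lipschitz_caratheodory_measurable[OF F1 F2])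
    have FQ: "F k \<in> borel_measurable Q" "AE z in Q. 0 \<le> F k z" "integrable Q (F k)"
      if Q: "Q \<in> space (prob_algebra (N \<Otimes>\<^sub>M borel))" for Q k
    proof -
      interpret Q: prob_space Q by (rule in_prob_algebraD[OF Q])
      show 1: "F k \<in> borel_measurable Q"
        using FM measurable_cong_sets[OF in_prob_algebraD(2)[OF Q] refl] by blast
      show "AE z in Q. 0 \<le> F k z"
        using F3(1) by (intro AE_I2) (auto simp: in_prob_algebraD(3)[OF Q] space_pair_measure)
      show "integrable Q (F k)"
      proof (rule Q.integrable_const_bound[OF _ 1])
        show "AE z in Q. norm (F k z) \<le> real k"
          using F3 by (intro AE_I2) (auto simp: in_prob_algebraD(3)[OF Q] space_pair_measure)
      qed
    qed
    have Fconv: "(\<lambda>n. \<integral>\<^sup>+z. ennreal (F k z) \<partial>\<mu> (r n)) \<longlonglongrightarrow> (\<integral>\<^sup>+z. ennreal (F k z) \<partial>\<mu>')" for k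
    proof -
      have "(\<lambda>n. \<integral>z. F k z \<partial>\<mu> (r n)) \<longlonglongrightarrow> (\<integral>z. F k z \<partial>\<mu>')"
      proof (rule lipconv)
        show "(\<lambda>x. F k (x, u)) \<in> borel_measurable N" for u by (rule F1)
        show "\<bar>F k (x, u) - F k (x, u')\<bar> \<le> real k * dist u u'" if "x \<in> space N" for x u u'
          by (rule F2[OF that])
        show "\<bar>F k (x, u)\<bar> \<le> real k" if "x \<in> space N" for x u
          using F3[OF that, of k u] by simp
      qed simp
      then have "(\<lambda>n. ennreal (\<integral>z. F k z \<partial>\<mu> (r n))) \<longlonglongrightarrow> ennreal (\<integral>z. F k z \<partial>\<mu>')"
        by (rule tendsto_ennrealI)
      then show ?thesis
        using nn_integral_eq_integral[OF FQ(3,2)[OF \<mu>]] nn_integral_eq_integral[OF FQ(3,2)[OF \<mu>']] by simp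
    qed
    let ?R = "liminf (\<lambda>n. \<integral>\<^sup>+z. ennreal (f z) * indicator graph z \<partial>\<mu> (r n))"
    have Fle: "(\<integral>\<^sup>+z. ennreal (F k z) \<partial>\<mu>') \<le> ?R" for k
    proof -
      have "(\<integral>\<^sup>+z. ennreal (F k z) \<partial>\<mu>') = liminf (\<lambda>n. \<integral>\<^sup>+z. ennreal (F k z) \<partial>\<mu> (r n))"
        using lim_imp_Liminf[OF _ Fconv[of k]] by simp
      also have "\<dots> \<le> ?R"
      proof (rule Liminf_mono, rule always_eventually, rule allI, rule nn_integral_mono_AE)
        fix n
        show "AE z in \<mu> (r n). ennreal (F k z) \<le> ennreal (f z) * indicator graph z"
          using graph[of "r n"] AE_space
        proof eventually_elim
          case (elim z)
          then obtain x u where z: "z = (x, u)" "x \<in> space N" "u \<in> \<Gamma> x"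
            by (cases z) (auto simp: \<mu>s space_pair_measure)
          have "F k (x, u) \<le> f (x, u)"
            unfolding F_def by (rule lip_minorant_le[where \<Gamma>=\<Gamma>])
              (auto intro: f0s z sel_in sel_dense fc)
          then show ?case using z by (simp add: ennreal_leI)
        qed
      qed
      finally show ?thesis .
    qed
    have "(\<integral>\<^sup>+z. ennreal (f z) * indicator graph z \<partial>\<mu>') = (\<integral>\<^sup>+z. liminf (\<lambda>k. ennreal (F k z)) \<partial>\<mu>')"
    proof (rule nn_integral_cong_AE)
      show "AE z in \<mu>'. ennreal (f z) * indicator graph z = liminf (\<lambda>k. ennreal (F k z))"
        using graph'
      proof eventually_elim
        case (elim z)
        then obtain x u where z: "z = (x, u)" "x \<in> space N" "u \<in> \<Gamma> x" by auto
        have "(\<lambda>k. F k (x, u)) \<longlonglongrightarrow> f (x, u)"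
          unfolding F_def by (rule lip_minorant_tendsto[where \<Gamma>=\<Gamma>])
            (use f0[of "(x, u)"] z in \<open>auto intro: f0s sel_in sel_dense fc\<close>)
        then have "(\<lambda>k. ennreal (F k (x, u))) \<longlonglongrightarrow> ennreal (f (x, u))" by (rule tendsto_ennrealI)
        then show ?case using lim_imp_Liminf[of sequentially "\<lambda>k. ennreal (F k (x, u))"] z by simp
      qed
    qed
    also have "\<dots> \<le> liminf (\<lambda>k. \<integral>\<^sup>+z. ennreal (F k z) \<partial>\<mu>')"
      using FQ(1)[OF \<mu>'] by (intro nn_integral_liminf) simp
    also have "\<dots> \<le> liminf (\<lambda>k. ?R)"
      by (intro Liminf_mono always_eventually allI Fle)
    also have "\<dots> = ?R" by (rule Liminf_const) simp
    finally show ?thesis .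
  qed
  show ?thesis
    using r m mle \<phi> \<phi>1 lsc unfolding \<mu>'_\<phi>[symmetric]
    by (intro exI[of _ r] exI[of _ m] exI[of _ \<phi>] conjI allI impI ballI) auto
qed

end

section \<open>Limits of state-action laws in a controlled model\<close>

text \<open>Lower bounds for \<open>a\<close> and for \<open>1 - a\<close> enclose \<open>a\<close>.\<close>

lemma liminf_two_sided:
  fixes a :: "nat \<Rightarrow> real"
  assumes a: "\<And>n. 0 \<le> a n" "\<And>n. a n \<le> 1" and l: "0 \<le> l" "l \<le> 1"
    and 1: "ennreal l \<le> liminf (\<lambda>n. ennreal (a n))" and 2: "ennreal (1 - l) \<le> liminf (\<lambda>n. ennreal (1 - a n))"
  shows "a \<longlonglongrightarrow> l"
proof -
  have *: "\<forall>\<^sub>F n in sequentially. l - e < a n"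
    if "ennreal l \<le> liminf (\<lambda>n. ennreal (a n))" "e > 0" "0 \<le> l" "\<And>n. 0 \<le> a n" for a :: "nat \<Rightarrow> real" and l e
  proof (cases "l - e < 0")
    case True
    then show ?thesis using that(4) by (auto intro!: always_eventually intro: less_le_trans[of _ 0])
  next
    case False
    then have "ennreal (l - e) < ennreal l" using that by (intro ennreal_lessI) auto
    with that(1) have "\<forall>\<^sub>F n in sequentially. ennreal (l - e) < ennreal (a n)"
      by (simp add: le_Liminf_iff)
    then show ?thesis
    proof eventually_elim
      case (elim n)
      then show ?case using False by (simp add: ennreal_less_iff)
    qed
  qed
  show ?thesis
  proof (rule tendstoI)
    fix e :: real assume e: "0 < e"
    have "\<forall>\<^sub>F n in sequentially. (1 - l) - e < 1 - a n"
      by (rule *[OF 2 e]) (use a l in auto)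
    with *[OF 1 e l(1) a(1)] show "\<forall>\<^sub>F n in sequentially. dist (a n) l < e"
      by eventually_elim (simp add: dist_real_def abs_less_iff)
  qed
qed

text \<open>The conditional law of the pair given the state \<open>x\<close> and the law \<open>\<kappa>\<close> of the action, separated from the
  history on which \<open>\<kappa>\<close> may depend.\<close>

definition act_law ::
    "('x::topological_space, 'u::topological_space) control_model \<Rightarrow> 'u measure \<Rightarrow> 'x \<Rightarrow> ('x \<times> 'u) measure" where
  "act_law M \<kappa> x = distr (restrict_space \<kappa> (feasible M x)) (borel_graph M) (Pair x)"

lemma pair_law_eq_act_law: "pair_law M \<gamma> t w x = act_law M (\<gamma> t (w, x)) x"
  by (simp add: pair_law_def act_law_def)

locale borel_controlled =
  fixes M :: "('x::polish_space, 'u::polish_space) control_model"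
  assumes cmc: "controlled_markov_chain M"
    and graph_borel: "graph_set M \<in> sets borel"
    and compact_feasible: "\<And>x. x \<in> states M \<Longrightarrow> compact (feasible M x)"
begin

abbreviation "X \<equiv> borel_states M"
abbreviation "A \<equiv> borel_actions M"
abbreviation "G \<equiv> borel_graph M"

lemma model:
  shows states_borel: "states M \<in> sets borel" and actions_borel: "actions M \<in> sets borel"
    and feasible_ne: "x \<in> states M \<Longrightarrow> feasible M x \<noteq> {}"
    and feasible_actions: "x \<in> states M \<Longrightarrow> feasible M x \<subseteq> actions M"
    and feasible_borel: "x \<in> states M \<Longrightarrow> feasible M x \<in> sets borel"
    and lower: "open H \<Longrightarrow> {x \<in> states M. feasible M x \<inter> H \<noteq> {}} \<in> sets borel"
    and kernel_measurable: "kernel M \<in> G \<rightarrow>\<^sub>M prob_algebra X"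
    and cost_measurable: "cost M \<in> borel_measurable G"
    and cost_nonneg: "k \<in> graph_set M \<Longrightarrow> 0 \<le> cost M k"
  using cmc by (auto simp: controlled_markov_chain_def)

lemma space_X[simp]: "space X = states M" by (simp add: borel_states_def space_restrict_space)
lemma space_A[simp]: "space A = actions M" by (simp add: borel_actions_def space_restrict_space)
lemma space_G[simp]: "space G = graph_set M" by (simp add: borel_graph_def space_restrict_space)

lemma graph_in_G[simp]: "graph_set M \<in> sets G" using sets.top[of G] by simp

lemma mem_graph_iff: "(x, u) \<in> graph_set M \<longleftrightarrow> x \<in> states M \<and> u \<in> feasible M x"
  by (simp add: graph_set_def)

lemma sets_X_iff: "B \<in> sets X \<longleftrightarrow> B \<in> sets borel \<and> B \<subseteq> states M"
  unfolding borel_states_def using states_borel by (subst sets_restrict_space_iff) auto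

lemma sets_A_iff: "B \<in> sets A \<longleftrightarrow> B \<in> sets borel \<and> B \<subseteq> actions M"
  unfolding borel_actions_def using actions_borel by (subst sets_restrict_space_iff) auto

lemma sets_G_iff: "B \<in> sets G \<longleftrightarrow> B \<in> sets borel \<and> B \<subseteq> graph_set M"
  unfolding borel_graph_def using graph_borel by (subst sets_restrict_space_iff) auto

lemma id_X_borel: "(\<lambda>x. x) \<in> X \<rightarrow>\<^sub>M borel"
  unfolding borel_states_def by (rule measurable_restrict_space1) simp

lemma id_A_borel: "(\<lambda>x. x) \<in> A \<rightarrow>\<^sub>M borel"
  unfolding borel_actions_def by (rule measurable_restrict_space1) simp

lemma fst_G[measurable]: "fst \<in> G \<rightarrow>\<^sub>M X"
  unfolding borel_graph_def borel_states_def
  by (rule measurable_restrict_space3) (auto simp: graph_set_def borel_measurable_continuous_onI continuous_on_fst)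

lemma snd_G[measurable]: "snd \<in> G \<rightarrow>\<^sub>M borel"
  unfolding borel_graph_def
  by (rule measurable_restrict_space1) (auto intro!: borel_measurable_continuous_onI continuous_on_snd)

lemma id_G_pair: "(\<lambda>k. k) \<in> G \<rightarrow>\<^sub>M X \<Otimes>\<^sub>M borel"
  using measurable_Pair[OF fst_G snd_G] by simp

lemma pair_into_borel:
  assumes "f \<in> N \<rightarrow>\<^sub>M X" "g \<in> N \<rightarrow>\<^sub>M (borel :: 'u measure)"
  shows "(\<lambda>z. (f z, g z)) \<in> N \<rightarrow>\<^sub>M borel"
  unfolding borel_prod[symmetric]
  by (rule measurable_Pair[OF measurable_compose[OF assms(1) id_X_borel] assms(2)])

sublocale selectable X "feasible M"
proof
  show "feasible M x \<noteq> {}" if "x \<in> space X" for x using that feasible_ne by simp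
  show "closed (feasible M x)" if "x \<in> space X" for x
    using that compact_feasible by (simp add: compact_imp_closed)
  show "{x \<in> space X. feasible M x \<inter> H \<noteq> {}} \<in> sets X" if "open H" for H
    using lower[OF that] by (auto simp: sets_X_iff)
qed

lemma graph_eq: "graph = graph_set M"
  by (auto simp: graph_set_def)

lemma id_graph_G: "(\<lambda>k. k) \<in> restrict_space (X \<Otimes>\<^sub>M borel) graph \<rightarrow>\<^sub>M G"
  unfolding borel_graph_def
proof (rule measurable_restrict_space3)
  show "(\<lambda>k. k) \<in> X \<Otimes>\<^sub>M (borel :: 'u measure) \<rightarrow>\<^sub>M borel"
    using pair_into_borel[OF measurable_fst measurable_snd] by simp
qed (auto simp: graph_set_def)

lemma countably_generated_X: "countably_generated \<nu>" if "sets \<nu> = sets X"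
  using countably_generated_restrict_borel[OF states_borel] that sets_eq_imp_space_eq[OF that]
  unfolding countably_generated_def borel_states_def by simp

subsection \<open>Laws of an action under a randomized decision\<close>

definition decision :: "'x \<Rightarrow> 'u measure \<Rightarrow> bool" where
  "decision x \<kappa> \<longleftrightarrow> \<kappa> \<in> space (prob_algebra A) \<and> emeasure \<kappa> (feasible M x) = 1"

lemma decisionD:
  assumes "decision x \<kappa>"
  shows "prob_space \<kappa>" "sets \<kappa> = sets A" "space \<kappa> = actions M" "emeasure \<kappa> (feasible M x) = 1"
  using assms in_prob_algebraD[of \<kappa> A] by (auto simp: decision_def)

lemma pair_restrict:
  assumes "x \<in> states M" "decision x \<kappa>"
  shows "Pair x \<in> restrict_space \<kappa> (feasible M x) \<rightarrow>\<^sub>M G"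
  unfolding borel_graph_def
proof (rule measurable_restrict_space3)
  have "(\<lambda>u. (x, u)) \<in> A \<rightarrow>\<^sub>M borel"
    by (rule pair_into_borel) (use assms id_A_borel in auto)
  then show "Pair x \<in> \<kappa> \<rightarrow>\<^sub>M borel"
    using measurable_cong_sets[OF decisionD(2)[OF assms(2)] refl] by blast
qed (use assms in \<open>auto simp: mem_graph_iff\<close>)

lemma feasible_in_sets: "x \<in> states M \<Longrightarrow> decision x \<kappa> \<Longrightarrow> feasible M x \<in> sets \<kappa>"
  using decisionD(2) feasible_borel feasible_actions by (simp add: sets_A_iff)

lemma nn_integral_act_law:
  assumes x: "x \<in> states M" "decision x \<kappa>" and f: "f \<in> borel_measurable G"
  shows "(\<integral>\<^sup>+k. f k \<partial>act_law M \<kappa> x) = (\<integral>\<^sup>+u. f (x, u) * indicator (feasible M x) u \<partial>\<kappa>)"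
  unfolding act_law_def
  using feasible_in_sets[OF x] decisionD(3)[OF x(2)] feasible_actions[OF x(1)] f
  by (simp add: nn_integral_distr[OF pair_restrict[OF x]] nn_integral_restrict_space Int_absorb2)

lemma act_law_in_prob_algebra:
  assumes x: "x \<in> states M" "decision x \<kappa>"
  shows "act_law M \<kappa> x \<in> space (prob_algebra G)"
proof -
  have "emeasure (act_law M \<kappa> x) (space G) = (\<integral>\<^sup>+k. indicator (space G) k \<partial>act_law M \<kappa> x)"
    by (simp add: act_law_def)
  also have "\<dots> = (\<integral>\<^sup>+u. indicator (feasible M x) u \<partial>\<kappa>)"
    using x by (subst nn_integral_act_law[OF x]) (auto intro!: nn_integral_cong borel_measurable_indicator simp: mem_graph_iff split: split_indicator)
  also have "\<dots> = 1" using feasible_in_sets[OF x] decisionD(4)[OF x(2)] by simp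
  finally show ?thesis
    by (auto simp: space_prob_algebra act_law_def intro!: prob_spaceI)
qed

lemma act_law_fst:
  assumes x: "x \<in> states M" "decision x \<kappa>" and f: "f \<in> borel_measurable X"
  shows "(\<integral>\<^sup>+k. f (fst k) \<partial>act_law M \<kappa> x) = f x"
proof -
  have "(\<integral>\<^sup>+k. f (fst k) \<partial>act_law M \<kappa> x) = (\<integral>\<^sup>+u. f x * indicator (feasible M x) u \<partial>\<kappa>)"
    using nn_integral_act_law[OF x, of "\<lambda>k. f (fst k)"] measurable_compose[OF fst_G f] by simp
  also have "\<dots> = f x"
    using feasible_in_sets[OF x] decisionD(4)[OF x(2)] by (simp add: nn_integral_cmult_indicator)
  finally show ?thesis .
qed

text \<open>Measurability in the history: the mass of \<open>E\<close> is the \<open>D h\<close>-mass of its section at \<open>s h\<close>.\<close>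

lemma act_law_measurable:
  assumes D: "D \<in> N \<rightarrow>\<^sub>M prob_algebra A" and s: "s \<in> N \<rightarrow>\<^sub>M X"
    and feas: "\<And>h. h \<in> space N \<Longrightarrow> decision (s h) (D h)"
  shows "(\<lambda>h. act_law M (D h) (s h)) \<in> N \<rightarrow>\<^sub>M prob_algebra G"
proof (rule measurable_prob_algebraI)
  have sx: "s h \<in> states M" if "h \<in> space N" for h
    using measurable_space[OF s that] by simp
  show "prob_space (act_law M (D h) (s h))" if "h \<in> space N" for h
    using act_law_in_prob_algebra[OF sx[OF that] feas[OF that]] by (rule in_prob_algebraD)
  show "(\<lambda>h. act_law M (D h) (s h)) \<in> N \<rightarrow>\<^sub>M subprob_algebra G"
  proof (rule measurable_subprob_algebra)
    fix h assume h: "h \<in> space N"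
    show "subprob_space (act_law M (D h) (s h))" "sets (act_law M (D h) (s h)) = sets G"
      using in_prob_algebraD[OF act_law_in_prob_algebra[OF sx[OF h] feas[OF h]]]
      by (auto intro: prob_space_imp_subprob_space)
  next
    fix E assume E: "E \<in> sets G"
    let ?S = "\<lambda>h. {u \<in> actions M. (s h, u) \<in> E}"
    have em: "emeasure (act_law M (D h) (s h)) E = emeasure (D h) (?S h)" if h: "h \<in> space N" for h
    proof -
      note d = sx[OF h] feas[OF h]
      have "emeasure (act_law M (D h) (s h)) E
          = emeasure (restrict_space (D h) (feasible M (s h))) (Pair (s h) -` E \<inter> space (restrict_space (D h) (feasible M (s h))))"
        unfolding act_law_def by (rule emeasure_distr[OF pair_restrict[OF d] E])
      also have "\<dots> = emeasure (D h) (Pair (s h) -` E \<inter> space (restrict_space (D h) (feasible M (s h))))"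
        using feasible_in_sets[OF d] by (intro emeasure_restrict_space) (auto simp: space_restrict_space)
      also have "Pair (s h) -` E \<inter> space (restrict_space (D h) (feasible M (s h))) = ?S h"
      proof -
        have "u \<in> feasible M (s h)" if "(s h, u) \<in> E" for u
        proof -
          have "(s h, u) \<in> graph_set M" using E that by (auto simp: sets_G_iff)
          then show ?thesis by (simp add: mem_graph_iff)
        qed
        then show ?thesis
          using feasible_actions[OF d(1)] decisionD(3)[OF d(2)] by (auto simp: space_restrict_space)
      qed
      finally show ?thesis .
    qed
    have "(\<lambda>z. (s (fst z), snd z)) \<in> N \<Otimes>\<^sub>M A \<rightarrow>\<^sub>M borel"
      by (rule pair_into_borel) (use s id_A_borel in measurable)
    from measurable_sets[OF this, of E] E
    have "(\<lambda>z. (s (fst z), snd z)) -` E \<inter> space (N \<Otimes>\<^sub>M A) \<in> sets (N \<Otimes>\<^sub>M A)" by (simp add: sets_G_iff)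
    also have "(\<lambda>z. (s (fst z), snd z)) -` E \<inter> space (N \<Otimes>\<^sub>M A) = Sigma (space N) ?S"
      by (auto simp: space_pair_measure)
    finally have "(\<lambda>h. emeasure (D h) (?S h)) \<in> borel_measurable N"
      by (rule emeasure_measurable_subprob_algebra2[OF _ measurable_prob_algebraD[OF D]])
    then show "(\<lambda>h. emeasure (act_law M (D h) (s h)) E) \<in> borel_measurable N"
      by (subst measurable_cong[OF em])
  qed
qed

definition stationary_kernel :: "('x \<Rightarrow> 'u measure) \<Rightarrow> bool" where
  "stationary_kernel \<phi> \<longleftrightarrow> \<phi> \<in> X \<rightarrow>\<^sub>M prob_algebra A \<and> (\<forall>x\<in>states M. emeasure (\<phi> x) (feasible M x) = 1)"

lemma stationary_kernel_decision: "stationary_kernel \<phi> \<Longrightarrow> x \<in> states M \<Longrightarrow> decision x (\<phi> x)"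
  by (auto simp: stationary_kernel_def decision_def dest: measurable_space)

definition joint :: "'x measure \<Rightarrow> ('x \<Rightarrow> 'u measure) \<Rightarrow> ('x \<times> 'u) measure" where
  "joint m \<phi> = m \<bind> (\<lambda>x. act_law M (\<phi> x) x)"

lemma act_law_stationary_measurable:
  "stationary_kernel \<phi> \<Longrightarrow> (\<lambda>x. act_law M (\<phi> x) x) \<in> X \<rightarrow>\<^sub>M prob_algebra G"
  by (rule act_law_measurable) (auto simp: stationary_kernel_def stationary_kernel_decision)

lemma joint_in_prob_algebra:
  assumes "m \<in> space (prob_algebra X)" "stationary_kernel \<phi>"
  shows "joint m \<phi> \<in> space (prob_algebra G)"
  unfolding joint_def space_prob_algebra
  using prob_space_bind'[OF assms(1) act_law_stationary_measurable[OF assms(2)]]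
    sets_bind'[OF assms(1) act_law_stationary_measurable[OF assms(2)]] by simp

lemma nn_integral_joint:
  assumes "m \<in> space (prob_algebra X)" "stationary_kernel \<phi>" "f \<in> borel_measurable G"
  shows "(\<integral>\<^sup>+k. f k \<partial>joint m \<phi>) = (\<integral>\<^sup>+x. \<integral>\<^sup>+k. f k \<partial>act_law M (\<phi> x) x \<partial>m)"
  unfolding joint_def by (rule nn_integral_bind_prob_algebra[OF assms(1) act_law_stationary_measurable[OF assms(2)] assms(3)])

definition marginal :: "('x \<times> 'u) measure \<Rightarrow> 'x set \<Rightarrow> ennreal" where
  "marginal \<mu> B = emeasure \<mu> ((B \<times> actions M) \<inter> graph_set M)"

lemma marginal_set: "(B \<times> actions M) \<inter> graph_set M = fst -` B \<inter> space G"
  using feasible_actions by (auto simp: graph_set_def)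

lemma marginal_set_measurable: "B \<in> sets X \<Longrightarrow> (B \<times> actions M) \<inter> graph_set M \<in> sets G"
  unfolding marginal_set by (rule measurable_sets[OF fst_G])

lemma marginal_eq_nn_integral:
  assumes "\<mu> \<in> space (prob_algebra G)" "B \<in> sets X"
  shows "marginal \<mu> B = (\<integral>\<^sup>+k. indicator B (fst k) \<partial>\<mu>)"
proof -
  have "marginal \<mu> B = (\<integral>\<^sup>+k. indicator ((B \<times> actions M) \<inter> graph_set M) k \<partial>\<mu>)"
    unfolding marginal_def using marginal_set_measurable[OF assms(2)] in_prob_algebraD(2)[OF assms(1)] by simp
  also have "\<dots> = (\<integral>\<^sup>+k. indicator B (fst k) \<partial>\<mu>)"
    unfolding marginal_set using in_prob_algebraD(3)[OF assms(1)]
    by (intro nn_integral_cong) (auto split: split_indicator)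
  finally show ?thesis .
qed

lemma marginal_joint:
  assumes m: "m \<in> space (prob_algebra X)" and \<phi>: "stationary_kernel \<phi>" and B: "B \<in> sets X"
  shows "marginal (joint m \<phi>) B = emeasure m B"
proof -
  have iB: "(\<lambda>k. indicator B (fst k) :: ennreal) \<in> borel_measurable G"
    using measurable_compose[OF fst_G borel_measurable_indicator[OF B]] .
  have "marginal (joint m \<phi>) B = (\<integral>\<^sup>+x. \<integral>\<^sup>+k. indicator B (fst k) \<partial>act_law M (\<phi> x) x \<partial>m)"
    unfolding marginal_eq_nn_integral[OF joint_in_prob_algebra[OF m \<phi>] B]
    by (rule nn_integral_joint[OF m \<phi> iB])
  also have "\<dots> = (\<integral>\<^sup>+x. indicator B x \<partial>m)"
    using B in_prob_algebraD(3)[OF m]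
    by (intro nn_integral_cong act_law_fst stationary_kernel_decision[OF \<phi>]) auto
  also have "\<dots> = emeasure m B" using B in_prob_algebraD(2)[OF m] by simp
  finally show ?thesis .
qed

lemma invariant_measures_iff:
  "\<mu> \<in> invariant_measures M \<longleftrightarrow> \<mu> \<in> space (prob_algebra G) \<and>
     (\<forall>B\<in>sets X. marginal \<mu> B = (\<integral>\<^sup>+k. emeasure (kernel M k) B \<partial>\<mu>))"
  by (simp add: invariant_measures_def marginal_def)

subsection \<open>Compactness for laws on the graph\<close>

text \<open>The integrands to which the compactness theorem applies.\<close>

definition continuous_in_action :: "('x \<times> 'u \<Rightarrow> real) \<Rightarrow> bool" where
  "continuous_in_action f \<longleftrightarrow> f \<in> borel_measurable G \<and> (\<forall>k\<in>graph_set M. 0 \<le> f k) \<and>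
     (\<forall>x\<in>states M. continuous_on (feasible M x) (\<lambda>u. f (x, u)))"

text \<open>The laws are carried over to the product of the states with the whole Polish space of actions, and
  the limiting kernel is restricted back to the action space, which has full measure.\<close>

theorem state_action_law_limit:
  fixes \<mu> :: "nat \<Rightarrow> ('x \<times> 'u) measure"
  assumes \<nu>: "finite_measure \<nu>" "sets \<nu> = sets X"
    and \<mu>: "\<And>n. \<mu> n \<in> space (prob_algebra G)"
    and dom: "\<And>n B. B \<in> sets X \<Longrightarrow> marginal (\<mu> n) B \<le> emeasure \<nu> B"
    and tight: "\<And>e. e > 0 \<Longrightarrow> \<exists>L. compact L \<and> (\<forall>n. measure (\<mu> n) {k \<in> graph_set M. snd k \<notin> L} \<le> e)"
  shows "\<exists>r m \<phi>. strict_mono r \<and> m \<in> space (prob_algebra X) \<and> (\<forall>B\<in>sets X. emeasure m B \<le> emeasure \<nu> B) \<and>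
     stationary_kernel \<phi> \<and>
     (\<forall>f. continuous_in_action f \<longrightarrow>
        (\<integral>\<^sup>+k. ennreal (f k) \<partial>joint m \<phi>) \<le> liminf (\<lambda>n. \<integral>\<^sup>+k. ennreal (f k) \<partial>\<mu> (r n)))"
proof -
  note \<mu>s = in_prob_algebraD[OF \<mu>]
  have sp\<nu>: "space \<nu> = states M" using sets_eq_imp_space_eq[OF \<nu>(2)] by simp
  interpret N: selectable \<nu> "feasible M"
    using ne cl lower_meas by (unfold_locales) (simp_all add: sp\<nu> \<nu>(2))
  have pair_sets: "sets (\<nu> \<Otimes>\<^sub>M borel) = sets (X \<Otimes>\<^sub>M (borel :: 'u measure))"
    by (rule sets_pair_measure_cong[OF \<nu>(2) refl])
  have pair_space: "space (\<nu> \<Otimes>\<^sub>M borel) = states M \<times> (UNIV :: 'u set)"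
    by (simp add: space_pair_measure sp\<nu>)
  have i\<mu>: "(\<lambda>k. k) \<in> \<mu> n \<rightarrow>\<^sub>M \<nu> \<Otimes>\<^sub>M borel" for n
    using id_G_pair measurable_cong_sets[OF \<mu>s(2) pair_sets] by blast
  define \<mu>' where "\<mu>' n = distr (\<mu> n) (\<nu> \<Otimes>\<^sub>M borel) (\<lambda>k. k)" for n
  have \<mu>': "\<mu>' n \<in> space (prob_algebra (\<nu> \<Otimes>\<^sub>M borel))" for n
    unfolding \<mu>'_def space_prob_algebra using prob_space.prob_space_distr[OF \<mu>s(1) i\<mu>] by simp
  have \<mu>'e: "emeasure (\<mu>' n) E = emeasure (\<mu> n) (E \<inter> graph_set M)" if "E \<in> sets (\<nu> \<Otimes>\<^sub>M borel)" for n E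
    unfolding \<mu>'_def using emeasure_distr[OF i\<mu> that] by (simp add: \<mu>s)
  have gr: "Sigma (space \<nu>) (feasible M) = graph_set M" by (auto simp: sp\<nu> graph_set_def)
  have "\<exists>r m \<phi>. strict_mono r \<and> m \<in> space (prob_algebra \<nu>) \<and> (\<forall>A\<in>sets \<nu>. emeasure m A \<le> emeasure \<nu> A) \<and>
     \<phi> \<in> \<nu> \<rightarrow>\<^sub>M prob_algebra borel \<and> (\<forall>x\<in>space \<nu>. emeasure (\<phi> x) (feasible M x) = 1) \<and>
     (\<forall>f. f \<in> borel_measurable (restrict_space (\<nu> \<Otimes>\<^sub>M borel) N.graph) \<longrightarrow> (\<forall>z\<in>N.graph. (0::real) \<le> f z) \<longrightarrow>
        (\<forall>x\<in>space \<nu>. continuous_on (feasible M x) (\<lambda>u. f (x, u))) \<longrightarrow>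
        (\<integral>\<^sup>+z. ennreal (f z) * indicator N.graph z \<partial>kernel_prod \<nu> borel m \<phi>)
          \<le> liminf (\<lambda>n. \<integral>\<^sup>+z. ennreal (f z) * indicator N.graph z \<partial>\<mu>' (r n)))"
  proof (rule N.dominated_marginals_compactness[OF \<nu>(1) countably_generated_X[OF \<nu>(2)] \<mu>'])
    fix n
    have "AE z in distr (\<mu> n) (\<nu> \<Otimes>\<^sub>M borel) (\<lambda>k. k). z \<in> N.graph"
      by (subst AE_distr_iff[OF i\<mu>]) (use N.graph_sets sets.sets_into_space[OF N.graph_sets] in \<open>auto simp: \<mu>s gr Int_absorb1 Int_def[symmetric]\<close>)
    then show "AE z in \<mu>' n. snd z \<in> feasible M (fst z)"
      unfolding \<mu>'_def by eventually_elim auto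
  next
    fix n B assume B: "B \<in> sets \<nu>"
    have "(B \<times> UNIV) \<inter> graph_set M = (B \<times> actions M) \<inter> graph_set M"
      using feasible_actions by (auto simp: graph_set_def)
    then show "emeasure (\<mu>' n) (B \<times> UNIV) \<le> emeasure \<nu> B"
      using \<mu>'e[of "B \<times> UNIV" n] B dom[of B n] by (simp add: \<nu>(2) marginal_def)
  next
    fix e :: real assume "0 < e"
    from tight[OF this] obtain L where L: "compact L" "\<And>n. measure (\<mu> n) {k \<in> graph_set M. snd k \<notin> L} \<le> e" by blast
    have [measurable]: "L \<in> sets borel" using L(1) by (intro borel_closed compact_imp_closed)
    have LM: "{z \<in> space (\<nu> \<Otimes>\<^sub>M borel). snd z \<notin> L} \<in> sets (\<nu> \<Otimes>\<^sub>M borel)" by measurable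
    have "{z \<in> space (\<nu> \<Otimes>\<^sub>M borel). snd z \<notin> L} \<inter> graph_set M = {k \<in> graph_set M. snd k \<notin> L}"
      by (auto simp: pair_space graph_set_def)
    then have "measure (\<mu>' n) {z \<in> space (\<nu> \<Otimes>\<^sub>M borel). snd z \<notin> L} \<le> e" for n
      using \<mu>'e[OF LM, of n] L(2)[of n] by (simp add: measure_def)
    then show "\<exists>L. compact L \<and> (\<forall>n. measure (\<mu>' n) {z \<in> space (\<nu> \<Otimes>\<^sub>M borel). snd z \<notin> L} \<le> e)"
      using L(1) by blast
  qed
  then obtain r m \<phi>' where r: "strict_mono r" and m: "m \<in> space (prob_algebra \<nu>)"
    and mle: "\<forall>A\<in>sets \<nu>. emeasure m A \<le> emeasure \<nu> A"
    and \<phi>': "\<phi>' \<in> \<nu> \<rightarrow>\<^sub>M prob_algebra borel" "\<And>x. x \<in> space \<nu> \<Longrightarrow> emeasure (\<phi>' x) (feasible M x) = 1"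
    and lsc: "\<And>f. f \<in> borel_measurable (restrict_space (\<nu> \<Otimes>\<^sub>M borel) N.graph) \<Longrightarrow> (\<forall>z\<in>N.graph. (0::real) \<le> f z) \<Longrightarrow>
        (\<forall>x\<in>space \<nu>. continuous_on (feasible M x) (\<lambda>u. f (x, u))) \<Longrightarrow>
        (\<integral>\<^sup>+z. ennreal (f z) * indicator N.graph z \<partial>kernel_prod \<nu> borel m \<phi>')
          \<le> liminf (\<lambda>n. \<integral>\<^sup>+z. ennreal (f z) * indicator N.graph z \<partial>\<mu>' (r n))"
    by blast
  have mX: "m \<in> space (prob_algebra X)" using m by (simp add: space_prob_algebra \<nu>(2))
  have \<phi>'X: "\<phi>' \<in> X \<rightarrow>\<^sub>M prob_algebra borel" using \<phi>'(1) measurable_cong_sets[OF \<nu>(2) refl] by blast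
  define \<phi> where "\<phi> x = restrict_space (\<phi>' x) (actions M)" for x
  have \<phi>'s: "prob_space (\<phi>' x)" "sets (\<phi>' x) = sets borel" "space (\<phi>' x) = UNIV" if "x \<in> states M" for x
    using kernelD[OF \<phi>'X, of x] that by auto
  have \<phi>e: "emeasure (\<phi> x) B = emeasure (\<phi>' x) B" if "x \<in> states M" "B \<subseteq> actions M" for x B
    unfolding \<phi>_def using that actions_borel by (intro emeasure_restrict_space) (auto simp: \<phi>'s)
  have acts1: "emeasure (\<phi>' x) (actions M) = 1" if x: "x \<in> states M" for x
  proof -
    interpret prob_space "\<phi>' x" by (rule \<phi>'s[OF x])
    have "emeasure (\<phi>' x) (feasible M x) \<le> emeasure (\<phi>' x) (actions M)"
      using feasible_actions[OF x] actions_borel by (intro emeasure_mono) (auto simp: \<phi>'s x)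
    then show ?thesis using \<phi>'(2)[of x] x emeasure_le_1[of "actions M"] by (simp add: sp\<nu>)
  qed
  have \<phi>A: "\<phi> \<in> X \<rightarrow>\<^sub>M prob_algebra A"
  proof (rule measurable_prob_algebraI)
    show 1: "prob_space (\<phi> x)" if "x \<in> space X" for x
      using acts1[of x] that \<phi>e[of x "actions M"]
      by (intro prob_spaceI) (simp add: \<phi>_def space_restrict_space \<phi>'s)
    show "\<phi> \<in> X \<rightarrow>\<^sub>M subprob_algebra A"
    proof (rule measurable_subprob_algebra)
      fix x assume "x \<in> space X"
      then show "subprob_space (\<phi> x)" "sets (\<phi> x) = sets A"
        using 1 sets_restrict_space_cong[of "\<phi>' x" borel "actions M"]
        by (auto simp: prob_space_imp_subprob_space \<phi>_def borel_actions_def \<phi>'s)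
    next
      fix B assume "B \<in> sets A"
      then have B: "B \<in> sets borel" "B \<subseteq> actions M" by (auto simp: sets_A_iff)
      have "(\<lambda>x. emeasure (\<phi>' x) B) \<in> borel_measurable X"
        by (rule measurable_compose[OF measurable_prob_algebraD[OF \<phi>'X] measurable_emeasure_subprob_algebra[OF B(1)]])
      then show "(\<lambda>x. emeasure (\<phi> x) B) \<in> borel_measurable X"
        by (subst measurable_cong[OF \<phi>e]) (use B in auto)
    qed
  qed
  have \<phi>: "stationary_kernel \<phi>"
    unfolding stationary_kernel_def using \<phi>A \<phi>e feasible_actions \<phi>'(2) by (simp add: sp\<nu>)
  have "(\<integral>\<^sup>+k. ennreal (f k) \<partial>joint m \<phi>) \<le> liminf (\<lambda>n. \<integral>\<^sup>+k. ennreal (f k) \<partial>\<mu> (r n))"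
    if f: "continuous_in_action f" for f
  proof -
    have fG: "f \<in> borel_measurable G" using f by (simp add: continuous_in_action_def)
    have eG: "(\<lambda>k. ennreal (f k)) \<in> borel_measurable G" using fG by simp
    have id1: "(\<lambda>k. k) \<in> restrict_space (\<nu> \<Otimes>\<^sub>M borel) N.graph \<rightarrow>\<^sub>M G"
      using id_graph_G[unfolded graph_eq] measurable_cong_sets[OF sets_restrict_space_cong[OF pair_sets, of "graph_set M"] refl]
      unfolding gr by blast
    have fR: "f \<in> borel_measurable (restrict_space (\<nu> \<Otimes>\<^sub>M borel) N.graph)"
      using measurable_compose[OF id1 fG] .
    have fI: "(\<lambda>z. ennreal (f z) * indicator N.graph z) \<in> borel_measurable (\<nu> \<Otimes>\<^sub>M borel)"
      using fR borel_measurable_restrict_space_iff_ennreal[of N.graph "\<nu> \<Otimes>\<^sub>M borel" "\<lambda>z. ennreal (f z)"] N.graph_sets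
      by (simp add: sets.Int_space_eq2)
    have pull: "(\<integral>\<^sup>+z. ennreal (f z) * indicator N.graph z \<partial>\<mu>' n) = (\<integral>\<^sup>+k. ennreal (f k) \<partial>\<mu> n)" for n
    proof -
      have "(\<integral>\<^sup>+z. ennreal (f z) * indicator N.graph z \<partial>\<mu>' n) = (\<integral>\<^sup>+k. ennreal (f k) * indicator N.graph k \<partial>\<mu> n)"
        unfolding \<mu>'_def using fI by (subst nn_integral_distr[OF i\<mu>]) simp_all
      also have "\<dots> = (\<integral>\<^sup>+k. ennreal (f k) \<partial>\<mu> n)"
        unfolding gr by (intro nn_integral_cong) (simp add: \<mu>s)
      finally show ?thesis .
    qed
    have "(\<integral>\<^sup>+k. ennreal (f k) \<partial>joint m \<phi>) = (\<integral>\<^sup>+x. \<integral>\<^sup>+k. ennreal (f k) \<partial>act_law M (\<phi> x) x \<partial>m)"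
      by (rule nn_integral_joint[OF mX \<phi> eG])
    also have "\<dots> = (\<integral>\<^sup>+x. \<integral>\<^sup>+u. ennreal (f (x, u)) * indicator N.graph (x, u) \<partial>\<phi>' x \<partial>m)"
    proof (rule nn_integral_cong)
      fix x assume "x \<in> space m"
      then have x: "x \<in> states M" using in_prob_algebraD(3)[OF mX] by simp
      have "(\<integral>\<^sup>+k. ennreal (f k) \<partial>act_law M (\<phi> x) x) = (\<integral>\<^sup>+u. ennreal (f (x, u)) * indicator (feasible M x) u \<partial>\<phi> x)"
        by (rule nn_integral_act_law[OF x stationary_kernel_decision[OF \<phi> x] eG])
      also have "\<dots> = (\<integral>\<^sup>+u. ennreal (f (x, u)) * indicator (feasible M x) u * indicator (actions M) u \<partial>\<phi>' x)"
        unfolding \<phi>_def using actions_borel by (subst nn_integral_restrict_space) (auto simp: \<phi>'s[OF x])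
      also have "\<dots> = (\<integral>\<^sup>+u. ennreal (f (x, u)) * indicator N.graph (x, u) \<partial>\<phi>' x)"
        using feasible_actions[OF x] x by (intro nn_integral_cong) (auto simp: sp\<nu> split: split_indicator)
      finally show "(\<integral>\<^sup>+k. ennreal (f k) \<partial>act_law M (\<phi> x) x) = (\<integral>\<^sup>+u. ennreal (f (x, u)) * indicator N.graph (x, u) \<partial>\<phi>' x)" .
    qed
    also have "\<dots> = (\<integral>\<^sup>+z. ennreal (f z) * indicator N.graph z \<partial>kernel_prod \<nu> borel m \<phi>')"
      by (rule nn_integral_kernel_prod[OF m \<phi>'(1) fI, symmetric])
    also have "\<dots> \<le> liminf (\<lambda>n. \<integral>\<^sup>+z. ennreal (f z) * indicator N.graph z \<partial>\<mu>' (r n))"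
      by (rule lsc[OF fR]) (use f in \<open>auto simp: continuous_in_action_def graph_set_def sp\<nu>\<close>)
    also have "\<dots> = liminf (\<lambda>n. \<integral>\<^sup>+k. ennreal (f k) \<partial>\<mu> (r n))"
      by (simp only: pull)
    finally show ?thesis .
  qed
  then show ?thesis using r mX mle \<phi> \<nu>(2) by blast
qed

text \<open>Both \<open>f\<close> and \<open>1 - f\<close> are admissible, so lower semicontinuity turns into convergence.\<close>

lemma state_action_limit_bounded:
  assumes \<mu>: "\<And>n. \<mu> n \<in> space (prob_algebra G)" "\<mu>' \<in> space (prob_algebra G)"
    and lsc: "\<And>f. continuous_in_action f \<Longrightarrow> (\<integral>\<^sup>+k. ennreal (f k) \<partial>\<mu>') \<le> liminf (\<lambda>n. \<integral>\<^sup>+k. ennreal (f k) \<partial>\<mu> n)"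
    and f: "continuous_in_action f" "\<And>k. k \<in> graph_set M \<Longrightarrow> f k \<le> 1"
  shows "(\<lambda>n. \<integral>k. f k \<partial>\<mu> n) \<longlonglongrightarrow> (\<integral>k. f k \<partial>\<mu>')"
proof -
  have fG: "f \<in> borel_measurable G" and f0: "\<And>k. k \<in> graph_set M \<Longrightarrow> 0 \<le> f k"
    using f(1) by (auto simp: continuous_in_action_def)
  have f': "continuous_in_action (\<lambda>k. 1 - f k)"
    using f by (auto simp: continuous_in_action_def intro!: continuous_on_diff continuous_on_const borel_measurable_diff)
  have int: "integrable Q f" "integrable Q (\<lambda>k. 1 - f k)" "0 \<le> (\<integral>k. f k \<partial>Q)" "(\<integral>k. f k \<partial>Q) \<le> 1"
    "(\<integral>k. 1 - f k \<partial>Q) = 1 - (\<integral>k. f k \<partial>Q)"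
    "(\<integral>\<^sup>+k. ennreal (f k) \<partial>Q) = ennreal (\<integral>k. f k \<partial>Q)" "(\<integral>\<^sup>+k. ennreal (1 - f k) \<partial>Q) = ennreal (1 - (\<integral>k. f k \<partial>Q))"
    if Q: "Q \<in> space (prob_algebra G)" for Q
  proof -
    interpret Q: prob_space Q by (rule in_prob_algebraD[OF Q])
    have fQ: "f \<in> borel_measurable Q" using fG measurable_cong_sets[OF in_prob_algebraD(2)[OF Q] refl] by blast
    have sp: "space Q = graph_set M" using in_prob_algebraD(3)[OF Q] by simp
    show i: "integrable Q f" using fQ f0 f(2) by (intro Q.integrable_const_bound[of _ 1]) (auto simp: sp)
    then show i': "integrable Q (\<lambda>k. 1 - f k)" by simp
    show "0 \<le> (\<integral>k. f k \<partial>Q)" by (rule integral_nonneg_AE) (auto intro!: AE_I2 f0 simp: sp)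
    show eq: "(\<integral>k. 1 - f k \<partial>Q) = 1 - (\<integral>k. f k \<partial>Q)" using i by (simp add: Q.prob_space)
    have "0 \<le> (\<integral>k. 1 - f k \<partial>Q)" by (rule integral_nonneg_AE) (auto intro!: AE_I2 f(2) simp: sp)
    then show "(\<integral>k. f k \<partial>Q) \<le> 1" using eq by simp
    show "(\<integral>\<^sup>+k. ennreal (f k) \<partial>Q) = ennreal (\<integral>k. f k \<partial>Q)"
      using f0 by (intro nn_integral_eq_integral i AE_I2) (auto simp: sp)
    show "(\<integral>\<^sup>+k. ennreal (1 - f k) \<partial>Q) = ennreal (1 - (\<integral>k. f k \<partial>Q))"
      unfolding eq[symmetric] using f(2) by (intro nn_integral_eq_integral i' AE_I2) (auto simp: sp)
  qed
  show ?thesis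
    by (rule liminf_two_sided)
      (use lsc[OF f(1)] lsc[OF f'] int[OF \<mu>(1)] int[OF \<mu>(2)] in \<open>auto simp: int(6,7)[OF \<mu>(1)] int(6,7)[OF \<mu>(2)]\<close>)
qed

text \<open>The indicator of a set of states and the probability of a transition into it are bounded integrands
  continuous in the action, the latter by the strong continuity of the kernel. So the invariance
  equation passes to the limit, although neither of them is continuous in the state.\<close>

theorem almost_invariant_limit:
  fixes \<mu> :: "nat \<Rightarrow> ('x \<times> 'u) measure"
  assumes D: "cond_D M" and \<nu>: "finite_measure \<nu>" "sets \<nu> = sets X"
    and \<mu>: "\<And>n. \<mu> n \<in> space (prob_algebra G)"
    and dom: "\<And>n B. B \<in> sets X \<Longrightarrow> marginal (\<mu> n) B \<le> emeasure \<nu> B"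
    and tight: "\<And>e. e > 0 \<Longrightarrow> \<exists>L. compact L \<and> (\<forall>n. measure (\<mu> n) {k \<in> graph_set M. snd k \<notin> L} \<le> e)"
    and defect: "\<And>B. B \<in> sets X \<Longrightarrow>
      (\<lambda>n. enn2real (marginal (\<mu> n) B) - (\<integral>k. measure (kernel M k) B \<partial>\<mu> n)) \<longlonglongrightarrow> 0"
    and cost: "\<And>x. x \<in> states M \<Longrightarrow> continuous_on (feasible M x) (\<lambda>u. cost M (x, u))"
  shows "\<exists>r m \<phi>. strict_mono r \<and> m \<in> space (prob_algebra X) \<and> (\<forall>B\<in>sets X. emeasure m B \<le> emeasure \<nu> B) \<and>
     stationary_kernel \<phi> \<and> joint m \<phi> \<in> invariant_measures M \<and>
     mean_cost M (joint m \<phi>) \<le> liminf (\<lambda>n. mean_cost M (\<mu> (r n)))"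
proof -
  from state_action_law_limit[OF \<nu> \<mu> dom tight]
  obtain r m \<phi> where r: "strict_mono r" and m: "m \<in> space (prob_algebra X)" and mle: "\<forall>B\<in>sets X. emeasure m B \<le> emeasure \<nu> B"
    and \<phi>: "stationary_kernel \<phi>"
    and lsc: "\<And>f. continuous_in_action f \<Longrightarrow>
        (\<integral>\<^sup>+k. ennreal (f k) \<partial>joint m \<phi>) \<le> liminf (\<lambda>n. \<integral>\<^sup>+k. ennreal (f k) \<partial>\<mu> (r n))"
    by blast
  let ?J = "joint m \<phi>"
  have J: "?J \<in> space (prob_algebra G)" by (rule joint_in_prob_algebra[OF m \<phi>])
  note lim = state_action_limit_bounded[OF \<mu> J lsc]
  have kp: "prob_space (kernel M k)" "sets (kernel M k) = sets X" if "k \<in> graph_set M" for k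
    using kernelD[OF kernel_measurable, of k] that by auto
  have "marginal ?J B = (\<integral>\<^sup>+k. emeasure (kernel M k) B \<partial>?J)" if B: "B \<in> sets X" for B
  proof -
    define f where "f k = (indicator B (fst k) :: real)" for k :: "'x \<times> 'u"
    define g where "g k = measure (kernel M k) B" for k
    have fM: "f \<in> borel_measurable G"
      unfolding f_def using measurable_compose[OF fst_G borel_measurable_indicator[OF B]] .
    have f: "continuous_in_action f"
      using fM by (simp add: continuous_in_action_def f_def)
    have gM: "g \<in> borel_measurable G"
      unfolding g_def by (rule measurable_compose[OF kernel_measurable measurable_measure_prob_algebra[OF B]])
    have gc: "continuous_on (feasible M x) (\<lambda>u. g (x, u))" if x: "x \<in> states M" for x
    proof -
      have "continuous_on (feasible M x) (\<lambda>u. \<integral>z. (indicator B z :: real) \<partial>kernel M (x, u))"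
      proof -
        have "(indicator B :: 'x \<Rightarrow> real) \<in> borel_measurable X" using B by simp
        moreover have "bounded ((indicator B :: 'x \<Rightarrow> real) ` states M)"
          by (rule boundedI[of _ 1]) (auto simp: indicator_def)
        moreover have "\<forall>f::'x \<Rightarrow> real. f \<in> borel_measurable X \<longrightarrow> bounded (f ` states M) \<longrightarrow>
            continuous_on (feasible M x) (\<lambda>u. \<integral>z. f z \<partial>kernel M (x, u))"
          using conjunct1[OF D[unfolded cond_D_def]] x by (rule bspec)
        ultimately show ?thesis by (elim allE[of _ "indicator B"] impE)
      qed
      moreover have "(\<integral>z. indicator B z \<partial>kernel M (x, u)) = g (x, u)" if "u \<in> feasible M x" for u
        using B sets.sets_into_space[OF B] kp[of "(x, u)"] sets_eq_imp_space_eq[OF kp(2)[of "(x, u)"]] x that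
        by (simp add: g_def mem_graph_iff Int_absorb2)
      ultimately show ?thesis by (rule continuous_on_eq)
    qed
    have g: "continuous_in_action g"
      using gM gc by (simp add: continuous_in_action_def) (simp add: g_def)
    have g1: "g k \<le> 1" if "k \<in> graph_set M" for k
      unfolding g_def using kp(1)[OF that] by (rule prob_space.prob_le_1)
    have mf: "enn2real (marginal Q B) = (\<integral>k. f k \<partial>Q)" if Q: "Q \<in> space (prob_algebra G)" for Q
    proof -
      interpret Q: prob_space Q by (rule in_prob_algebraD[OF Q])
      have "(\<integral>k. f k \<partial>Q) = (\<integral>k. indicator ((B \<times> actions M) \<inter> graph_set M) k \<partial>Q)"
        unfolding marginal_set f_def using in_prob_algebraD(3)[OF Q]
        by (intro Bochner_Integration.integral_cong) (auto split: split_indicator)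
      also have "\<dots> = measure Q ((B \<times> actions M) \<inter> graph_set M)"
        using in_prob_algebraD(3)[OF Q] by (simp add: Int_absorb2)
      finally show ?thesis by (simp add: marginal_def measure_def)
    qed
    have "(\<lambda>n. (\<integral>k. f k \<partial>\<mu> (r n)) - (\<integral>k. g k \<partial>\<mu> (r n))) \<longlonglongrightarrow> (\<integral>k. f k \<partial>?J) - (\<integral>k. g k \<partial>?J)"
      by (intro tendsto_diff lim f g g1) (simp_all add: f_def indicator_def)
    moreover have "(\<lambda>n. (\<integral>k. f k \<partial>\<mu> (r n)) - (\<integral>k. g k \<partial>\<mu> (r n))) \<longlonglongrightarrow> 0"
      using LIMSEQ_subseq_LIMSEQ[OF defect[OF B] r] by (simp add: mf[OF \<mu>] g_def comp_def)
    ultimately have eq: "(\<integral>k. f k \<partial>?J) = (\<integral>k. g k \<partial>?J)"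
      using LIMSEQ_unique by fastforce
    interpret J: prob_space ?J by (rule in_prob_algebraD[OF J])
    have "(\<integral>\<^sup>+k. emeasure (kernel M k) B \<partial>?J) = (\<integral>\<^sup>+k. ennreal (g k) \<partial>?J)"
      using in_prob_algebraD(3)[OF J] kp
      by (intro nn_integral_cong) (simp add: g_def finite_measure.emeasure_eq_measure prob_space_def)
    also have "\<dots> = ennreal (\<integral>k. g k \<partial>?J)"
    proof (rule nn_integral_eq_integral)
      have "g \<in> borel_measurable ?J" using gM measurable_cong_sets[OF in_prob_algebraD(2)[OF J] refl] by blast
      then show "integrable ?J g"
        using g1 in_prob_algebraD(3)[OF J] by (intro J.integrable_const_bound[of _ 1]) (auto simp: g_def)
    qed (simp add: g_def)
    also have "\<dots> = marginal ?J B"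
      using mf[OF J] eq by (simp add: marginal_def J.emeasure_eq_measure)
    finally show ?thesis ..
  qed
  then have inv: "?J \<in> invariant_measures M" using J by (simp add: invariant_measures_iff)
  have "mean_cost M ?J \<le> liminf (\<lambda>n. mean_cost M (\<mu> (r n)))"
    unfolding mean_cost_def using cost cost_measurable cost_nonneg
    by (intro lsc) (simp add: continuous_in_action_def)
  then show ?thesis using r m mle \<phi> inv by blast
qed

end

section \<open>The controlled process and its occupation measures\<close>

locale controlled_process = borel_controlled M
  for M :: "('x::polish_space, 'u::polish_space) control_model" +
  fixes \<gamma> :: "('x, 'u) policy" and x\<^sub>0 :: 'x
  assumes admissible: "\<gamma> \<in> admissible_policies M" and init: "x\<^sub>0 \<in> states M"
begin

lemma admissible_measurable: "\<gamma> t \<in> histories M t \<rightarrow>\<^sub>M prob_algebra A"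
  using admissible by (simp add: admissible_policies_def)

lemma admissible_decision: "h \<in> space (histories M t) \<Longrightarrow> decision (snd h) (\<gamma> t h)"
  using admissible measurable_space[OF admissible_measurable]
  by (auto simp: admissible_policies_def decision_def)

lemma snd_history: "snd \<in> histories M t \<rightarrow>\<^sub>M X"
  by (simp add: histories_def)

lemma pair_law_measurable: "(\<lambda>(w, x). pair_law M \<gamma> t w x) \<in> histories M t \<rightarrow>\<^sub>M prob_algebra G"
proof -
  have "(\<lambda>h. act_law M (\<gamma> t h) (snd h)) \<in> histories M t \<rightarrow>\<^sub>M prob_algebra G"
    by (rule act_law_measurable[OF admissible_measurable snd_history admissible_decision])
  then show ?thesis by (simp add: pair_law_eq_act_law case_prod_unfold)
qed

lemma step_law_measurable: "step_law M \<gamma> x\<^sub>0 t \<in> PiM {0..<t} (\<lambda>_. G) \<rightarrow>\<^sub>M prob_algebra G"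
proof (cases "t = 0")
  case True
  have "(\<lambda>w. (w, x\<^sub>0)) \<in> PiM {0..<0} (\<lambda>_. G) \<rightarrow>\<^sub>M histories M 0"
    unfolding histories_def using init by (intro measurable_Pair) auto
  from measurable_compose[OF this pair_law_measurable] True show ?thesis
    by (simp add: step_law_def[abs_def])
next
  case False
  have 1: "(\<lambda>w. kernel M (w (t - 1))) \<in> PiM {0..<t} (\<lambda>_. G) \<rightarrow>\<^sub>M prob_algebra X"
    by (rule measurable_compose[OF measurable_component_singleton[of "t - 1" "{0..<t}" "\<lambda>_. G"] kernel_measurable])
      (use False in auto)
  have "(\<lambda>w. kernel M (w (t - 1)) \<bind> pair_law M \<gamma> t w) \<in> PiM {0..<t} (\<lambda>_. G) \<rightarrow>\<^sub>M prob_algebra G"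
    by (rule measurable_bind_prob_space2[OF 1]) (use pair_law_measurable[of t] in \<open>simp add: histories_def\<close>)
  then show ?thesis using False by (simp add: step_law_def[abs_def])
qed

sublocale IT: Ionescu_Tulcea "step_law M \<gamma> x\<^sub>0" "\<lambda>_. G"
  by (rule Ionescu_Tulcea.intro)
    (auto intro: measurable_prob_algebraD[OF step_law_measurable] kernelD(1)[OF step_law_measurable])

abbreviation "law \<equiv> process_law M \<gamma> x\<^sub>0"

lemma law_eq: "law = IT.PF.lim"
  by (simp add: process_law_def)

lemma sets_law[simp]: "sets law = sets (PiM UNIV (\<lambda>_. G))" and space_law[simp]: "space law = space (PiM UNIV (\<lambda>_. G))"
  by (simp_all add: law_eq)

lemma prob_space_law: "prob_space law"
proof (rule prob_space_distrD)
  show "(\<lambda>\<omega>. restrict \<omega> {}) \<in> law \<rightarrow>\<^sub>M PiM {} (\<lambda>_. G)"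
    by (simp add: law_eq cong: measurable_cong_sets)
  show "prob_space (distr law (PiM {} (\<lambda>_. G)) (\<lambda>\<omega>. restrict \<omega> {}))"
    unfolding law_eq by (subst IT.distr_lim) (auto intro: IT.PF.prob_space_P)
qed

lemma coordinate_measurable[measurable]: "(\<lambda>\<omega>. \<omega> t) \<in> law \<rightarrow>\<^sub>M G"
  by (simp cong: measurable_cong_sets)

definition past :: "nat \<Rightarrow> (nat \<Rightarrow> 'x \<times> 'u) measure" where
  "past n = IT.C 0 n (\<lambda>_. undefined)"

lemma past: "sets (past n) = sets (PiM {0..<n} (\<lambda>_. G))" "space (past n) = space (PiM {0..<n} (\<lambda>_. G))"
  using IT.sets_C[of "\<lambda>_. undefined" 0 n] IT.space_C[of "\<lambda>_. undefined" 0 n]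
  by (auto simp: past_def space_PiM)

lemma CI_eq_past: "IT.CI {0..<n} = past n"
proof (rule measure_eqI)
  show "sets (IT.CI {0..<n}) = sets (past n)" by (simp add: IT.PF.sets_P past)
  fix E assume "E \<in> sets (IT.CI {0..<n})"
  then have E: "E \<in> sets (PiM {0..<n} (\<lambda>_. G))" by (simp add: IT.PF.sets_P)
  have "IT.PF.emb {0..<n} {0..<n} E = E"
    using sets.sets_into_space[OF E] by (intro prod_emb_id) (simp add: space_PiM)
  then show "emeasure (IT.CI {0..<n}) E = emeasure (past n) E"
    using IT.emeasure_CI[OF subset_refl E] by (simp add: past_def)
qed

lemma nn_integral_law_past:
  assumes F: "F \<in> borel_measurable (PiM {0..<n} (\<lambda>_. G))"
  shows "(\<integral>\<^sup>+\<omega>. F (restrict \<omega> {0..<n}) \<partial>law) = (\<integral>\<^sup>+w. F w \<partial>past n)"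
proof -
  have R: "(\<lambda>\<omega>. restrict \<omega> {0..<n}) \<in> law \<rightarrow>\<^sub>M PiM {0..<n} (\<lambda>_. G)"
    using measurable_restrict_subset[of "{0..<n}" UNIV "\<lambda>_. G"] by (simp cong: measurable_cong_sets)
  have "(\<integral>\<^sup>+w. F w \<partial>past n) = (\<integral>\<^sup>+w. F w \<partial>distr law (PiM {0..<n} (\<lambda>_. G)) (\<lambda>\<omega>. restrict \<omega> {0..<n}))"
    unfolding law_eq by (subst IT.distr_lim) (auto simp: CI_eq_past)
  also have "\<dots> = (\<integral>\<^sup>+\<omega>. F (restrict \<omega> {0..<n}) \<partial>law)"
    using F by (simp add: nn_integral_distr[OF R])
  finally show ?thesis ..
qed

text \<open>The finite-dimensional laws of the Ionescu-Tulcea measure are built by appending one coordinate at a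
  time.\<close>

lemma nn_integral_law_coordinate:
  assumes g: "g \<in> borel_measurable G"
  shows "(\<integral>\<^sup>+\<omega>. g (\<omega> t) \<partial>law) = (\<integral>\<^sup>+w. \<integral>\<^sup>+k. g k \<partial>step_law M \<gamma> x\<^sub>0 t w \<partial>past t)"
proof -
  have F: "(\<lambda>w. g (w t)) \<in> borel_measurable (PiM {0..<Suc t} (\<lambda>_. G))"
    by (rule measurable_compose[OF measurable_component_singleton[of t "{0..<Suc t}" "\<lambda>_. G"] g]) simp
  have E: "IT.eP t \<in> past t \<rightarrow>\<^sub>M subprob_algebra (PiM {0..<Suc t} (\<lambda>_. G))"
    using IT.measurable_eP[of t] measurable_cong_sets[OF past(1) refl] by blast
  have "(\<integral>\<^sup>+\<omega>. g (\<omega> t) \<partial>law) = (\<integral>\<^sup>+w. g (w t) \<partial>past (Suc t))"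
    using nn_integral_law_past[OF F] by simp
  also have "past (Suc t) = past t \<bind> IT.eP t" by (simp add: past_def)
  also have "(\<integral>\<^sup>+w. g (w t) \<partial>(past t \<bind> IT.eP t)) = (\<integral>\<^sup>+w. \<integral>\<^sup>+v. g (v t) \<partial>IT.eP t w \<partial>past t)"
    by (rule nn_integral_bind[OF F E])
  also have "\<dots> = (\<integral>\<^sup>+w. \<integral>\<^sup>+k. g k \<partial>step_law M \<gamma> x\<^sub>0 t w \<partial>past t)"
  proof (rule nn_integral_cong)
    fix w assume "w \<in> space (past t)"
    then have w: "w \<in> space (PiM {0..<t} (\<lambda>_. G))" by (simp add: past)
    show "(\<integral>\<^sup>+v. g (v t) \<partial>IT.eP t w) = (\<integral>\<^sup>+k. g k \<partial>step_law M \<gamma> x\<^sub>0 t w)"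
      using IT.nn_integral_eP[OF w F] by simp
  qed
  finally show ?thesis .
qed

text \<open>One transition: the next state depends on the past through the current pair only, the next action
  may depend on all of it.\<close>

lemma nn_integral_step_Suc:
  assumes g: "g \<in> borel_measurable G" and w: "w \<in> space (PiM {0..<Suc t} (\<lambda>_. G))"
  shows "(\<integral>\<^sup>+k. g k \<partial>step_law M \<gamma> x\<^sub>0 (Suc t) w) = (\<integral>\<^sup>+y. \<integral>\<^sup>+k. g k \<partial>act_law M (\<gamma> (Suc t) (w, y)) y \<partial>kernel M (w t))"
proof -
  have wt: "w t \<in> space G" using w by (auto simp: space_PiM PiE_iff)
  have P: "(\<lambda>y. pair_law M \<gamma> (Suc t) w y) \<in> X \<rightarrow>\<^sub>M prob_algebra G"
  proof -
    have "(\<lambda>y. (w, y)) \<in> X \<rightarrow>\<^sub>M histories M (Suc t)"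
      unfolding histories_def using w by (intro measurable_Pair) auto
    from measurable_compose[OF this pair_law_measurable] show ?thesis by simp
  qed
  show ?thesis
    using nn_integral_bind_prob_algebra[OF measurable_space[OF kernel_measurable wt] P g]
    by (simp add: step_law_def) (simp add: pair_law_eq_act_law)
qed

definition occ :: "nat \<Rightarrow> ('x \<times> 'u) measure" where
  "occ t = distr law G (\<lambda>\<omega>. \<omega> t)"

lemma occ: "occ t \<in> space (prob_algebra G)"
  using prob_space.prob_space_distr[OF prob_space_law coordinate_measurable]
  by (simp add: occ_def space_prob_algebra)

lemma nn_integral_occ: "g \<in> borel_measurable G \<Longrightarrow> (\<integral>\<^sup>+k. g k \<partial>occ t) = (\<integral>\<^sup>+\<omega>. g (\<omega> t) \<partial>law)"
  unfolding occ_def by (simp add: nn_integral_distr[OF coordinate_measurable])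

lemma nn_integral_occ_past:
  assumes "H \<in> borel_measurable G"
  shows "(\<integral>\<^sup>+w. H (w t) \<partial>past (Suc t)) = (\<integral>\<^sup>+k. H k \<partial>occ t)"
proof -
  have F: "(\<lambda>w. H (w t)) \<in> borel_measurable (PiM {0..<Suc t} (\<lambda>_. G))"
    by (rule measurable_compose[OF measurable_component_singleton[of t "{0..<Suc t}" "\<lambda>_. G"] assms]) simp
  show ?thesis using nn_integral_law_past[OF F] by (simp add: nn_integral_occ[OF assms])
qed

lemma kernel_emeasure_measurable: "B \<in> sets X \<Longrightarrow> (\<lambda>k. emeasure (kernel M k) B) \<in> borel_measurable G"
  by (rule measurable_compose[OF measurable_prob_algebraD[OF kernel_measurable] measurable_emeasure_subprob_algebra])

lemma marginal_occ_Suc: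
  assumes B: "B \<in> sets X"
  shows "marginal (occ (Suc t)) B = (\<integral>\<^sup>+k. emeasure (kernel M k) B \<partial>occ t)"
proof -
  have iX: "(indicator B :: 'x \<Rightarrow> ennreal) \<in> borel_measurable X" using B by simp
  have iB: "(\<lambda>k. indicator B (fst k) :: ennreal) \<in> borel_measurable G"
    using measurable_compose[OF fst_G iX] .
  have "marginal (occ (Suc t)) B = (\<integral>\<^sup>+w. \<integral>\<^sup>+k. indicator B (fst k) \<partial>step_law M \<gamma> x\<^sub>0 (Suc t) w \<partial>past (Suc t))"
    by (simp add: marginal_eq_nn_integral[OF occ B] nn_integral_occ[OF iB] nn_integral_law_coordinate[OF iB])
  also have "\<dots> = (\<integral>\<^sup>+w. emeasure (kernel M (w t)) B \<partial>past (Suc t))"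
  proof (rule nn_integral_cong)
    fix w assume "w \<in> space (past (Suc t))"
    then have w: "w \<in> space (PiM {0..<Suc t} (\<lambda>_. G))" by (simp add: past)
    have wt: "w t \<in> space G" using w by (auto simp: space_PiM PiE_iff)
    have sk: "space (kernel M (w t)) = states M" "sets (kernel M (w t)) = sets X"
      using kernelD[OF kernel_measurable wt] by auto
    have "(\<integral>\<^sup>+k. indicator B (fst k) \<partial>step_law M \<gamma> x\<^sub>0 (Suc t) w)
        = (\<integral>\<^sup>+y. \<integral>\<^sup>+k. indicator B (fst k) \<partial>act_law M (\<gamma> (Suc t) (w, y)) y \<partial>kernel M (w t))"
      by (rule nn_integral_step_Suc[OF iB w])
    also have "\<dots> = (\<integral>\<^sup>+y. indicator B y \<partial>kernel M (w t))"
    proof (rule nn_integral_cong)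
      fix y assume y: "y \<in> space (kernel M (w t))"
      have "(w, y) \<in> space (histories M (Suc t))"
        using w y sk by (simp add: histories_def space_pair_measure)
      from admissible_decision[OF this] have "decision y (\<gamma> (Suc t) (w, y))" by simp
      then show "(\<integral>\<^sup>+k. indicator B (fst k) \<partial>act_law M (\<gamma> (Suc t) (w, y)) y) = indicator B y"
        using act_law_fst[OF _ _ iX] y sk by simp
    qed
    also have "\<dots> = emeasure (kernel M (w t)) B" using B sk by simp
    finally show "(\<integral>\<^sup>+k. indicator B (fst k) \<partial>step_law M \<gamma> x\<^sub>0 (Suc t) w) = emeasure (kernel M (w t)) B" .
  qed
  also have "\<dots> = (\<integral>\<^sup>+k. emeasure (kernel M k) B \<partial>occ t)"
    by (rule nn_integral_occ_past[OF kernel_emeasure_measurable[OF B]])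
  finally show ?thesis .
qed

text \<open>The averages leave out time \<open>0\<close>: from time \<open>1\<close> on the law of the state is a mixture of
  transition laws, hence dominated by \<open>\<nu>\<close>.\<close>

definition avg_occ :: "nat \<Rightarrow> ('x \<times> 'u) measure" where
  "avg_occ n = measure_pmf (pmf_of_set {1..Suc n}) \<bind> occ"

lemma avg_occ: "avg_occ n \<in> space (prob_algebra G)"
  and nn_integral_avg_occ: "g \<in> borel_measurable G \<Longrightarrow>
    (\<integral>\<^sup>+k. g k \<partial>avg_occ n) = (\<Sum>t=1..Suc n. \<integral>\<^sup>+k. g k \<partial>occ t) / of_nat (Suc n)"
proof -
  let ?p = "measure_pmf (pmf_of_set {1..Suc n})"
  have p: "?p \<in> space (prob_algebra (count_space UNIV))"
    by (simp add: space_prob_algebra prob_space_measure_pmf)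
  have o: "occ \<in> count_space UNIV \<rightarrow>\<^sub>M prob_algebra G" using occ by simp
  show "avg_occ n \<in> space (prob_algebra G)"
    unfolding avg_occ_def using prob_space_bind'[OF p o] sets_bind'[OF p o] by (simp add: space_prob_algebra)
  assume g: "g \<in> borel_measurable G"
  have "(\<integral>\<^sup>+k. g k \<partial>avg_occ n) = (\<integral>\<^sup>+t. \<integral>\<^sup>+k. g k \<partial>occ t \<partial>?p)"
    unfolding avg_occ_def by (rule nn_integral_bind_prob_algebra[OF p o g])
  also have "\<dots> = (\<Sum>t=1..Suc n. \<integral>\<^sup>+k. g k \<partial>occ t) / of_nat (Suc n)"
    by (subst nn_integral_pmf_of_set) auto
  finally show "(\<integral>\<^sup>+k. g k \<partial>avg_occ n) = (\<Sum>t=1..Suc n. \<integral>\<^sup>+k. g k \<partial>occ t) / of_nat (Suc n)" .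
qed

end

context borel_controlled
begin

lemma kernel_average_le:
  assumes \<nu>: "\<And>k B. k \<in> graph_set M \<Longrightarrow> B \<in> sets X \<Longrightarrow> emeasure (kernel M k) B \<le> emeasure \<nu> B"
    and \<mu>: "\<mu> \<in> space (prob_algebra G)" and B: "B \<in> sets X"
  shows "(\<integral>\<^sup>+k. emeasure (kernel M k) B \<partial>\<mu>) \<le> emeasure \<nu> B"
proof -
  have "(\<integral>\<^sup>+k. emeasure (kernel M k) B \<partial>\<mu>) \<le> (\<integral>\<^sup>+k. emeasure \<nu> B \<partial>\<mu>)"
    using \<nu> B in_prob_algebraD(3)[OF \<mu>] by (intro nn_integral_mono) simp
  also have "\<dots> = emeasure \<nu> B"
    using prob_space.emeasure_space_1[OF in_prob_algebraD(1)[OF \<mu>]] by simp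
  finally show ?thesis .
qed

lemma integral_kernel_measure:
  assumes \<mu>: "\<mu> \<in> space (prob_algebra G)" and B: "B \<in> sets X"
  shows "(\<integral>k. measure (kernel M k) B \<partial>\<mu>) = enn2real (\<integral>\<^sup>+k. emeasure (kernel M k) B \<partial>\<mu>)"
proof -
  have "(\<lambda>k. measure (kernel M k) B) \<in> borel_measurable G"
    by (rule measurable_compose[OF kernel_measurable measurable_measure_prob_algebra[OF B]])
  then have "(\<lambda>k. measure (kernel M k) B) \<in> borel_measurable \<mu>"
    using measurable_cong_sets[OF in_prob_algebraD(2)[OF \<mu>] refl] by blast
  then have "(\<integral>k. measure (kernel M k) B \<partial>\<mu>) = enn2real (\<integral>\<^sup>+k. ennreal (measure (kernel M k) B) \<partial>\<mu>)"
    by (intro integral_eq_nn_integral) auto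
  also have "(\<integral>\<^sup>+k. ennreal (measure (kernel M k) B) \<partial>\<mu>) = (\<integral>\<^sup>+k. emeasure (kernel M k) B \<partial>\<mu>)"
    using kernelD(1)[OF kernel_measurable] in_prob_algebraD(3)[OF \<mu>]
    by (intro nn_integral_cong) (simp add: finite_measure.emeasure_eq_measure prob_space_def)
  finally show ?thesis .
qed

end

context controlled_process
begin

lemma marginal_avg_occ:
  assumes B: "B \<in> sets X"
  shows "marginal (avg_occ n) B = (\<Sum>t=1..Suc n. marginal (occ t) B) / of_nat (Suc n)"
proof -
  have iB: "(\<lambda>k. indicator B (fst k) :: ennreal) \<in> borel_measurable G"
    using measurable_compose[OF fst_G borel_measurable_indicator[OF B]] .
  show ?thesis
    unfolding marginal_eq_nn_integral[OF avg_occ B] marginal_eq_nn_integral[OF occ B]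
    by (rule nn_integral_avg_occ[OF iB])
qed

lemma marginal_avg_occ_le:
  assumes \<nu>: "\<And>k B. k \<in> graph_set M \<Longrightarrow> B \<in> sets X \<Longrightarrow> emeasure (kernel M k) B \<le> emeasure \<nu> B"
    and B: "B \<in> sets X"
  shows "marginal (avg_occ n) B \<le> emeasure \<nu> B"
proof -
  have "marginal (occ t) B \<le> emeasure \<nu> B" if t: "t \<in> {1..Suc n}" for t
  proof -
    obtain s where s: "t = Suc s" using t by (cases t) auto
    show ?thesis unfolding s marginal_occ_Suc[OF B] by (rule kernel_average_le[OF \<nu> occ B])
  qed
  then have "(\<Sum>t=1..Suc n. marginal (occ t) B) \<le> (\<Sum>t=1..Suc n. emeasure \<nu> B)" by (rule sum_mono)
  also have "\<dots> = emeasure \<nu> B * of_nat (Suc n)" by (simp only: sum_constant card_atLeastAtMost diff_Suc_1 mult.commute)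
  finally have "(\<Sum>t=1..Suc n. marginal (occ t) B) / of_nat (Suc n) \<le> emeasure \<nu> B * of_nat (Suc n) / of_nat (Suc n)"
    by (rule divide_right_mono_ennreal)
  also have "\<dots> = emeasure \<nu> B"
    by (rule ennreal_mult_divide_eq[OF of_nat_neq_0 ennreal_of_nat_neq_top])
  finally show ?thesis by (simp only: marginal_avg_occ[OF B])
qed

lemma avg_occ_defect:
  assumes B: "B \<in> sets X"
  shows "(\<lambda>n. enn2real (marginal (avg_occ n) B) - (\<integral>k. measure (kernel M k) B \<partial>avg_occ n)) \<longlonglongrightarrow> 0"
proof -
  define a where "a t = measure (occ t) ((B \<times> actions M) \<inter> graph_set M)" for t
  have ae: "marginal (occ t) B = ennreal (a t)" for t
    using in_prob_algebraD(1)[OF occ[of t]]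
    by (simp add: marginal_def a_def finite_measure.emeasure_eq_measure prob_space_def)
  have a01: "0 \<le> a t" "a t \<le> 1" for t
    using prob_space.prob_le_1[OF in_prob_algebraD(1)[OF occ[of t]]] by (auto simp: a_def)
  have avg: "enn2real ((\<Sum>t=1..Suc n. ennreal (f t)) / of_nat (Suc n)) = (\<Sum>t=1..Suc n. f t) / real (Suc n)"
    if "\<And>t. 0 \<le> f t" for f n
  proof -
    have "(\<Sum>t=1..Suc n. ennreal (f t)) / of_nat (Suc n) = ennreal ((\<Sum>t=1..Suc n. f t) / real (Suc n))"
      using that by (simp only: sum_ennreal ennreal_of_nat_eq_real_of_nat) (intro divide_ennreal sum_nonneg; simp)
    moreover have "0 \<le> (\<Sum>t=1..Suc n. f t) / real (Suc n)"
      using that by (intro divide_nonneg_nonneg sum_nonneg) auto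
    ultimately show ?thesis by simp
  qed
  have 1: "enn2real (marginal (avg_occ n) B) = (\<Sum>t=1..Suc n. a t) / real (Suc n)" for n
    unfolding marginal_avg_occ[OF B] ae by (rule avg) (rule a01)
  have 2: "(\<integral>k. measure (kernel M k) B \<partial>avg_occ n) = (\<Sum>t=1..Suc n. a (Suc t)) / real (Suc n)" for n
    unfolding integral_kernel_measure[OF avg_occ B] nn_integral_avg_occ[OF kernel_emeasure_measurable[OF B]]
      marginal_occ_Suc[OF B, symmetric] ae
    by (rule avg) (rule a01)
  \<comment> \<open>The state at time \<open>t + 1\<close> is the outcome of the transition at time \<open>t\<close>, so the defect telescopes.\<close>
  have 3: "(\<Sum>t=1..Suc n. a t) - (\<Sum>t=1..Suc n. a (Suc t)) = a 1 - a (Suc (Suc n))" for n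
    by (induction n) auto
  have "enn2real (marginal (avg_occ n) B) - (\<integral>k. measure (kernel M k) B \<partial>avg_occ n)
      = (a 1 - a (Suc (Suc n))) / real (Suc n)" for n
    unfolding 1 2 by (simp only: diff_divide_distrib[symmetric] 3)
  moreover have "(\<lambda>n. (a 1 - a (Suc (Suc n))) / real (Suc n)) \<longlonglongrightarrow> 0"
  proof (rule Lim_null_comparison)
    show "\<forall>\<^sub>F n in sequentially. norm ((a 1 - a (Suc (Suc n))) / real (Suc n)) \<le> 1 / real (Suc n)"
    proof (intro always_eventually allI)
      fix n
      have "\<bar>a 1 - a (Suc (Suc n))\<bar> \<le> 1" using a01[of 1] a01[of "Suc (Suc n)"] by linarith
      then show "norm ((a 1 - a (Suc (Suc n))) / real (Suc n)) \<le> 1 / real (Suc n)"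
        by (simp add: divide_right_mono)
    qed
    show "(\<lambda>n. 1 / real (Suc n)) \<longlonglongrightarrow> 0" by (rule LIMSEQ_Suc[OF lim_1_over_n])
  qed
  ultimately show ?thesis by simp
qed

lemma average_cost_eq:
  "average_cost M x\<^sub>0 \<gamma> = limsup (\<lambda>T. (\<Sum>t<T. mean_cost M (occ t)) / of_nat T)"
proof -
  have c: "(\<lambda>k. ennreal (cost M k)) \<in> borel_measurable G" using cost_measurable by simp
  have "(\<integral>\<^sup>+\<omega>. (\<Sum>t<T. ennreal (cost M (\<omega> t))) \<partial>law) = (\<Sum>t<T. mean_cost M (occ t))" for T
    unfolding mean_cost_def nn_integral_occ[OF c]
    by (rule nn_integral_sum) (rule measurable_compose[OF coordinate_measurable c])
  then show ?thesis by (simp add: average_cost_def)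
qed

lemma mean_cost_avg_occ:
  "mean_cost M (avg_occ n) = (\<Sum>t=1..Suc n. mean_cost M (occ t)) / of_nat (Suc n)"
  unfolding mean_cost_def using cost_measurable by (intro nn_integral_avg_occ) simp

text \<open>Adding the nonnegative cost of time \<open>0\<close> and dividing by \<open>n + 1\<close> instead of \<open>n + 2\<close> only costs a factor
  that tends to \<open>1\<close>.\<close>

lemma limsup_mean_cost_avg_occ: "limsup (\<lambda>n. mean_cost M (avg_occ n)) \<le> average_cost M x\<^sub>0 \<gamma>"
proof (rule dense_ge)
  fix y assume y: "average_cost M x\<^sub>0 \<gamma> < y"
  show "limsup (\<lambda>n. mean_cost M (avg_occ n)) \<le> y"
  proof (cases "y = \<top>")
    case False
  define S where "S T = (\<Sum>t<T. mean_cost M (occ t)) / of_nat T" for T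
  define q where "q n = ennreal (real (Suc (Suc n)) / real (Suc n))" for n
  have le: "mean_cost M (avg_occ n) \<le> q n * S (Suc (Suc n))" for n
  proof -
    let ?s = "\<Sum>t<Suc (Suc n). mean_cost M (occ t)"
    have "(\<Sum>t=1..Suc n. mean_cost M (occ t)) \<le> ?s"
      by (rule sum_mono2) auto
    then have "mean_cost M (avg_occ n) \<le> ?s / of_nat (Suc n)"
      unfolding mean_cost_avg_occ by (rule divide_right_mono_ennreal)
    also have "?s / of_nat (Suc n) = q n * S (Suc (Suc n))"
    proof -
      have "inverse (ennreal (real (Suc n))) = q n * inverse (ennreal (real (Suc (Suc n))))"
        unfolding q_def by (simp only: inverse_ennreal of_nat_0_less_iff zero_less_Suc ennreal_mult[symmetric]
            divide_nonneg_nonneg of_nat_0_le_iff inverse_nonnegative_iff_nonnegative) (simp add: field_simps)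
      then show ?thesis
        by (simp only: S_def divide_ennreal_def ennreal_of_nat_eq_real_of_nat mult_ac)
    qed
    finally show ?thesis .
  qed
  have "\<forall>\<^sub>F T in sequentially. S T < y"
    using y unfolding average_cost_eq S_def[symmetric] by (rule Limsup_lessD)
  then have "\<forall>\<^sub>F n in sequentially. S (Suc (Suc n)) < y"
    by (simp add: eventually_sequentially_Suc[of "\<lambda>n. S n < y"] eventually_sequentially_Suc[of "\<lambda>n. S (Suc n) < y"])
  then have "\<forall>\<^sub>F n in sequentially. mean_cost M (avg_occ n) \<le> q n * y"
  proof eventually_elim
    case (elim n)
    then have "q n * S (Suc (Suc n)) \<le> q n * y" by (intro mult_left_mono) auto
    then show ?case using le[of n] by simp
  qed
  then have "limsup (\<lambda>n. mean_cost M (avg_occ n)) \<le> limsup (\<lambda>n. q n * y)"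
    by (rule Limsup_mono)
  also have "limsup (\<lambda>n. q n * y) = y"
  proof (rule lim_imp_Limsup)
    have "(\<lambda>n. real (Suc (Suc n)) / real (Suc n)) \<longlonglongrightarrow> 1"
    proof -
      have "(\<lambda>n. 1 + 1 / real (Suc n)) \<longlonglongrightarrow> 1 + 0"
        by (intro tendsto_add tendsto_const LIMSEQ_Suc[OF lim_1_over_n])
      then show ?thesis by (simp add: field_simps)
    qed
    then have "q \<longlonglongrightarrow> ennreal 1" unfolding q_def by (rule tendsto_ennrealI)
    then have "(\<lambda>n. y * q n) \<longlonglongrightarrow> y * ennreal 1"
      using False by (intro ennreal_tendsto_cmult) (auto simp: less_top)
    then show "(\<lambda>n. q n * y) \<longlonglongrightarrow> y" by (simp add: mult.commute)
  qed simp
  finally show ?thesis .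
  qed simp
qed

end

section \<open>Existence of optimal invariant measures\<close>

context borel_controlled
begin

text \<open>Only the actions have to be tight: for the states, domination by a finite measure takes over.\<close>

definition action_tight :: "(nat \<Rightarrow> ('x \<times> 'u) measure) \<Rightarrow> bool" where
  "action_tight \<mu> \<longleftrightarrow>
     (\<forall>e>0. \<exists>L. compact L \<and> (\<forall>n. measure (\<mu> n) {k \<in> graph_set M. snd k \<notin> L} \<le> e))"

lemma action_tight_of_compact_actions:
  assumes "compact (actions M)"
  shows "action_tight \<mu>"
  unfolding action_tight_def
proof (intro allI impI exI conjI)
  have E: "{k \<in> graph_set M. snd k \<notin> actions M} = {}"
    using feasible_actions by (auto simp: graph_set_def)
  show "measure (\<mu> n) {k \<in> graph_set M. snd k \<notin> actions M} \<le> e" if "e > 0" for n e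
    unfolding E using that by simp
qed (rule assms)

text \<open>The action leaves the projection of a compact sublevel set of the cost only where the cost is above
  the level, and Markov's inequality bounds that probability.\<close>

lemma action_tight_of_bounded_cost:
  assumes B: "cond_B M" and \<mu>: "\<And>n. \<mu> n \<in> space (prob_algebra G)"
    and C: "\<And>n. mean_cost M (\<mu> n) \<le> ennreal C" "0 \<le> C"
  shows "action_tight \<mu>"
  unfolding action_tight_def
proof (intro allI impI)
  fix e :: real assume e: "0 < e"
  \<comment> \<open>\<open>C + 1\<close> instead of \<open>C\<close> keeps the level positive.\<close>
  define \<alpha> where "\<alpha> = (C + 1) / e"
  have \<alpha>: "\<alpha> > 0" using C(2) e by (simp add: \<alpha>_def)
  let ?K = "{k \<in> graph_set M. cost M k \<le> \<alpha>}"
  have "compact ?K" using B \<alpha> by (simp add: cond_B_def)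
  then have L: "compact (snd ` ?K)" by (intro compact_continuous_image continuous_on_snd continuous_on_id)
  have [measurable]: "snd ` ?K \<in> sets borel" using L by (intro borel_closed compact_imp_closed)
  let ?E = "{k \<in> graph_set M. snd k \<notin> snd ` ?K}"
  have "{k \<in> space G. snd k \<notin> snd ` ?K} \<in> sets G" by measurable
  then have E: "?E \<in> sets G" by simp
  have "measure (\<mu> n) ?E \<le> e" for n
  proof -
    interpret prob_space "\<mu> n" by (rule in_prob_algebraD[OF \<mu>])
    note s = in_prob_algebraD(2,3)[OF \<mu>, of n]
    have "(\<lambda>k. ennreal (cost M k)) \<in> borel_measurable G" using cost_measurable by simp
    then have c: "(\<lambda>k. ennreal (cost M k)) \<in> borel_measurable (\<mu> n)"
      using measurable_cong_sets[OF s(1) refl] by blast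
    have "emeasure (\<mu> n) ?E = (\<integral>\<^sup>+k. indicator ?E k \<partial>\<mu> n)" using E s by simp
    also have "\<dots> \<le> (\<integral>\<^sup>+k. ennreal (1 / \<alpha>) * ennreal (cost M k) \<partial>\<mu> n)"
    proof (rule nn_integral_mono)
      fix k assume "k \<in> space (\<mu> n)"
      then have k: "k \<in> graph_set M" by (simp add: s)
      show "indicator ?E k \<le> ennreal (1 / \<alpha>) * ennreal (cost M k)"
      proof (cases "k \<in> ?E")
        case True
        then have "\<not> cost M k \<le> \<alpha>" using k by auto
        then have "1 \<le> 1 / \<alpha> * cost M k" using \<alpha> by (simp add: field_simps)
        then have "ennreal 1 \<le> ennreal (1 / \<alpha> * cost M k)" by (rule ennreal_leI)
        also have "ennreal (1 / \<alpha> * cost M k) = ennreal (1 / \<alpha>) * ennreal (cost M k)"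
          using \<alpha> cost_nonneg[OF k] by (intro ennreal_mult) auto
        finally show ?thesis using True by (simp only: indicator_simps ennreal_1)
      qed simp
    qed
    also have "\<dots> = ennreal (1 / \<alpha>) * mean_cost M (\<mu> n)"
      unfolding mean_cost_def using c by (rule nn_integral_cmult)
    also have "\<dots> \<le> ennreal (1 / \<alpha>) * ennreal C" by (intro mult_left_mono C) simp
    also have "\<dots> = ennreal (C / \<alpha>)" using \<alpha> C(2) by (simp add: ennreal_mult[symmetric])
    also have "\<dots> \<le> ennreal e"
    proof (rule ennreal_leI)
      show "C / \<alpha> \<le> e" using C(2) e by (simp add: \<alpha>_def field_simps)
    qed
    finally show ?thesis using e by (simp add: emeasure_eq_measure)
  qed
  then show "\<exists>L. compact L \<and> (\<forall>n. measure (\<mu> n) {k \<in> graph_set M. snd k \<notin> L} \<le> e)"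
    using L by blast
qed

lemma invariantD:
  assumes "\<mu> \<in> invariant_measures M"
  shows "\<mu> \<in> space (prob_algebra G)" "B \<in> sets X \<Longrightarrow> marginal \<mu> B = (\<integral>\<^sup>+k. emeasure (kernel M k) B \<partial>\<mu>)"
  using assms by (auto simp: invariant_measures_iff)

text \<open>A minimizing sequence of invariant measures has finite, bounded cost from some index on, and there
  the limit theorem applies with vanishing defect.\<close>

lemma optimal_invariant_measure_exists:
  assumes D: "cond_D M" and cost: "\<And>x. x \<in> states M \<Longrightarrow> continuous_on (feasible M x) (\<lambda>u. cost M (x, u))"
    and \<nu>: "finite_measure \<nu>" "sets \<nu> = sets X"
      "\<And>k B. k \<in> graph_set M \<Longrightarrow> B \<in> sets X \<Longrightarrow> emeasure (kernel M k) B \<le> emeasure \<nu> B"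
    and tight: "\<And>\<mu> C. (\<And>n. \<mu> n \<in> space (prob_algebra G)) \<Longrightarrow> 0 \<le> C \<Longrightarrow> (\<And>n. mean_cost M (\<mu> n) \<le> ennreal C) \<Longrightarrow> action_tight \<mu>"
    and fin: "\<mu>\<^sub>0 \<in> invariant_measures M" "mean_cost M \<mu>\<^sub>0 < \<top>"
  shows "\<exists>m \<phi>. m \<in> space (prob_algebra X) \<and> (\<forall>B\<in>sets X. emeasure m B \<le> emeasure \<nu> B) \<and> stationary_kernel \<phi> \<and>
    joint m \<phi> \<in> invariant_measures M \<and>
    mean_cost M (joint m \<phi>) = (INF \<mu>\<in>invariant_measures M. mean_cost M \<mu>)"
proof -
  let ?I = "INF \<mu>\<in>invariant_measures M. mean_cost M \<mu>"
  have ne': "mean_cost M ` invariant_measures M \<noteq> {}" using fin by auto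
  obtain f where f: "decseq f" "range f \<subseteq> mean_cost M ` invariant_measures M" "?I = (INF i. f i)"
    using ennreal_Inf_countable_INF[OF ne'] by blast
  have lim: "f \<longlonglongrightarrow> ?I" using LIMSEQ_INF[OF f(1)] f(3) by simp
  have "?I < \<top>" using fin by (meson INF_lower le_less_trans)
  then obtain C where C: "?I < ennreal C" "0 \<le> C"
  proof -
    obtain c where c: "?I = ennreal c" "0 \<le> c" using \<open>?I < \<top>\<close> by (cases ?I) auto
    then have "?I < ennreal (c + 1)" by (simp add: ennreal_less_iff)
    then show ?thesis using c(2) by (intro that[of "c + 1"]) auto
  qed
  from order_tendstoD(2)[OF lim C(1)] obtain N where N: "\<And>n. n \<ge> N \<Longrightarrow> f n < ennreal C"
    by (auto simp: eventually_sequentially)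
  have "\<forall>n. \<exists>\<mu>\<in>invariant_measures M. f (n + N) = mean_cost M \<mu>" using f(2) by auto
  then obtain \<mu> where \<mu>: "\<And>n. \<mu> n \<in> invariant_measures M" "\<And>n. f (n + N) = mean_cost M (\<mu> n)" by metis
  have P: "\<mu> n \<in> space (prob_algebra G)" for n by (rule invariantD[OF \<mu>(1)])
  have "action_tight \<mu>"
  proof (rule tight[OF P C(2)])
    show "mean_cost M (\<mu> n) \<le> ennreal C" for n
      using N[of "n + N"] unfolding \<mu>(2) by simp
  qed
  have "\<exists>r m \<phi>. strict_mono r \<and> m \<in> space (prob_algebra X) \<and> (\<forall>B\<in>sets X. emeasure m B \<le> emeasure \<nu> B) \<and>
     stationary_kernel \<phi> \<and> joint m \<phi> \<in> invariant_measures M \<and>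
     mean_cost M (joint m \<phi>) \<le> liminf (\<lambda>n. mean_cost M (\<mu> (r n)))"
  proof (rule almost_invariant_limit[OF D \<nu>(1,2) P _ _ _ cost])
    show "marginal (\<mu> n) B \<le> emeasure \<nu> B" if "B \<in> sets X" for n B
      unfolding invariantD(2)[OF \<mu>(1) that] by (rule kernel_average_le[OF \<nu>(3) P that])
    show "\<exists>L. compact L \<and> (\<forall>n. measure (\<mu> n) {k \<in> graph_set M. snd k \<notin> L} \<le> e)" if "e > 0" for e
      using \<open>action_tight \<mu>\<close> that by (simp add: action_tight_def)
    show "(\<lambda>n. enn2real (marginal (\<mu> n) B) - (\<integral>k. measure (kernel M k) B \<partial>\<mu> n)) \<longlonglongrightarrow> 0" if "B \<in> sets X" for B
      by (simp add: integral_kernel_measure[OF P that] invariantD(2)[OF \<mu>(1) that])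
  qed
  then obtain r m \<phi> where r: "strict_mono r" and m: "m \<in> space (prob_algebra X)" "\<forall>B\<in>sets X. emeasure m B \<le> emeasure \<nu> B"
    "stationary_kernel \<phi>" "joint m \<phi> \<in> invariant_measures M"
    and le: "mean_cost M (joint m \<phi>) \<le> liminf (\<lambda>n. mean_cost M (\<mu> (r n)))" by blast
  have "(\<lambda>n. mean_cost M (\<mu> n)) \<longlonglongrightarrow> ?I"
    using LIMSEQ_ignore_initial_segment[OF lim, of N] by (simp add: \<mu>(2))
  from LIMSEQ_subseq_LIMSEQ[OF this r] have "liminf (\<lambda>n. mean_cost M (\<mu> (r n))) = ?I"
    by (intro lim_imp_Liminf) (auto simp: comp_def)
  with le have "mean_cost M (joint m \<phi>) = ?I"
    by (intro antisym INF_lower m(4)) simp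
  then show ?thesis using m by blast
qed

end

context controlled_process
begin

text \<open>Every policy is at least as expensive as some invariant measure: a limit of its averaged occupation
  measures. The shift \<open>N\<close> skips the initial averages, for which a bound on the limit superior says
  nothing.\<close>

lemma invariant_measure_below_average_cost:
  assumes D: "cond_D M" and cost: "\<And>x. x \<in> states M \<Longrightarrow> continuous_on (feasible M x) (\<lambda>u. cost M (x, u))"
    and \<nu>: "finite_measure \<nu>" "sets \<nu> = sets X"
      "\<And>k B. k \<in> graph_set M \<Longrightarrow> B \<in> sets X \<Longrightarrow> emeasure (kernel M k) B \<le> emeasure \<nu> B"
    and tight: "action_tight (\<lambda>n. avg_occ (n + N))"
  shows "\<exists>\<mu>\<in>invariant_measures M. mean_cost M \<mu> \<le> average_cost M x\<^sub>0 \<gamma>"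
proof -
  have "\<exists>r m \<phi>. strict_mono r \<and> m \<in> space (prob_algebra X) \<and> (\<forall>B\<in>sets X. emeasure m B \<le> emeasure \<nu> B) \<and>
     stationary_kernel \<phi> \<and> joint m \<phi> \<in> invariant_measures M \<and>
     mean_cost M (joint m \<phi>) \<le> liminf (\<lambda>n. mean_cost M (avg_occ (r n + N)))"
  proof (rule almost_invariant_limit[OF D \<nu>(1,2) avg_occ _ _ _ cost])
    show "marginal (avg_occ (n + N)) B \<le> emeasure \<nu> B" if "B \<in> sets X" for n B
      by (rule marginal_avg_occ_le[OF \<nu>(3) that])
    show "\<exists>L. compact L \<and> (\<forall>n. measure (avg_occ (n + N)) {k \<in> graph_set M. snd k \<notin> L} \<le> e)" if "e > 0" for e
      using tight that by (simp add: action_tight_def)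
    show "(\<lambda>n. enn2real (marginal (avg_occ (n + N)) B) - (\<integral>k. measure (kernel M k) B \<partial>avg_occ (n + N))) \<longlonglongrightarrow> 0"
      if "B \<in> sets X" for B
      using LIMSEQ_ignore_initial_segment[OF avg_occ_defect[OF that], of N] .
  qed
  then obtain r m \<phi> where r: "strict_mono r" and inv: "joint m \<phi> \<in> invariant_measures M"
    and le: "mean_cost M (joint m \<phi>) \<le> liminf (\<lambda>n. mean_cost M (avg_occ (r n + N)))" by blast
  note le
  also have "liminf (\<lambda>n. mean_cost M (avg_occ (r n + N))) \<le> limsup (\<lambda>n. mean_cost M (avg_occ (r n + N)))"
    by (rule Liminf_le_Limsup) simp
  also have "\<dots> \<le> limsup (\<lambda>n. mean_cost M (avg_occ n))"
    using limsup_subseq_mono[of "\<lambda>n. r n + N" "\<lambda>n. mean_cost M (avg_occ n)"] r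
    by (simp add: comp_def strict_mono_def)
  also have "\<dots> \<le> average_cost M x\<^sub>0 \<gamma>" by (rule limsup_mean_cost_avg_occ)
  finally show ?thesis using inv by blast
qed

lemma action_tight_avg_occ:
  assumes B: "cond_B M" and fin: "average_cost M x\<^sub>0 \<gamma> < \<top>"
  shows "\<exists>N. action_tight (\<lambda>n. avg_occ (n + N))"
proof -
  obtain c where c: "average_cost M x\<^sub>0 \<gamma> = ennreal c" "0 \<le> c"
    using fin by (cases "average_cost M x\<^sub>0 \<gamma>") auto
  have "limsup (\<lambda>n. mean_cost M (avg_occ n)) < ennreal (c + 1)"
    using limsup_mean_cost_avg_occ c by (auto intro: le_less_trans simp: ennreal_less_iff)
  then have "\<forall>\<^sub>F n in sequentially. mean_cost M (avg_occ n) < ennreal (c + 1)" by (rule Limsup_lessD)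
  then obtain N where N: "\<And>n. n \<ge> N \<Longrightarrow> mean_cost M (avg_occ n) < ennreal (c + 1)"
    by (auto simp: eventually_sequentially)
  have "action_tight (\<lambda>n. avg_occ (n + N))"
    by (rule action_tight_of_bounded_cost[OF B avg_occ, of _ "c + 1"]) (use N c(2) in \<open>auto intro: less_imp_le\<close>)
  then show ?thesis ..
qed

end

section \<open>Stationary policies\<close>

context borel_controlled
begin

definition stationary :: "('x \<Rightarrow> 'u measure) \<Rightarrow> ('x, 'u) policy" where
  "stationary \<phi> = (\<lambda>t h. \<phi> (snd h))"

lemma stationary_apply: "stationary \<phi> t h = \<phi> (snd h)"
  by (simp add: stationary_def)

lemma stationary_policies_eq: "stationary_policies M = stationary ` Collect stationary_kernel"
  by (auto simp: stationary_policies_def stationary_def stationary_kernel_def)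

lemma stationary_admissible:
  assumes "stationary_kernel \<phi>"
  shows "stationary \<phi> \<in> admissible_policies M"
proof -
  have "(\<lambda>h. \<phi> (snd h)) \<in> histories M t \<rightarrow>\<^sub>M prob_algebra A" for t
    using assms unfolding histories_def stationary_kernel_def
    by (intro measurable_compose[OF measurable_snd]) simp
  then show ?thesis
    using assms by (auto simp: admissible_policies_def stationary_def stationary_kernel_def histories_def space_pair_measure)
qed

definition transition :: "('x \<Rightarrow> 'u measure) \<Rightarrow> 'x \<Rightarrow> 'x measure" where
  "transition \<phi> x = act_law M (\<phi> x) x \<bind> kernel M"

lemma transition_measurable:
  assumes "stationary_kernel \<phi>"
  shows "transition \<phi> \<in> X \<rightarrow>\<^sub>M prob_algebra X"
  unfolding transition_def[abs_def]
  by (rule measurable_bind_prob_space[OF act_law_stationary_measurable[OF assms] kernel_measurable])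

lemma nn_integral_transition:
  assumes \<phi>: "stationary_kernel \<phi>" and x: "x \<in> states M" and g: "g \<in> borel_measurable X"
  shows "(\<integral>\<^sup>+y. g y \<partial>transition \<phi> x) = (\<integral>\<^sup>+k. \<integral>\<^sup>+y. g y \<partial>kernel M k \<partial>act_law M (\<phi> x) x)"
  unfolding transition_def
  by (rule nn_integral_bind_prob_algebra[OF act_law_in_prob_algebra[OF x stationary_kernel_decision[OF \<phi> x]] kernel_measurable g])

lemma kernel_nn_integral_measurable:
  "g \<in> borel_measurable X \<Longrightarrow> (\<lambda>k. \<integral>\<^sup>+y. g y \<partial>kernel M k) \<in> borel_measurable G"
  by (rule measurable_compose[OF measurable_prob_algebraD[OF kernel_measurable] nn_integral_measurable_subprob_algebra])

lemma invariant_joint_iff: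
  assumes m: "m \<in> space (prob_algebra X)" and \<phi>: "stationary_kernel \<phi>"
  shows "joint m \<phi> \<in> invariant_measures M \<longleftrightarrow> m \<bind> transition \<phi> = m"
proof -
  have e: "emeasure (m \<bind> transition \<phi>) B = (\<integral>\<^sup>+k. emeasure (kernel M k) B \<partial>joint m \<phi>)" if B: "B \<in> sets X" for B
  proof -
    have "emeasure (m \<bind> transition \<phi>) B = (\<integral>\<^sup>+x. emeasure (transition \<phi> x) B \<partial>m)"
      by (rule emeasure_bind_prob_algebra[OF m transition_measurable[OF \<phi>] B])
    also have "\<dots> = (\<integral>\<^sup>+x. \<integral>\<^sup>+k. emeasure (kernel M k) B \<partial>act_law M (\<phi> x) x \<partial>m)"
    proof (rule nn_integral_cong)
      fix x assume "x \<in> space m"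
      then have x: "x \<in> states M" using in_prob_algebraD(3)[OF m] by simp
      show "emeasure (transition \<phi> x) B = (\<integral>\<^sup>+k. emeasure (kernel M k) B \<partial>act_law M (\<phi> x) x)"
        unfolding transition_def
        by (rule emeasure_bind_prob_algebra[OF act_law_in_prob_algebra[OF x stationary_kernel_decision[OF \<phi> x]] kernel_measurable B])
    qed
    also have "\<dots> = (\<integral>\<^sup>+k. emeasure (kernel M k) B \<partial>joint m \<phi>)"
    proof (rule nn_integral_joint[OF m \<phi>, symmetric])
      show "(\<lambda>k. emeasure (kernel M k) B) \<in> borel_measurable G"
        by (rule measurable_compose[OF measurable_prob_algebraD[OF kernel_measurable] measurable_emeasure_subprob_algebra[OF B]])
    qed
    finally show ?thesis .
  qed
  have s: "sets (m \<bind> transition \<phi>) = sets X" by (rule sets_bind'[OF m transition_measurable[OF \<phi>]])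
  show ?thesis
  proof
    assume "joint m \<phi> \<in> invariant_measures M"
    then show "m \<bind> transition \<phi> = m"
      by (intro measure_eqI) (simp_all add: s e in_prob_algebraD(2)[OF m] invariant_measures_iff marginal_joint[OF m \<phi>])
  next
    assume eq: "m \<bind> transition \<phi> = m"
    then have "emeasure m B = (\<integral>\<^sup>+k. emeasure (kernel M k) B \<partial>joint m \<phi>)" if "B \<in> sets X" for B
      using e[OF that] by simp
    then show "joint m \<phi> \<in> invariant_measures M"
      by (simp add: invariant_measures_iff joint_in_prob_algebra[OF m \<phi>] marginal_joint[OF m \<phi>])
  qed
qed

primrec state_law :: "('x \<Rightarrow> 'u measure) \<Rightarrow> nat \<Rightarrow> 'x \<Rightarrow> 'x measure" where
  "state_law \<phi> 0 = return X"
| "state_law \<phi> (Suc t) = (\<lambda>x. state_law \<phi> t x \<bind> transition \<phi>)"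

lemma state_law_measurable:
  "stationary_kernel \<phi> \<Longrightarrow> state_law \<phi> t \<in> X \<rightarrow>\<^sub>M prob_algebra X"
  by (induction t) (auto intro: measurable_bind_prob_space transition_measurable)

text \<open>A law invariant under one transition is invariant under \<open>t\<close> of them.\<close>

lemma invariant_state_law:
  assumes \<phi>: "stationary_kernel \<phi>" and m: "m \<in> space (prob_algebra X)" "m \<bind> transition \<phi> = m"
    and g: "g \<in> borel_measurable X"
  shows "(\<integral>\<^sup>+x. \<integral>\<^sup>+y. g y \<partial>state_law \<phi> t x \<partial>m) = (\<integral>\<^sup>+x. g x \<partial>m)"
  using g
proof (induction t arbitrary: g)
  case 0
  then show ?case
    using in_prob_algebraD(3)[OF m(1)] by (intro nn_integral_cong) (simp add: nn_integral_return)
next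
  case (Suc t)
  have I: "(\<lambda>y. \<integral>\<^sup>+z. g z \<partial>transition \<phi> y) \<in> borel_measurable X"
    by (rule measurable_compose[OF measurable_prob_algebraD[OF transition_measurable[OF \<phi>]]
          nn_integral_measurable_subprob_algebra[OF Suc.prems]])
  have "(\<integral>\<^sup>+x. \<integral>\<^sup>+y. g y \<partial>state_law \<phi> (Suc t) x \<partial>m) = (\<integral>\<^sup>+x. \<integral>\<^sup>+y. \<integral>\<^sup>+z. g z \<partial>transition \<phi> y \<partial>state_law \<phi> t x \<partial>m)"
    using in_prob_algebraD(3)[OF m(1)] measurable_space[OF state_law_measurable[OF \<phi>]]
    by (intro nn_integral_cong) (simp add: nn_integral_bind_prob_algebra[OF _ transition_measurable[OF \<phi>] Suc.prems])
  also have "\<dots> = (\<integral>\<^sup>+y. \<integral>\<^sup>+z. g z \<partial>transition \<phi> y \<partial>m)" by (rule Suc.IH[OF I])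
  also have "\<dots> = (\<integral>\<^sup>+z. g z \<partial>(m \<bind> transition \<phi>))"
    by (rule nn_integral_bind_prob_algebra[OF m(1) transition_measurable[OF \<phi>] Suc.prems, symmetric])
  finally show ?case by (simp add: m(2))
qed

end

locale stationary_process = borel_controlled M
  for M :: "('x::polish_space, 'u::polish_space) control_model" +
  fixes \<phi> :: "'x \<Rightarrow> 'u measure" and x\<^sub>0 :: 'x
  assumes kernel: "stationary_kernel \<phi>" and start: "x\<^sub>0 \<in> states M"
begin

sublocale controlled_process M "stationary \<phi>" x\<^sub>0
  by unfold_locales (auto intro: stationary_admissible kernel start)

lemma act_integral_measurable:
  "g \<in> borel_measurable G \<Longrightarrow> (\<lambda>y. \<integral>\<^sup>+k. g k \<partial>act_law M (\<phi> y) y) \<in> borel_measurable X"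
  by (rule measurable_compose[OF measurable_prob_algebraD[OF act_law_stationary_measurable[OF kernel]]
        nn_integral_measurable_subprob_algebra])

lemma occ_0: "g \<in> borel_measurable G \<Longrightarrow> (\<integral>\<^sup>+k. g k \<partial>occ 0) = (\<integral>\<^sup>+k. g k \<partial>act_law M (\<phi> x\<^sub>0) x\<^sub>0)"
proof -
  assume g: "g \<in> borel_measurable G"
  have "prob_space (past 0)" unfolding past_def by (rule IT.prob_space_C) (simp add: space_PiM)
  then show ?thesis
    by (simp add: nn_integral_occ[OF g] nn_integral_law_coordinate[OF g] step_law_def pair_law_eq_act_law stationary_apply
        prob_space.emeasure_space_1)
qed

lemma occ_Suc:
  assumes g: "g \<in> borel_measurable G"
  shows "(\<integral>\<^sup>+k. g k \<partial>occ (Suc t)) = (\<integral>\<^sup>+k. \<integral>\<^sup>+y. \<integral>\<^sup>+l. g l \<partial>act_law M (\<phi> y) y \<partial>kernel M k \<partial>occ t)"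
proof -
  have "(\<integral>\<^sup>+k. g k \<partial>occ (Suc t)) = (\<integral>\<^sup>+w. \<integral>\<^sup>+k. g k \<partial>step_law M (stationary \<phi>) x\<^sub>0 (Suc t) w \<partial>past (Suc t))"
    by (simp add: nn_integral_occ[OF g] nn_integral_law_coordinate[OF g])
  also have "\<dots> = (\<integral>\<^sup>+w. \<integral>\<^sup>+y. \<integral>\<^sup>+l. g l \<partial>act_law M (\<phi> y) y \<partial>kernel M (w t) \<partial>past (Suc t))"
    by (intro nn_integral_cong) (simp add: nn_integral_step_Suc[OF g] past stationary_apply)
  also have "\<dots> = (\<integral>\<^sup>+k. \<integral>\<^sup>+y. \<integral>\<^sup>+l. g l \<partial>act_law M (\<phi> y) y \<partial>kernel M k \<partial>occ t)"
    by (rule nn_integral_occ_past[OF kernel_nn_integral_measurable[OF act_integral_measurable[OF g]]])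
  finally show ?thesis .
qed

text \<open>Given the current state, the action is drawn from \<open>\<phi>\<close> at every time.\<close>

lemma occ_disintegration:
  assumes g: "g \<in> borel_measurable G"
  shows "(\<integral>\<^sup>+k. g k \<partial>occ t) = (\<integral>\<^sup>+k. \<integral>\<^sup>+l. g l \<partial>act_law M (\<phi> (fst k)) (fst k) \<partial>occ t)"
proof -
  let ?I = "\<lambda>y. \<integral>\<^sup>+l. g l \<partial>act_law M (\<phi> y) y"
  have I: "?I \<in> borel_measurable X" by (rule act_integral_measurable[OF g])
  have IG: "(\<lambda>k. ?I (fst k)) \<in> borel_measurable G" by (rule measurable_compose[OF fst_G I])
  have II: "(\<integral>\<^sup>+k. ?I (fst k) \<partial>act_law M (\<phi> y) y) = ?I y" if "y \<in> states M" for y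
    by (rule act_law_fst[OF that stationary_kernel_decision[OF kernel that] I])
  show ?thesis
  proof (cases t)
    case 0
    then show ?thesis using II[OF start] by (simp add: occ_0[OF g] occ_0[OF IG])
  next
    case (Suc s)
    have "(\<integral>\<^sup>+k. ?I (fst k) \<partial>occ (Suc s)) = (\<integral>\<^sup>+k. \<integral>\<^sup>+y. \<integral>\<^sup>+l. ?I (fst l) \<partial>act_law M (\<phi> y) y \<partial>kernel M k \<partial>occ s)"
      by (rule occ_Suc[OF IG])
    also have "\<dots> = (\<integral>\<^sup>+k. \<integral>\<^sup>+y. ?I y \<partial>kernel M k \<partial>occ s)"
      using in_prob_algebraD(3)[OF occ] kernelD(3)[OF kernel_measurable]
      by (intro nn_integral_cong II) auto
    finally show ?thesis using Suc by (simp add: occ_Suc[OF g])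
  qed
qed

text \<open>The state process under a stationary policy is the Markov chain with kernel \<open>transition \<phi>\<close>.\<close>

lemma nn_integral_occ_fst:
  assumes g: "g \<in> borel_measurable X"
  shows "(\<integral>\<^sup>+k. g (fst k) \<partial>occ t) = (\<integral>\<^sup>+y. g y \<partial>state_law \<phi> t x\<^sub>0)"
  using g
proof (induction t arbitrary: g)
  case 0
  have gG: "(\<lambda>k. g (fst k)) \<in> borel_measurable G" by (rule measurable_compose[OF fst_G 0])
  show ?case
    using act_law_fst[OF start stationary_kernel_decision[OF kernel start] 0] start 0
    by (simp add: occ_0[OF gG] nn_integral_return)
next
  case (Suc t)
  have gG: "(\<lambda>k. g (fst k)) \<in> borel_measurable G" by (rule measurable_compose[OF fst_G Suc.prems])
  let ?H = "\<lambda>k. \<integral>\<^sup>+y. g y \<partial>kernel M k"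
  have H: "?H \<in> borel_measurable G" by (rule kernel_nn_integral_measurable[OF Suc.prems])
  have T: "(\<lambda>y. \<integral>\<^sup>+z. g z \<partial>transition \<phi> y) \<in> borel_measurable X"
    by (rule measurable_compose[OF measurable_prob_algebraD[OF transition_measurable[OF kernel]]
          nn_integral_measurable_subprob_algebra[OF Suc.prems]])
  have fst_in: "fst k \<in> states M" if "k \<in> space (occ t)" for k
    using that in_prob_algebraD(3)[OF occ[of t]] by (auto simp: graph_set_def)
  have "(\<integral>\<^sup>+k. g (fst k) \<partial>occ (Suc t)) = (\<integral>\<^sup>+k. \<integral>\<^sup>+y. \<integral>\<^sup>+l. g (fst l) \<partial>act_law M (\<phi> y) y \<partial>kernel M k \<partial>occ t)"
    by (rule occ_Suc[OF gG])
  also have "\<dots> = (\<integral>\<^sup>+k. ?H k \<partial>occ t)"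
    using in_prob_algebraD(3)[OF occ] kernelD(3)[OF kernel_measurable]
    by (intro nn_integral_cong act_law_fst[OF _ _ Suc.prems] stationary_kernel_decision[OF kernel]) auto
  also have "\<dots> = (\<integral>\<^sup>+k. \<integral>\<^sup>+l. ?H l \<partial>act_law M (\<phi> (fst k)) (fst k) \<partial>occ t)" by (rule occ_disintegration[OF H])
  also have "\<dots> = (\<integral>\<^sup>+k. \<integral>\<^sup>+z. g z \<partial>transition \<phi> (fst k) \<partial>occ t)"
    using nn_integral_transition[OF kernel fst_in Suc.prems] by (intro nn_integral_cong) simp
  also have "\<dots> = (\<integral>\<^sup>+y. \<integral>\<^sup>+z. g z \<partial>transition \<phi> y \<partial>state_law \<phi> t x\<^sub>0)" by (rule Suc.IH[OF T])
  also have "\<dots> = (\<integral>\<^sup>+z. g z \<partial>state_law \<phi> (Suc t) x\<^sub>0)"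
    using nn_integral_bind_prob_algebra[OF measurable_space[OF state_law_measurable[OF kernel]] transition_measurable[OF kernel] Suc.prems, of x\<^sub>0 t] start
    by simp
  finally show ?case .
qed

text \<open>A set that has full measure at each time contains the whole trajectory almost surely.\<close>

lemma law_state_in:
  assumes S: "S \<in> sets X" and 1: "\<And>t. emeasure (state_law \<phi> t x\<^sub>0) S = 1"
  shows "AE \<omega> in law. \<forall>t. fst (\<omega> t) \<in> S"
proof -
  interpret law: prob_space law by (rule prob_space_law)
  have "AE \<omega> in law. fst (\<omega> t) \<in> S" for t
  proof -
    have iS: "(indicator S :: 'x \<Rightarrow> ennreal) \<in> borel_measurable X" using S by simp
    have fS: "(\<lambda>\<omega>. fst (\<omega> t)) \<in> law \<rightarrow>\<^sub>M X" by (rule measurable_compose[OF coordinate_measurable fst_G])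
    let ?E = "(\<lambda>\<omega>. fst (\<omega> t)) -` S \<inter> space law"
    have E: "?E \<in> sets law" by (rule measurable_sets[OF fS S])
    have "emeasure law ?E = (\<integral>\<^sup>+\<omega>. indicator ?E \<omega> \<partial>law)" using E by simp
    also have "\<dots> = (\<integral>\<^sup>+\<omega>. indicator S (fst (\<omega> t)) \<partial>law)"
      by (intro nn_integral_cong) (auto split: split_indicator)
    also have "\<dots> = (\<integral>\<^sup>+k. indicator S (fst k) \<partial>occ t)"
      by (rule nn_integral_occ[OF measurable_compose[OF fst_G iS], symmetric])
    also have "\<dots> = emeasure (state_law \<phi> t x\<^sub>0) S"
      using S kernelD(2)[OF state_law_measurable[OF kernel], of x\<^sub>0 t] start
      by (simp add: nn_integral_occ_fst[OF iS])
    finally have "law.prob ?E = 1" using 1 by (simp add: law.emeasure_eq_measure)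
    then have "AE \<omega> in law. \<omega> \<in> ?E" by (rule law.AE_prob_1)
    then show ?thesis by (rule eventually_mono) simp
  qed
  then show ?thesis by (simp add: AE_all_countable)
qed

end

section \<open>Uniqueness of the invariant law of a Harris recurrent chain\<close>

lemma nn_integral_eq_total_density:
  "f \<in> borel_measurable \<nu> \<Longrightarrow> (\<integral>\<^sup>+x. f x \<partial>\<nu>) = emeasure (density \<nu> f) (space \<nu>)"
  by (simp add: emeasure_density cong: nn_integral_cong)

lemma dominated_density:
  assumes \<nu>: "finite_measure \<nu>" and m: "sets m = sets \<nu>" "\<And>B. B \<in> sets \<nu> \<Longrightarrow> emeasure m B \<le> emeasure \<nu> B"
  shows "\<exists>F. F \<in> borel_measurable \<nu> \<and> (\<forall>x. 0 \<le> F x) \<and> m = density \<nu> (\<lambda>x. ennreal (F x))"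
proof -
  interpret \<nu>: finite_measure \<nu> by fact
  have sp: "space m = space \<nu>" using m(1) by (rule sets_eq_imp_space_eq)
  have fin: "emeasure m (space \<nu>) \<noteq> \<infinity>"
    using m(2)[of "space \<nu>"] \<nu>.emeasure_finite[of "space \<nu>"] by (auto simp: top_unique)
  have "\<exists>f\<in>borel_measurable \<nu>. density \<nu> f = m"
  proof (rule \<nu>.Radon_Nikodym_finite_measure)
    show "finite_measure m" by (rule finite_measureI) (use fin in \<open>simp add: sp\<close>)
    show "sets m = sets \<nu>" by (rule m)
    show "absolutely_continuous \<nu> m"
      unfolding absolutely_continuous_def
    proof
      fix B assume "B \<in> null_sets \<nu>"
      then have B: "B \<in> sets \<nu>" "emeasure \<nu> B = 0" by (auto simp: null_sets_def)
      then show "B \<in> null_sets m" using m(2)[OF B(1)] by (simp add: null_sets_def m(1))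
    qed
  qed
  then obtain f where f: "f \<in> borel_measurable \<nu>" "density \<nu> f = m" by blast
  have "(\<integral>\<^sup>+x. f x \<partial>\<nu>) = emeasure m (space \<nu>)"
    unfolding f(2)[symmetric] using f(1) by (rule nn_integral_eq_total_density)
  then have "AE x in \<nu>. f x \<noteq> \<infinity>" using fin by (intro nn_integral_PInf_AE[OF f(1)]) simp
  then have "density \<nu> f = density \<nu> (\<lambda>x. ennreal (enn2real (f x)))"
    using f(1) by (intro density_cong) (auto elim!: eventually_mono simp: less_top)
  then show ?thesis using f by (intro exI[of _ "\<lambda>x. enn2real (f x)"]) auto
qed

context borel_controlled
begin

text \<open>Let \<open>D\<close> be the difference of two invariant densities, \<open>S\<close> the set where it is positive and \<open>H t x\<close>
  the probability of being in \<open>S\<close> at time \<open>t\<close> when starting from \<open>x\<close>. Invariance says that \<open>D\<close> has the same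
  integral against \<open>H t\<close> as against the indicator of \<open>S\<close>. Since \<open>H t\<close> lies between \<open>0\<close> and \<open>1\<close>, the indicator
  maximizes this integral, and equality forces \<open>H t = 1\<close> almost everywhere on \<open>S\<close>.\<close>

lemma excess_never_leaves:
  assumes \<phi>: "stationary_kernel \<phi>" and \<nu>: "finite_measure \<nu>" "sets \<nu> = sets X"
    and m: "m\<^sub>1 \<in> space (prob_algebra X)" "m\<^sub>2 \<in> space (prob_algebra X)"
    and inv: "m\<^sub>1 \<bind> transition \<phi> = m\<^sub>1" "m\<^sub>2 \<bind> transition \<phi> = m\<^sub>2"
    and F1: "F\<^sub>1 \<in> borel_measurable \<nu>" "\<And>x. 0 \<le> F\<^sub>1 x" "m\<^sub>1 = density \<nu> (\<lambda>x. ennreal (F\<^sub>1 x))"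
    and F2: "F\<^sub>2 \<in> borel_measurable \<nu>" "\<And>x. 0 \<le> F\<^sub>2 x" "m\<^sub>2 = density \<nu> (\<lambda>x. ennreal (F\<^sub>2 x))"
  shows "(AE x in \<nu>. F\<^sub>1 x \<le> F\<^sub>2 x) \<or>
    (\<exists>x\<in>states M. \<forall>t. emeasure (state_law \<phi> t x) {y \<in> states M. F\<^sub>2 y < F\<^sub>1 y} = 1)"
proof (rule disjCI)
  assume none: "\<not> (\<exists>x\<in>states M. \<forall>t. emeasure (state_law \<phi> t x) {y \<in> states M. F\<^sub>2 y < F\<^sub>1 y} = 1)"
  interpret \<nu>: finite_measure \<nu> by fact
  have sp: "space \<nu> = states M" using sets_eq_imp_space_eq[OF \<nu>(2)] by simp
  define S where "S = {y \<in> states M. F\<^sub>2 y < F\<^sub>1 y}"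
  have "{y \<in> space \<nu>. F\<^sub>2 y < F\<^sub>1 y} \<in> sets \<nu>" using F1(1) F2(1) by measurable
  then have S: "S \<in> sets X" by (simp add: S_def sp \<nu>(2))
  define H where "H t x = measure (state_law \<phi> t x) S" for t x
  have HX: "H t \<in> borel_measurable X" for t
    unfolding H_def by (rule measurable_compose[OF state_law_measurable[OF \<phi>] measurable_measure_prob_algebra[OF S]])
  have H\<nu>: "H t \<in> borel_measurable \<nu>" for t using HX measurable_cong_sets[OF \<nu>(2) refl] by blast
  have sl: "prob_space (state_law \<phi> t x)" "sets (state_law \<phi> t x) = sets X" if "x \<in> states M" for t x
    using kernelD[OF state_law_measurable[OF \<phi>], of x t] that by auto
  have H01: "0 \<le> H t x" "x \<in> states M \<Longrightarrow> H t x \<le> 1" for t x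
    unfolding H_def using prob_space.prob_le_1[OF sl(1)] by auto
  have S\<nu>[measurable]: "S \<in> sets \<nu>" using S \<nu>(2) by simp
  \<comment> \<open>Both sides are the mass of \<open>S\<close> under the invariant law with density \<open>F\<close>.\<close>
  have balance: "integrable \<nu> F \<and> integrable \<nu> (\<lambda>x. F x * H t x) \<and> integrable \<nu> (\<lambda>x. F x * indicator S x) \<and>
      (\<integral>x. F x * H t x \<partial>\<nu>) = (\<integral>x. F x * indicator S x \<partial>\<nu>)"
    if F: "F \<in> borel_measurable \<nu>" "\<And>x. 0 \<le> F x" and md: "m = density \<nu> (\<lambda>x. ennreal (F x))"
      and mP: "m \<in> space (prob_algebra X)" and mi: "m \<bind> transition \<phi> = m" for F m t
  proof -
    interpret m: prob_space m by (rule in_prob_algebraD[OF mP])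
    note ms = in_prob_algebraD(2,3)[OF mP]
    have "(\<integral>\<^sup>+x. ennreal (F x) \<partial>\<nu>) = emeasure m (space \<nu>)"
      unfolding md using F(1) by (intro nn_integral_eq_total_density) simp
    also have "\<dots> = 1" using m.emeasure_space_1 by (simp add: ms sp)
    finally have iF: "integrable \<nu> F" using F by (intro integrableI_nonneg) auto
    have iH: "integrable \<nu> (\<lambda>x. F x * H t x)"
    proof (rule Bochner_Integration.integrable_bound[OF iF])
      show "AE x in \<nu>. norm (F x * H t x) \<le> norm (F x)"
        using H01 F(2) by (intro AE_I2) (simp add: sp abs_mult mult_left_le)
    qed (use F(1) H\<nu> in simp)
    have iS: "integrable \<nu> (\<lambda>x. F x * indicator S x)"
      by (rule integrable_real_mult_indicator[OF S\<nu> iF])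
    have Hm: "H t \<in> borel_measurable m" using HX measurable_cong_sets[OF ms(1) refl] by blast
    have "(\<integral>\<^sup>+x. ennreal (H t x) \<partial>m) = (\<integral>\<^sup>+x. \<integral>\<^sup>+y. indicator S y \<partial>state_law \<phi> t x \<partial>m)"
      using sl S by (intro nn_integral_cong)
        (simp add: ms H_def finite_measure.emeasure_eq_measure prob_space_def)
    also have "\<dots> = (\<integral>\<^sup>+x. indicator S x \<partial>m)"
      using S by (intro invariant_state_law[OF \<phi> mP mi]) simp
    also have "\<dots> = emeasure m S" using S by (simp add: ms)
    finally have e: "(\<integral>\<^sup>+x. ennreal (H t x) \<partial>m) = emeasure m S" .
    have "(\<integral>x. H t x \<partial>m) = enn2real (emeasure m S)"
      unfolding e[symmetric] using Hm H01 by (intro integral_eq_nn_integral) auto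
    then have 1: "(\<integral>x. H t x \<partial>m) = (\<integral>x. indicator S x \<partial>m)"
      using S sets.sets_into_space[OF S] by (simp add: measure_def ms Int_absorb2)
    have 2: "(\<integral>x. h x \<partial>m) = (\<integral>x. F x * h x \<partial>\<nu>)" if "h \<in> borel_measurable \<nu>" for h :: "'x \<Rightarrow> real"
      unfolding md using integral_density[OF that F(1)] F(2) by simp
    have "(\<integral>x. F x * H t x \<partial>\<nu>) = (\<integral>x. F x * indicator S x \<partial>\<nu>)"
      using 1 unfolding 2[OF H\<nu>[of t]] 2[OF borel_measurable_indicator[OF S\<nu>]] .
    then show ?thesis using iF iH iS by simp
  qed
  note b1 = balance[OF F1 m(1) inv(1)] and b2 = balance[OF F2 m(2) inv(2)]
  have "AE x in \<nu>. (F\<^sub>1 x - F\<^sub>2 x) * (indicator S x - H t x) = 0" for t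
  proof -
    let ?D = "\<lambda>x. (F\<^sub>1 x - F\<^sub>2 x) * (indicator S x - H t x)"
    have eq: "?D x = (F\<^sub>1 x * indicator S x - F\<^sub>1 x * H t x) - (F\<^sub>2 x * indicator S x - F\<^sub>2 x * H t x)" for x
      by (simp add: algebra_simps)
    have int: "integrable \<nu> ?D"
      unfolding eq using b1[of t] b2[of t] by (intro Bochner_Integration.integrable_diff) auto
    have zero: "(\<integral>x. ?D x \<partial>\<nu>) = 0"
      unfolding eq using b1[of t] b2[of t] by simp
    have "AE x in \<nu>. 0 \<le> ?D x"
    proof (rule AE_I2)
      fix x assume "x \<in> space \<nu>"
      then have x: "x \<in> states M" by (simp add: sp)
      show "0 \<le> ?D x"
      proof (cases "x \<in> S")
        case True
        then show ?thesis using H01(2)[OF x, of t] by (simp add: S_def)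
      next
        case False
        then have "F\<^sub>1 x - F\<^sub>2 x \<le> 0" using x by (simp add: S_def)
        then show ?thesis using False H01(1)[of t x] by (simp add: mult_nonpos_nonneg)
      qed
    qed
    then show ?thesis using integral_nonneg_eq_0_iff_AE[OF int] zero by simp
  qed
  then have "AE x in \<nu>. \<forall>t. (F\<^sub>1 x - F\<^sub>2 x) * (indicator S x - H t x) = 0"
    by (intro AE_all_countable[THEN iffD2] allI)
  then show "AE x in \<nu>. F\<^sub>1 x \<le> F\<^sub>2 x"
    using AE_space
  proof eventually_elim
    case (elim x)
    then have x: "x \<in> states M" by (simp add: sp)
    show ?case
    proof (rule ccontr)
      assume "\<not> F\<^sub>1 x \<le> F\<^sub>2 x"
      then have "x \<in> S" "F\<^sub>1 x - F\<^sub>2 x \<noteq> 0" using x by (auto simp: S_def)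
      then have "H t x = 1" for t using elim(1) by auto
      then have "emeasure (state_law \<phi> t x) S = 1" for t
        using sl(1)[OF x, of t] by (simp add: H_def finite_measure.emeasure_eq_measure prob_space_def)
      then show False using none x by (auto simp: S_def)
    qed
  qed
qed

text \<open>Two distinct invariant laws give disjoint sets, each of which contains the whole trajectory for
  some initial state. The complement of each is then negligible for the recurrence measure.\<close>

lemma harris_unique_invariant:
  assumes \<phi>: "stationary_kernel \<phi>" and harris: "harris_recurrent M (stationary \<phi>)"
    and \<nu>: "finite_measure \<nu>" "sets \<nu> = sets X"
    and m: "m\<^sub>1 \<in> space (prob_algebra X)" "m\<^sub>2 \<in> space (prob_algebra X)"
    and dom: "\<And>B. B \<in> sets X \<Longrightarrow> emeasure m\<^sub>1 B \<le> emeasure \<nu> B" "\<And>B. B \<in> sets X \<Longrightarrow> emeasure m\<^sub>2 B \<le> emeasure \<nu> B"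
    and inv: "m\<^sub>1 \<bind> transition \<phi> = m\<^sub>1" "m\<^sub>2 \<bind> transition \<phi> = m\<^sub>2"
  shows "m\<^sub>1 = m\<^sub>2"
proof (rule ccontr)
  assume neq: "m\<^sub>1 \<noteq> m\<^sub>2"
  interpret \<nu>: finite_measure \<nu> by fact
  have sp: "space \<nu> = states M" using sets_eq_imp_space_eq[OF \<nu>(2)] by simp
  obtain F\<^sub>1 where F1: "F\<^sub>1 \<in> borel_measurable \<nu>" "\<And>x. 0 \<le> F\<^sub>1 x" "m\<^sub>1 = density \<nu> (\<lambda>x. ennreal (F\<^sub>1 x))"
    using dominated_density[OF \<nu>(1), of m\<^sub>1] dom(1) in_prob_algebraD(2)[OF m(1)] by (auto simp: \<nu>(2))
  obtain F\<^sub>2 where F2: "F\<^sub>2 \<in> borel_measurable \<nu>" "\<And>x. 0 \<le> F\<^sub>2 x" "m\<^sub>2 = density \<nu> (\<lambda>x. ennreal (F\<^sub>2 x))"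
    using dominated_density[OF \<nu>(1), of m\<^sub>2] dom(2) in_prob_algebraD(2)[OF m(2)] by (auto simp: \<nu>(2))
  have le_eq: "F \<in> borel_measurable \<nu> \<Longrightarrow> F' \<in> borel_measurable \<nu> \<Longrightarrow> (\<And>x. 0 \<le> F x) \<Longrightarrow> (\<And>x. 0 \<le> F' x) \<Longrightarrow>
      (\<integral>\<^sup>+x. ennreal (F x) \<partial>\<nu>) = 1 \<Longrightarrow> (\<integral>\<^sup>+x. ennreal (F' x) \<partial>\<nu>) = 1 \<Longrightarrow>
      (AE x in \<nu>. F x \<le> F' x) \<Longrightarrow> density \<nu> (\<lambda>x. ennreal (F x)) = density \<nu> (\<lambda>x. ennreal (F' x))" for F F'
  proof -
    assume F: "F \<in> borel_measurable \<nu>" "F' \<in> borel_measurable \<nu>" "\<And>x. 0 \<le> F x" "\<And>x. 0 \<le> F' x"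
      "(\<integral>\<^sup>+x. ennreal (F x) \<partial>\<nu>) = 1" "(\<integral>\<^sup>+x. ennreal (F' x) \<partial>\<nu>) = 1" "AE x in \<nu>. F x \<le> F' x"
    have i: "integrable \<nu> F" "integrable \<nu> F'" using F by (auto intro!: integrableI_nonneg)
    have "(\<integral>x. F' x - F x \<partial>\<nu>) = 0" using i F by (simp add: integral_eq_nn_integral)
    moreover have "AE x in \<nu>. 0 \<le> F' x - F x" using F(7) by eventually_elim simp
    ultimately have "AE x in \<nu>. F' x - F x = 0"
      using integral_nonneg_eq_0_iff_AE[of \<nu> "\<lambda>x. F' x - F x"] i by simp
    then show ?thesis using F by (intro density_cong) (auto elim!: eventually_mono)
  qed
  have one: "(\<integral>\<^sup>+x. ennreal (F x) \<partial>\<nu>) = 1"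
    if "F \<in> borel_measurable \<nu>" "m = density \<nu> (\<lambda>x. ennreal (F x))" "m \<in> space (prob_algebra X)" for F m
  proof -
    have "(\<integral>\<^sup>+x. ennreal (F x) \<partial>\<nu>) = emeasure m (space \<nu>)"
      unfolding that(2) using that(1) by (intro nn_integral_eq_total_density) simp
    then show ?thesis
      using prob_space.emeasure_space_1[OF in_prob_algebraD(1)[OF that(3)]] in_prob_algebraD(3)[OF that(3)] by (simp add: sp)
  qed
  note o1 = one[OF F1(1,3) m(1)] and o2 = one[OF F2(1,3) m(2)]
  define S where "S = {y \<in> states M. F\<^sub>2 y < F\<^sub>1 y}"
  define S' where "S' = {y \<in> states M. F\<^sub>1 y < F\<^sub>2 y}"
  have "{y \<in> space \<nu>. F\<^sub>2 y < F\<^sub>1 y} \<in> sets \<nu>" "{y \<in> space \<nu>. F\<^sub>1 y < F\<^sub>2 y} \<in> sets \<nu>"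
    using F1(1) F2(1) by measurable
  then have S: "S \<in> sets X" "S' \<in> sets X" by (simp_all add: S_def S'_def sp \<nu>(2))
  have "\<not> (AE x in \<nu>. F\<^sub>1 x \<le> F\<^sub>2 x)"
    using le_eq[OF F1(1) F2(1) F1(2) F2(2) o1 o2] neq F1(3) F2(3) by auto
  then obtain x where x: "x \<in> states M" "\<And>t. emeasure (state_law \<phi> t x) S = 1"
    using excess_never_leaves[OF \<phi> \<nu> m inv F1 F2] by (auto simp: S_def)
  have "\<not> (AE x in \<nu>. F\<^sub>2 x \<le> F\<^sub>1 x)"
    using le_eq[OF F2(1) F1(1) F2(2) F1(2) o2 o1] neq F1(3) F2(3) by auto
  then obtain x' where x': "x' \<in> states M" "\<And>t. emeasure (state_law \<phi> t x') S' = 1"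
    using excess_never_leaves[OF \<phi> \<nu> m(2,1) inv(2,1) F2 F1] by (auto simp: S'_def)
  obtain \<psi> where \<psi>: "sets \<psi> = sets X" "emeasure \<psi> (states M) > 0"
    and rec: "\<And>B y. B \<in> sets X \<Longrightarrow> emeasure \<psi> B > 0 \<Longrightarrow> y \<in> states M \<Longrightarrow>
      AE \<omega> in process_law M (stationary \<phi>) y. \<exists>\<^sub>\<infinity>t. fst (\<omega> t) \<in> B"
    using harris by (auto simp: harris_recurrent_def)
  have null: "emeasure \<psi> (states M - T) = 0"
    if T: "T \<in> sets X" and y: "y \<in> states M" "\<And>t. emeasure (state_law \<phi> t y) T = 1" for T y
  proof (rule ccontr)
    assume "emeasure \<psi> (states M - T) \<noteq> 0"
    interpret stationary_process M \<phi> y by unfold_locales (rule \<phi>, rule y)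
    interpret law: prob_space law by (rule prob_space_law)
    have "states M - T \<in> sets X" using T sets.compl_sets[OF T] by simp
    then have "AE \<omega> in law. \<exists>\<^sub>\<infinity>t. fst (\<omega> t) \<in> states M - T"
      using \<open>emeasure \<psi> (states M - T) \<noteq> 0\<close> y(1) by (intro rec) (auto simp: zero_less_iff_neq_zero)
    moreover have "AE \<omega> in law. \<forall>t. fst (\<omega> t) \<in> T" by (rule law_state_in[OF T y(2)])
    ultimately have "AE \<omega> in law. False" by eventually_elim (auto simp: INFM_nat)
    then show False by simp
  qed
  have "states M = (states M - S) \<union> (states M - S')" by (auto simp: S_def S'_def)
  also have "emeasure \<psi> \<dots> \<le> emeasure \<psi> (states M - S) + emeasure \<psi> (states M - S')"
    using S sets.compl_sets[of _ X] by (intro emeasure_subadditive) (auto simp: \<psi>(1))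
  also have "\<dots> = 0" using null[OF S(1) x] null[OF S(2) x'] by simp
  finally show False using \<psi>(2) by simp
qed

end

section \<open>Average cost under an optimal stationary policy\<close>

context stationary_process
begin

definition state_avg :: "nat \<Rightarrow> 'x measure" where
  "state_avg n = distr (avg_occ n) X fst"

lemma fst_avg_occ: "fst \<in> avg_occ n \<rightarrow>\<^sub>M X"
  using fst_G measurable_cong_sets[OF in_prob_algebraD(2)[OF avg_occ] refl] by blast

lemma state_avg: "state_avg n \<in> space (prob_algebra X)"
  unfolding state_avg_def space_prob_algebra
  using prob_space.prob_space_distr[OF in_prob_algebraD(1)[OF avg_occ] fst_avg_occ] by simp

lemma emeasure_state_avg: "B \<in> sets X \<Longrightarrow> emeasure (state_avg n) B = marginal (avg_occ n) B"
  unfolding state_avg_def marginal_def marginal_set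
  using emeasure_distr[OF fst_avg_occ] in_prob_algebraD(3)[OF avg_occ] by simp

lemma nn_integral_avg_occ_state:
  assumes g: "g \<in> borel_measurable G"
  shows "(\<integral>\<^sup>+k. g k \<partial>avg_occ n) = (\<integral>\<^sup>+y. \<integral>\<^sup>+l. g l \<partial>act_law M (\<phi> y) y \<partial>state_avg n)"
proof -
  let ?I = "\<lambda>y. \<integral>\<^sup>+l. g l \<partial>act_law M (\<phi> y) y"
  have I: "?I \<in> borel_measurable X" by (rule act_integral_measurable[OF g])
  have IG: "(\<lambda>k. ?I (fst k)) \<in> borel_measurable G" by (rule measurable_compose[OF fst_G I])
  have "(\<integral>\<^sup>+k. g k \<partial>avg_occ n) = (\<integral>\<^sup>+k. ?I (fst k) \<partial>avg_occ n)"
    unfolding nn_integral_avg_occ[OF g] nn_integral_avg_occ[OF IG] occ_disintegration[OF g] ..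
  also have "\<dots> = (\<integral>\<^sup>+y. ?I y \<partial>state_avg n)"
    unfolding state_avg_def using I by (simp add: nn_integral_distr[OF fst_avg_occ])
  finally show ?thesis .
qed

text \<open>The averaged state laws are dominated by \<open>\<nu>\<close>, so every subsequence has a setwise limit point. It is
  invariant because the defect vanishes, hence it equals \<open>m\<close>, whatever the initial state.\<close>

lemma state_avg_integral_tendsto:
  fixes h :: "'x \<Rightarrow> real"
  assumes \<nu>: "finite_measure \<nu>" "sets \<nu> = sets X"
      "\<And>k B. k \<in> graph_set M \<Longrightarrow> B \<in> sets X \<Longrightarrow> emeasure (kernel M k) B \<le> emeasure \<nu> B"
    and unique: "\<And>m'. m' \<in> space (prob_algebra X) \<Longrightarrow> (\<And>B. B \<in> sets X \<Longrightarrow> emeasure m' B \<le> emeasure \<nu> B) \<Longrightarrow>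
      m' \<bind> transition \<phi> = m' \<Longrightarrow> m' = m"
    and h: "h \<in> borel_measurable X" "\<And>x. x \<in> states M \<Longrightarrow> \<bar>h x\<bar> \<le> C"
  shows "(\<lambda>n. \<integral>x. h x \<partial>state_avg n) \<longlonglongrightarrow> (\<integral>x. h x \<partial>m)"
proof (rule tendstoI, rule ccontr)
  fix e :: real assume e: "0 < e"
  assume "\<not> (\<forall>\<^sub>F n in sequentially. dist (\<integral>x. h x \<partial>state_avg n) (\<integral>x. h x \<partial>m) < e)"
  from not_eventually_sequentiallyD[OF this]
  obtain r :: "nat \<Rightarrow> nat" where r: "strict_mono r" "\<And>n. \<not> dist (\<integral>x. h x \<partial>state_avg (r n)) (\<integral>x. h x \<partial>m) < e" by blast
  have "\<exists>r' m'. strict_mono r' \<and> (\<forall>i::unit. sets (m' i) = sets \<nu> \<and>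
           (\<forall>B\<in>sets \<nu>. emeasure (m' i) B \<le> emeasure \<nu> B \<and>
              (\<lambda>n. measure (state_avg (r (r' n))) B) \<longlonglongrightarrow> measure (m' i) B))"
  proof (rule dominated_setwise_subsequence[OF \<nu>(1) countably_generated_X[OF \<nu>(2)]])
    show "sets (state_avg (r n)) = sets \<nu>" for n using in_prob_algebraD(2)[OF state_avg] \<nu>(2) by simp
    show "emeasure (state_avg (r n)) B \<le> emeasure \<nu> B" if "B \<in> sets \<nu>" for n B
    proof -
      have B: "B \<in> sets X" using that by (simp add: \<nu>(2))
      show ?thesis unfolding emeasure_state_avg[OF B] by (rule marginal_avg_occ_le[OF \<nu>(3) B])
    qed
  qed
  then obtain r' m'' where r': "strict_mono r'" and "\<forall>i::unit. sets (m'' i) = sets \<nu> \<and>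
           (\<forall>B\<in>sets \<nu>. emeasure (m'' i) B \<le> emeasure \<nu> B \<and>
              (\<lambda>n. measure (state_avg (r (r' n))) B) \<longlonglongrightarrow> measure (m'' i) B)" by blast
  moreover define m' where "m' = m'' ()"
  ultimately have m's: "sets m' = sets X" and m'le: "\<And>B. B \<in> sets X \<Longrightarrow> emeasure m' B \<le> emeasure \<nu> B"
    and conv: "\<And>B. B \<in> sets X \<Longrightarrow> (\<lambda>n. measure (state_avg (r (r' n))) B) \<longlonglongrightarrow> measure m' B"
    by (auto simp: \<nu>(2))
  have sp': "space m' = states M" using sets_eq_imp_space_eq[OF m's] by simp
  have fin': "emeasure m' B \<noteq> \<infinity>" if "B \<in> sets X" for B
    using m'le[OF that] finite_measure.emeasure_finite[OF \<nu>(1), of B] by (auto simp: top_unique)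
  have m'1: "prob_space m'"
  proof
    have "(\<lambda>n. measure (state_avg (r (r' n))) (states M)) \<longlonglongrightarrow> measure m' (states M)"
      using conv[OF sets.top] by simp
    moreover have "measure (state_avg n) (states M) = 1" for n
      using prob_space.prob_space[OF in_prob_algebraD(1)[OF state_avg]] in_prob_algebraD(3)[OF state_avg] by simp
    ultimately have "measure m' (states M) = 1" by (simp add: LIMSEQ_const_iff)
    then show "emeasure m' (space m') = 1"
      using fin'[OF sets.top] by (simp add: sp' emeasure_eq_ennreal_measure)
  qed
  have m'P: "m' \<in> space (prob_algebra X)" using m's m'1 by (simp add: space_prob_algebra)
  have lim: "(\<lambda>n. \<integral>x. g x \<partial>state_avg (r (r' n))) \<longlonglongrightarrow> (\<integral>x. g x \<partial>m')"
    if g: "g \<in> borel_measurable X" "\<And>x. x \<in> states M \<Longrightarrow> \<bar>g x\<bar> \<le> D" for g :: "'x \<Rightarrow> real" and D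
  proof (rule setwise_imp_integral_tendsto[OF _ _ _ m's conv g(1)])
    show "finite_measure (state_avg (r (r' n)))" for n
      using in_prob_algebraD(1)[OF state_avg] by (simp add: prob_space_def)
    show "finite_measure m'" using m'1 by (simp add: prob_space_def)
    show "sets (state_avg (r (r' n))) = sets X" for n by (rule in_prob_algebraD(2)[OF state_avg])
  qed (use g(2) in simp_all)
  have "m' \<bind> transition \<phi> = m'"
  proof (rule measure_eqI)
    show "sets (m' \<bind> transition \<phi>) = sets m'"
      using sets_bind'[OF m'P transition_measurable[OF kernel]] m's by simp
    fix B assume "B \<in> sets (m' \<bind> transition \<phi>)"
    then have B: "B \<in> sets X" using sets_bind'[OF m'P transition_measurable[OF kernel]] by simp
    define q where "q y = measure (transition \<phi> y) B" for y
    have qM: "q \<in> borel_measurable X"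
      unfolding q_def by (rule measurable_compose[OF transition_measurable[OF kernel] measurable_measure_prob_algebra[OF B]])
    have tp: "prob_space (transition \<phi> y)" if "y \<in> states M" for y
      using kernelD(1)[OF transition_measurable[OF kernel]] that by simp
    have q1: "\<bar>q y\<bar> \<le> 1" if "y \<in> states M" for y
      using prob_space.prob_le_1[OF tp[OF that]] by (simp add: q_def)
    have qe: "(\<integral>y. q y \<partial>s) = enn2real (\<integral>\<^sup>+y. emeasure (transition \<phi> y) B \<partial>s)" if s: "s \<in> space (prob_algebra X)" for s
    proof -
      have "q \<in> borel_measurable s" using qM measurable_cong_sets[OF in_prob_algebraD(2)[OF s] refl] by blast
      then have "(\<integral>y. q y \<partial>s) = enn2real (\<integral>\<^sup>+y. ennreal (q y) \<partial>s)"
        by (intro integral_eq_nn_integral) (assumption, simp add: q_def)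
      also have "(\<integral>\<^sup>+y. ennreal (q y) \<partial>s) = (\<integral>\<^sup>+y. emeasure (transition \<phi> y) B \<partial>s)"
        using tp in_prob_algebraD(3)[OF s]
        by (intro nn_integral_cong) (simp add: q_def finite_measure.emeasure_eq_measure prob_space_def)
      finally show ?thesis .
    qed
    have "(\<integral>y. q y \<partial>state_avg n) = (\<integral>k. measure (kernel M k) B \<partial>avg_occ n)" for n
    proof -
      have "(\<integral>\<^sup>+y. emeasure (transition \<phi> y) B \<partial>state_avg n)
          = (\<integral>\<^sup>+y. \<integral>\<^sup>+k. emeasure (kernel M k) B \<partial>act_law M (\<phi> y) y \<partial>state_avg n)"
        unfolding transition_def using in_prob_algebraD(3)[OF state_avg]
        by (intro nn_integral_cong emeasure_bind_prob_algebra[OF act_law_in_prob_algebra kernel_measurable B]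
            stationary_kernel_decision[OF kernel]) simp_all
      also have "\<dots> = (\<integral>\<^sup>+k. emeasure (kernel M k) B \<partial>avg_occ n)"
        by (rule nn_integral_avg_occ_state[OF kernel_emeasure_measurable[OF B], symmetric])
      finally show ?thesis by (simp add: qe[OF state_avg] integral_kernel_measure[OF avg_occ B])
    qed
    then have "(\<lambda>n. measure (state_avg n) B - (\<integral>y. q y \<partial>state_avg n)) \<longlonglongrightarrow> 0"
      using avg_occ_defect[OF B] by (simp add: measure_def emeasure_state_avg[OF B])
    from LIMSEQ_subseq_LIMSEQ[OF LIMSEQ_subseq_LIMSEQ[OF this r(1)] r']
    have "(\<lambda>n. measure (state_avg (r (r' n))) B - (\<integral>y. q y \<partial>state_avg (r (r' n)))) \<longlonglongrightarrow> 0"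
      by (simp add: comp_def)
    moreover have "(\<lambda>n. measure (state_avg (r (r' n))) B - (\<integral>y. q y \<partial>state_avg (r (r' n)))) \<longlonglongrightarrow>
        measure m' B - (\<integral>y. q y \<partial>m')"
      by (intro tendsto_diff conv B lim[OF qM q1])
    ultimately have eq: "measure m' B = (\<integral>y. q y \<partial>m')"
      using LIMSEQ_unique by fastforce
    have "emeasure (m' \<bind> transition \<phi>) B = (\<integral>\<^sup>+y. emeasure (transition \<phi> y) B \<partial>m')"
      by (rule emeasure_bind_prob_algebra[OF m'P transition_measurable[OF kernel] B])
    then have "measure (m' \<bind> transition \<phi>) B = measure m' B"
      using eq by (simp add: measure_def qe[OF m'P])
    moreover have "prob_space (m' \<bind> transition \<phi>)" by (rule prob_space_bind'[OF m'P transition_measurable[OF kernel]])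
    ultimately show "emeasure (m' \<bind> transition \<phi>) B = emeasure m' B"
      using m'1 by (simp add: finite_measure.emeasure_eq_measure prob_space_def)
  qed
  then have "m' = m" by (intro unique m'P m'le)
  then have "(\<lambda>n. \<integral>x. h x \<partial>state_avg (r (r' n))) \<longlonglongrightarrow> (\<integral>x. h x \<partial>m)" using lim[OF h] by simp
  from tendstoD[OF this e] obtain n where "dist (\<integral>x. h x \<partial>state_avg (r (r' n))) (\<integral>x. h x \<partial>m) < e"
    by (auto simp: eventually_sequentially)
  then show False using r(2) by blast
qed

text \<open>Given the state, the expected cost under \<open>\<phi>\<close> is a bounded function of the state, so its averages
  converge to its integral under \<open>m\<close>.\<close>

lemma average_cost_stationary_le:
  assumes \<nu>: "finite_measure \<nu>" "sets \<nu> = sets X"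
      "\<And>k B. k \<in> graph_set M \<Longrightarrow> B \<in> sets X \<Longrightarrow> emeasure (kernel M k) B \<le> emeasure \<nu> B"
    and m: "m \<in> space (prob_algebra X)"
    and unique: "\<And>m'. m' \<in> space (prob_algebra X) \<Longrightarrow> (\<And>B. B \<in> sets X \<Longrightarrow> emeasure m' B \<le> emeasure \<nu> B) \<Longrightarrow>
      m' \<bind> transition \<phi> = m' \<Longrightarrow> m' = m"
    and C: "\<And>k. k \<in> graph_set M \<Longrightarrow> cost M k \<le> C" "0 \<le> C"
  shows "average_cost M x\<^sub>0 (stationary \<phi>) \<le> mean_cost M (joint m \<phi>)"
proof -
  have c: "(\<lambda>k. ennreal (cost M k)) \<in> borel_measurable G" using cost_measurable by simp
  have mean_le: "mean_cost M \<mu> \<le> ennreal C" if \<mu>: "\<mu> \<in> space (prob_algebra G)" for \<mu>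
  proof -
    have "mean_cost M \<mu> \<le> (\<integral>\<^sup>+k. ennreal C \<partial>\<mu>)"
      unfolding mean_cost_def using C(1) in_prob_algebraD(3)[OF \<mu>] by (intro nn_integral_mono ennreal_leI) simp
    also have "\<dots> = ennreal C" using prob_space.emeasure_space_1[OF in_prob_algebraD(1)[OF \<mu>]] by simp
    finally show ?thesis .
  qed
  define h where "h y = enn2real (mean_cost M (act_law M (\<phi> y) y))" for y
  have Ile: "mean_cost M (act_law M (\<phi> y) y) \<le> ennreal C" if "y \<in> states M" for y
    by (rule mean_le[OF act_law_in_prob_algebra[OF that stationary_kernel_decision[OF kernel that]]])
  have he: "ennreal (h y) = mean_cost M (act_law M (\<phi> y) y)" if "y \<in> states M" for y
    using Ile[OF that] unfolding h_def by (intro ennreal_enn2real) (auto simp: less_top[symmetric] top_unique)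
  have hC: "\<bar>h y\<bar> \<le> C" if "y \<in> states M" for y
    using enn2real_mono[OF Ile[OF that]] C(2) by (simp add: h_def)
  have hM: "h \<in> borel_measurable X"
    unfolding h_def mean_cost_def using act_integral_measurable[OF c] by simp
  have int: "(\<integral>\<^sup>+y. mean_cost M (act_law M (\<phi> y) y) \<partial>s) = ennreal (\<integral>y. h y \<partial>s)" if s: "s \<in> space (prob_algebra X)" for s
  proof -
    interpret s: prob_space s by (rule in_prob_algebraD[OF s])
    have "h \<in> borel_measurable s" using hM measurable_cong_sets[OF in_prob_algebraD(2)[OF s] refl] by blast
    then have i: "integrable s h" using hC in_prob_algebraD(3)[OF s] by (intro s.integrable_const_bound[of _ C]) auto
    have "(\<integral>\<^sup>+y. mean_cost M (act_law M (\<phi> y) y) \<partial>s) = (\<integral>\<^sup>+y. ennreal (h y) \<partial>s)"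
      using in_prob_algebraD(3)[OF s] he by (intro nn_integral_cong) simp
    also have "\<dots> = ennreal (\<integral>y. h y \<partial>s)" by (rule nn_integral_eq_integral[OF i]) (simp add: h_def)
    finally show ?thesis .
  qed
  have "mean_cost M (avg_occ n) = ennreal (\<integral>y. h y \<partial>state_avg n)" for n
    using nn_integral_avg_occ_state[OF c] int[OF state_avg] by (simp add: mean_cost_def)
  moreover have "mean_cost M (joint m \<phi>) = ennreal (\<integral>y. h y \<partial>m)"
    using nn_integral_joint[OF m kernel c] int[OF m] by (simp add: mean_cost_def)
  moreover have "(\<lambda>n. ennreal (\<integral>y. h y \<partial>state_avg n)) \<longlonglongrightarrow> ennreal (\<integral>y. h y \<partial>m)"
    by (intro tendsto_ennrealI state_avg_integral_tendsto[OF \<nu> unique hM hC])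
  ultimately have lim: "(\<lambda>n. mean_cost M (avg_occ n)) \<longlonglongrightarrow> mean_cost M (joint m \<phi>)" by simp
  let ?S = "\<lambda>T. (\<Sum>t<T. mean_cost M (occ t)) / of_nat T"
  \<comment> \<open>The cost of time \<open>0\<close> is at most \<open>C\<close>.\<close>
  have le: "?S (n + 1) \<le> ennreal (C / real (Suc n)) + mean_cost M (avg_occ n)" for n
  proof -
    have "(\<Sum>t<n + 1. mean_cost M (occ t)) = mean_cost M (occ 0) + (\<Sum>t=1..n. mean_cost M (occ t))"
      by (simp add: lessThan_Suc_atMost atMost_atLeast0 sum.atLeast_Suc_atMost)
    also have "\<dots> \<le> ennreal C + (\<Sum>t=1..Suc n. mean_cost M (occ t))"
      by (intro add_mono mean_le[OF occ] sum_mono2) auto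
    finally have "?S (n + 1) \<le> (ennreal C + (\<Sum>t=1..Suc n. mean_cost M (occ t))) / of_nat (Suc n)"
      by (simp only: Suc_eq_plus1[symmetric] divide_right_mono_ennreal)
    also have "\<dots> = ennreal C / of_nat (Suc n) + mean_cost M (avg_occ n)"
      unfolding mean_cost_avg_occ by (rule add_divide_distrib_ennreal)
    also have "ennreal C / of_nat (Suc n) = ennreal (C / real (Suc n))"
      using C(2) by (simp only: ennreal_of_nat_eq_real_of_nat) (intro divide_ennreal; simp)
    finally show ?thesis .
  qed
  have "average_cost M x\<^sub>0 (stationary \<phi>) = limsup (\<lambda>n. ?S (n + 1))"
    unfolding average_cost_eq by (rule limsup_shift[symmetric])
  also have "\<dots> \<le> limsup (\<lambda>n. ennreal (C / real (Suc n)) + mean_cost M (avg_occ n))"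
    by (intro Limsup_mono always_eventually allI le)
  also have "\<dots> = mean_cost M (joint m \<phi>)"
  proof (rule lim_imp_Limsup)
    have "(\<lambda>n. C * (1 / real (Suc n))) \<longlonglongrightarrow> C * 0"
      by (intro tendsto_mult tendsto_const LIMSEQ_Suc[OF lim_1_over_n])
    then have "(\<lambda>n. ennreal (C / real (Suc n))) \<longlonglongrightarrow> ennreal 0" by (intro tendsto_ennrealI) simp
    from tendsto_add[OF this lim]
    show "(\<lambda>n. ennreal (C / real (Suc n)) + mean_cost M (avg_occ n)) \<longlonglongrightarrow> mean_cost M (joint m \<phi>)" by simp
  qed simp
  finally show ?thesis .
qed

end

section \<open>Existence of optimal measures and optimal policies\<close>

context borel_controlled
begin

lemma stationary_kernel_exists: "\<exists>\<phi>. stationary_kernel \<phi>"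
proof -
  have s: "sel 0 \<in> X \<rightarrow>\<^sub>M A"
    unfolding borel_actions_def
    by (rule measurable_restrict_space2) (use sel_in feasible_actions measurable_sel in auto)
  have "(\<lambda>x. return A (sel 0 x)) \<in> X \<rightarrow>\<^sub>M prob_algebra A"
    by (rule measurable_compose[OF s measurable_return_prob_space])
  moreover have "emeasure (return A (sel 0 x)) (feasible M x) = 1" if "x \<in> states M" for x
  proof -
    have "feasible M x \<in> sets A" using feasible_borel[OF that] feasible_actions[OF that] by (simp add: sets_A_iff)
    then show ?thesis using sel_in[of x 0] that by simp
  qed
  ultimately show ?thesis unfolding stationary_kernel_def by blast
qed

text \<open>A policy of finite average cost supplies an invariant measure of finite mean cost.\<close>

theorem optimal_measure:
  assumes B: "cond_B M" and C: "cond_C M" and D: "cond_D M"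
  shows "\<exists>\<mu>\<in>invariant_measures M. mean_cost M \<mu> = (INF \<mu>'\<in>invariant_measures M. mean_cost M \<mu>')"
proof -
  obtain \<nu> where \<nu>: "finite_measure \<nu>" "sets \<nu> = sets X"
    "\<And>k B. k \<in> graph_set M \<Longrightarrow> B \<in> sets X \<Longrightarrow> emeasure (kernel M k) B \<le> emeasure \<nu> B"
    using D by (auto simp: cond_D_def)
  have cost: "continuous_on (feasible M x) (\<lambda>u. cost M (x, u))" if "x \<in> states M" for x
    using B that by (simp add: cond_B_def)
  obtain \<gamma> x and \<eta> :: real where \<gamma>: "\<gamma> \<in> admissible_policies M" "x \<in> states M" "average_cost M x \<gamma> = ennreal \<eta>"
    using C by (auto simp: cond_C_def)
  interpret controlled_process M \<gamma> x by unfold_locales (rule \<gamma>)+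
  obtain N where N: "action_tight (\<lambda>n. avg_occ (n + N))"
    using action_tight_avg_occ[OF B] \<gamma>(3) by auto
  have "\<exists>\<mu>\<in>invariant_measures M. mean_cost M \<mu> \<le> average_cost M x \<gamma>"
    by (rule invariant_measure_below_average_cost[OF D cost \<nu> N])
  then obtain \<mu> where \<mu>: "\<mu> \<in> invariant_measures M" "mean_cost M \<mu> \<le> ennreal \<eta>" using \<gamma>(3) by auto
  have fin: "mean_cost M \<mu> < \<top>" using \<mu>(2) by (rule le_less_trans) simp
  have tight: "action_tight \<mu>'"
    if "\<And>n. \<mu>' n \<in> space (prob_algebra G)" "0 \<le> C" "\<And>n. mean_cost M (\<mu>' n) \<le> ennreal C" for \<mu>' C
    by (rule action_tight_of_bounded_cost[OF B that(1,3,2)])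
  have "\<exists>m \<phi>. m \<in> space (prob_algebra X) \<and> (\<forall>B\<in>sets X. emeasure m B \<le> emeasure \<nu> B) \<and> stationary_kernel \<phi> \<and>
    joint m \<phi> \<in> invariant_measures M \<and>
    mean_cost M (joint m \<phi>) = (INF \<mu>\<in>invariant_measures M. mean_cost M \<mu>)"
    by (rule optimal_invariant_measure_exists[OF D cost \<nu> tight \<mu>(1) fin])
  then show ?thesis by blast
qed

text \<open>The disintegration of an optimal invariant measure is the optimal policy: from every initial state
  it attains the minimal mean cost over the invariant measures, which bounds the cost of every policy
  from below.\<close>

theorem optimal_stationary_policy:
  assumes compact: "compact (actions M)" and B: "cond_B' M" and D: "cond_D M" and E: "cond_E M"
  shows "\<exists>\<phi>\<in>stationary_policies M. \<forall>x\<in>states M.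
    average_cost M x \<phi> = (INF \<gamma>\<in>admissible_policies M. average_cost M x \<gamma>)"
proof (cases "states M = {}")
  case True
  then show ?thesis using stationary_kernel_exists by (auto simp: stationary_policies_eq)
next
  case False
  then obtain x\<^sub>1 where x1: "x\<^sub>1 \<in> states M" by blast
  obtain \<nu> where \<nu>: "finite_measure \<nu>" "sets \<nu> = sets X"
    "\<And>k B. k \<in> graph_set M \<Longrightarrow> B \<in> sets X \<Longrightarrow> emeasure (kernel M k) B \<le> emeasure \<nu> B"
    using D by (auto simp: cond_D_def)
  have cost: "continuous_on (feasible M x) (\<lambda>u. cost M (x, u))" if "x \<in> states M" for x
    using B that by (simp add: cond_B'_def)
  obtain C where C: "\<And>k. k \<in> graph_set M \<Longrightarrow> cost M k \<le> C" "0 \<le> C"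
  proof -
    obtain b where "\<And>k. k \<in> graph_set M \<Longrightarrow> norm (cost M k) \<le> b"
      using B by (auto simp: cond_B'_def bounded_iff)
    then have "cost M k \<le> \<bar>b\<bar>" if "k \<in> graph_set M" for k using that by (fastforce simp: abs_le_iff)
    then show ?thesis by (rule that[OF _ abs_ge_zero])
  qed
  have tight: "action_tight \<mu>" for \<mu> by (rule action_tight_of_compact_actions[OF compact])
  have below: "\<exists>\<mu>\<in>invariant_measures M. mean_cost M \<mu> \<le> average_cost M x \<gamma>"
    if "\<gamma> \<in> admissible_policies M" "x \<in> states M" for \<gamma> x
  proof -
    interpret controlled_process M \<gamma> x by unfold_locales (rule that)+
    show ?thesis by (rule invariant_measure_below_average_cost[where N=0, OF D cost \<nu> tight])
  qed
  obtain \<phi>\<^sub>1 where "stationary_kernel \<phi>\<^sub>1" using stationary_kernel_exists by blast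
  from below[OF stationary_admissible[OF this] x1] obtain \<mu>\<^sub>0 where \<mu>0: "\<mu>\<^sub>0 \<in> invariant_measures M" by blast
  have fin: "mean_cost M \<mu>\<^sub>0 < \<top>"
  proof -
    note P = in_prob_algebraD[OF invariantD(1)[OF \<mu>0]]
    have "mean_cost M \<mu>\<^sub>0 \<le> (\<integral>\<^sup>+k. ennreal C \<partial>\<mu>\<^sub>0)"
      unfolding mean_cost_def using C(1) P(3) by (intro nn_integral_mono ennreal_leI) simp
    also have "\<dots> < \<top>" using prob_space.emeasure_space_1[OF P(1)] by simp
    finally show ?thesis .
  qed
  have "\<exists>m \<phi>. m \<in> space (prob_algebra X) \<and> (\<forall>B\<in>sets X. emeasure m B \<le> emeasure \<nu> B) \<and> stationary_kernel \<phi> \<and>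
    joint m \<phi> \<in> invariant_measures M \<and>
    mean_cost M (joint m \<phi>) = (INF \<mu>\<in>invariant_measures M. mean_cost M \<mu>)"
    by (rule optimal_invariant_measure_exists[OF D cost \<nu> tight \<mu>0 fin])
  then obtain m \<phi> where m: "m \<in> space (prob_algebra X)" "\<And>B. B \<in> sets X \<Longrightarrow> emeasure m B \<le> emeasure \<nu> B"
    and \<phi>: "stationary_kernel \<phi>" and inv: "joint m \<phi> \<in> invariant_measures M"
    and opt: "mean_cost M (joint m \<phi>) = (INF \<mu>\<in>invariant_measures M. mean_cost M \<mu>)" by blast
  have harris: "harris_recurrent M (stationary \<phi>)"
    using E \<phi> by (auto simp: cond_E_def stationary_policies_eq)
  show ?thesis
  proof (intro bexI[of _ "stationary \<phi>"] ballI antisym INF_greatest)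
    show "stationary \<phi> \<in> stationary_policies M" using \<phi> by (simp add: stationary_policies_eq)
    fix x assume x: "x \<in> states M"
    show "(INF \<gamma>\<in>admissible_policies M. average_cost M x \<gamma>) \<le> average_cost M x (stationary \<phi>)"
      by (rule INF_lower[OF stationary_admissible[OF \<phi>]])
    fix \<gamma> assume \<gamma>: "\<gamma> \<in> admissible_policies M"
    interpret stationary_process M \<phi> x by unfold_locales (rule \<phi>, rule x)
    have "average_cost M x (stationary \<phi>) \<le> mean_cost M (joint m \<phi>)"
    proof (rule average_cost_stationary_le[OF \<nu> m(1) _ C])
      fix m' assume m': "m' \<in> space (prob_algebra X)" "\<And>B. B \<in> sets X \<Longrightarrow> emeasure m' B \<le> emeasure \<nu> B"
        "m' \<bind> transition \<phi> = m'"
      show "m' = m"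
        by (rule harris_unique_invariant[OF \<phi> harris \<nu>(1,2) m'(1) m(1) m'(2) m(2) m'(3) invariant_joint_iff[OF m(1) \<phi>, THEN iffD1, OF inv]])
    qed
    also obtain \<mu> where \<mu>: "\<mu> \<in> invariant_measures M" "mean_cost M \<mu> \<le> average_cost M x \<gamma>"
      using below[OF \<gamma> x] by blast
    note opt
    also have "(INF \<mu>\<in>invariant_measures M. mean_cost M \<mu>) \<le> mean_cost M \<mu>" by (rule INF_lower[OF \<mu>(1)])
    also note \<mu>(2)
    finally show "average_cost M x (stationary \<phi>) \<le> average_cost M x \<gamma>" .
  qed
qed

end

theorem theorem2p2:
  fixes M :: "('x::polish_space, 'u::polish_space) control_model"
  assumes "controlled_markov_chain M"
  shows "(cond_A M \<and> cond_B M \<and> cond_C M \<and> cond_D M \<longrightarrow>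
            (\<exists>\<mu>\<in>invariant_measures M. mean_cost M \<mu> = (INF \<mu>'\<in>invariant_measures M. mean_cost M \<mu>'))) \<and>
         (cond_A' M \<and> cond_B' M \<and> cond_D M \<and> cond_E M \<longrightarrow>
            (\<exists>\<phi>\<in>stationary_policies M. \<forall>x\<in>states M.
               average_cost M x \<phi> = (INF \<gamma>\<in>admissible_policies M. average_cost M x \<gamma>)))"
proof (intro conjI impI)
  assume a: "cond_A M \<and> cond_B M \<and> cond_C M \<and> cond_D M"
  interpret borel_controlled M
    by unfold_locales (use assms a in \<open>auto simp: cond_A_def\<close>)
  show "\<exists>\<mu>\<in>invariant_measures M. mean_cost M \<mu> = (INF \<mu>'\<in>invariant_measures M. mean_cost M \<mu>')"
    by (rule optimal_measure) (use a in auto)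
next
  assume b: "cond_A' M \<and> cond_B' M \<and> cond_D M \<and> cond_E M"
  interpret borel_controlled M
    by unfold_locales (use assms b in \<open>auto simp: cond_A'_def\<close>)
  show "\<exists>\<phi>\<in>stationary_policies M. \<forall>x\<in>states M.
      average_cost M x \<phi> = (INF \<gamma>\<in>admissible_policies M. average_cost M x \<gamma>)"
    by (rule optimal_stationary_policy) (use b in \<open>auto simp: cond_A'_def\<close>)
qed

end
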